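(* Let $f\in L^2_{\mathrm{per}}(Y)$, let $A\in\mathcal{M}(\lambda,\Lambda)$ for some $\lambda,\Lambda>0$, and suppose that $A$ satisfies the Cordes condition with constant $\delta\in(0,1]$. Let $\gamma:=\frac{\mathrm{tr}(A)}{|A|^2}\in L^\infty_{\mathrm{per}}(Y)$, $C_\delta:=(1-\sqrt{1-\delta})^{-1}$, and $b_0(\varphi_1,\varphi_2):=(\gamma A:D^2\varphi_1,\Delta\varphi_2)_{L^2(Y)}$ for $\varphi_1,\varphi_2\in H^2_{\mathrm{per}}(Y)$. Let $r\in L^2_{\mathrm{per}}(Y)$ denote the unique invariant measure to $A$. Consider the problem $$-A:D^2v=f\quad\text{in }Y,\qquad v\ \text{is }Y\text{-periodic}.\qquad(\ast)$$ Then: (i) There exists a solution $v\in H^2_{\mathrm{per}}(Y)$ to $(\ast)$ if, and only if, $(f,r)_{L^2(Y)}=0$. Moreover, if $(f,r)_{L^2(Y)}=0$, then $v\in H^2_{\mathrm{per}}(Y)$ is a solution to $(\ast)$ if, and only if, $b_0(v,\varphi)=-(\gamma f,\Delta\varphi)_{L^2(Y)}$ for any $\varphi\in H^2_{\mathrm{per}}(Y)$. (ii) If $(f,r)_{L^2(Y)}=0$ and $v_1,v_2\in H^2_{\mathrm{per}}(Y)$ are solutions to $(\ast)$, then $v_1-v_2=\mathrm{const.}$ almost everywhere. In particular, the problem $(\ast)$ has a unique solution if $\int_Yv$ is prescribed. (iii) If $(f,r)_{L^2(Y)}=0$, then the unique solution $v_0\in H^2_{\mathrm{per},0}(Y)$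 to $(\ast)$ subject to $\int_Yv_0=0$ satisfies the bound $$\|\Delta v_0\|_{L^2(Y)}\le\frac{\Lambda}{\lambda^2}C_\delta\|f\|_{L^2(Y)}.$$
   Context: $Y:=(0,1)^n$; "$Y$-periodic" means $\mathbb{Z}^n$-periodic. For $\lambda,\Lambda>0$, $\mathcal{M}(\lambda,\Lambda)$ denotes the set of all $Y$-periodic $A\in L^\infty(\mathbb{R}^n;\mathbb{R}^{n\times n}_{\mathrm{sym}})$ such that $\lambda|\xi|^2\le A\xi\cdot\xi\le\Lambda|\xi|^2$ a.e. in $\mathbb{R}^n$ for all $\xi\in\mathbb{R}^n\setminus\{0\}$. For matrices, $P:Q:=\sum_{i,j}p_{ij}q_{ij}$ and $|P|:=\sqrt{P:P}$. $A$ satisfies the Cordes condition with constant $\delta\in(0,1]$ if $\frac{|A|^2}{(\mathrm{tr}(A))^2}\le\frac{1}{n-1+\delta}$ a.e. in $\mathbb{R}^n$. $L^2_{\mathrm{per}}(Y)$, $L^\infty_{\mathrm{per}}(Y)$, $H^k_{\mathrm{per}}(Y)$ are the usual spaces of $Y$-periodic functions, and $H^k_{\mathrm{per},0}(Y):=\{\varphi\in H^k_{\mathrm{per}}(Y):\int_Y\varphi=0\}$. Solutions $v\in H^2_{\mathrm{per}}(Y)$ to $(\ast)$ satisfy the equation almost everywhere. An invariant measure to $A$ is a function $r\in L^2_{\mathrm{per}}(Y)$ with $\int_Yr=1$ and $(r,-A:D^2\varphi)_{L^2(Y)}=0$ for all $\varphi\in H^2_{\mathrm{per}}(Y)$; under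 the Cordes condition it exists and is unique. *)

theory Defs
  imports "HOL-Analysis.Analysis"
begin

text \<open>
  The dimension is \<open>n = CARD('n)\<close>. On matrices of type \<open>real^'n^'n\<close> the library inner product
  is the Frobenius product \<open>P : Q\<close> and the library norm is \<open>sqrt (P : P)\<close>.
  Elements of the Lebesgue and Sobolev spaces are represented by functions on the whole space;
  every condition imposed on such representatives is invariant under modification on a null set.
\<close>

lemma matrix_inner_eq: "(P :: real^'n^'n) \<bullet> Q = (\<Sum>i\<in>UNIV. \<Sum>j\<in>UNIV. P$i$j * Q$i$j)"
  by (simp add: inner_vec_def)

lemma matrix_norm_eq: "norm (P :: real^'n^'n) = sqrt (\<Sum>i\<in>UNIV. \<Sum>j\<in>UNIV. P$i$j * P$i$j)"
  by (simp add: norm_eq_sqrt_inner inner_vec_def)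


section \<open>Periodic functions\<close>

definition unit_cell :: "(real^'n) set" where
  "unit_cell = box 0 1"

lemma unit_cell_eq: "unit_cell = {x :: real^'n. \<forall>i. 0 < x$i \<and> x$i < 1}"
  by (auto simp: unit_cell_def mem_box_cart)

definition int_vecs :: "(real^'n) set" where
  "int_vecs = {k. \<forall>i. k$i \<in> \<int>}"

definition periodic :: "(real^'n \<Rightarrow> 'b) \<Rightarrow> bool" where
  "periodic u \<longleftrightarrow> (\<forall>k\<in>int_vecs. \<forall>x. u (x + k) = u x)"

definition ae_periodic :: "(real^'n \<Rightarrow> 'b) \<Rightarrow> bool" where
  "ae_periodic u \<longleftrightarrow> (\<forall>k\<in>int_vecs. AE x in lebesgue. u (x + k) = u x)"

definition cell_integral :: "(real^'n \<Rightarrow> real) \<Rightarrow> real" where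
  "cell_integral u = integral\<^sup>L (lebesgue_on unit_cell) u"

definition L2_inner :: "(real^'n \<Rightarrow> real) \<Rightarrow> (real^'n \<Rightarrow> real) \<Rightarrow> real" where
  "L2_inner u w = cell_integral (\<lambda>x. u x * w x)"

definition L2_norm :: "(real^'n \<Rightarrow> real) \<Rightarrow> real" where
  "L2_norm u = sqrt (L2_inner u u)"

definition L2_per :: "(real^'n \<Rightarrow> real) set" where
  "L2_per = {u. u \<in> borel_measurable lebesgue \<and> ae_periodic u \<and>
                integrable (lebesgue_on unit_cell) (\<lambda>x. (u x)\<^sup>2)}"


section \<open>Smooth periodic test functions, weak derivatives and Sobolev spaces\<close>

definition partial :: "'n \<Rightarrow> (real^'n \<Rightarrow> real) \<Rightarrow> real^'n \<Rightarrow> real" where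
  "partial i u x = frechet_derivative u (at x) (axis i 1)"

primrec C_diff :: "nat \<Rightarrow> (real^'n \<Rightarrow> real) \<Rightarrow> bool" where
  "C_diff 0 u \<longleftrightarrow> continuous_on UNIV u"
| "C_diff (Suc k) u \<longleftrightarrow> (\<forall>x. u differentiable (at x)) \<and> (\<forall>i. C_diff k (partial i u))"

definition smooth_per :: "(real^'n \<Rightarrow> real) set" where
  "smooth_per = {u. (\<forall>k. C_diff k u) \<and> periodic u}"

text \<open>
  \<open>weak_partial i u g\<close>: the function \<open>g\<close> is the \<open>i\<close>-th weak partial derivative of \<open>u\<close> in the sense
  of periodic distributions, i.e. on the torus. No boundary terms appear in the integration by
  parts over the cell because both factors are periodic.
\<close>

definition weak_partial :: "'n \<Rightarrow> (real^'n \<Rightarrow> real) \<Rightarrow> (real^'n \<Rightarrow> real) \<Rightarrow> bool" where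
  "weak_partial i u g \<longleftrightarrow> u \<in> L2_per \<and> g \<in> L2_per \<and>
     (\<forall>\<phi>\<in>smooth_per. L2_inner u (partial i \<phi>) = - L2_inner g \<phi>)"

text \<open>\<open>H_per k\<close> consists of the periodic functions all of whose weak derivatives of order at most
  \<open>k\<close> exist and are square integrable over the cell.\<close>

primrec H_per :: "nat \<Rightarrow> (real^'n \<Rightarrow> real) set" where
  "H_per 0 = L2_per"
| "H_per (Suc k) = {u \<in> L2_per. \<forall>i. \<exists>g\<in>H_per k. weak_partial i u g}"

definition H_per0 :: "nat \<Rightarrow> (real^'n \<Rightarrow> real) set" where
  "H_per0 k = {u \<in> H_per k. cell_integral u = 0}"

text \<open>A representative of the weak derivative, which is unique up to null sets; meaningful only
  if a weak derivative exists.\<close>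

definition wpartial :: "'n \<Rightarrow> (real^'n \<Rightarrow> real) \<Rightarrow> real^'n \<Rightarrow> real" where
  "wpartial i u = (SOME g. weak_partial i u g)"

definition hessian :: "(real^'n \<Rightarrow> real) \<Rightarrow> real^'n \<Rightarrow> real^'n^'n" where
  "hessian u x = (\<chi> i j. wpartial i (wpartial j u) x)"

definition laplacian :: "(real^'n \<Rightarrow> real) \<Rightarrow> real^'n \<Rightarrow> real" where
  "laplacian u x = (\<Sum>i\<in>UNIV. wpartial i (wpartial i u) x)"


section \<open>Coefficients, invariant measures and the periodic problem\<close>

definition coeff_class :: "real \<Rightarrow> real \<Rightarrow> (real^'n \<Rightarrow> real^'n^'n) set" where
  "coeff_class l L = {A. A \<in> borel_measurable lebesgue \<and> ae_periodic A \<and>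
     (\<exists>C. AE x in lebesgue. norm (A x) \<le> C) \<and>
     (AE x in lebesgue. transpose (A x) = A x) \<and>
     (AE x in lebesgue. \<forall>\<xi>. \<xi> \<noteq> 0 \<longrightarrow>
        l * (norm \<xi>)\<^sup>2 \<le> (A x *v \<xi>) \<bullet> \<xi> \<and> (A x *v \<xi>) \<bullet> \<xi> \<le> L * (norm \<xi>)\<^sup>2)}"

definition cordes :: "real \<Rightarrow> (real^'n \<Rightarrow> real^'n^'n) \<Rightarrow> bool" where
  "cordes \<delta> A \<longleftrightarrow>
     (AE x in lebesgue. (norm (A x))\<^sup>2 / (trace (A x))\<^sup>2 \<le> 1 / (real CARD('n) - 1 + \<delta>))"

definition cordes_scaling :: "(real^'n \<Rightarrow> real^'n^'n) \<Rightarrow> real^'n \<Rightarrow> real" where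
  "cordes_scaling A x = trace (A x) / (norm (A x))\<^sup>2"

definition cordes_const :: "real \<Rightarrow> real" where
  "cordes_const \<delta> = inverse (1 - sqrt (1 - \<delta>))"

definition b0 :: "(real^'n \<Rightarrow> real^'n^'n) \<Rightarrow> (real^'n \<Rightarrow> real) \<Rightarrow> (real^'n \<Rightarrow> real) \<Rightarrow> real" where
  "b0 A \<phi>1 \<phi>2 =
     L2_inner (\<lambda>x. cordes_scaling A x * (A x \<bullet> hessian \<phi>1 x)) (laplacian \<phi>2)"

definition invariant_measure :: "(real^'n \<Rightarrow> real^'n^'n) \<Rightarrow> (real^'n \<Rightarrow> real) \<Rightarrow> bool" where
  "invariant_measure A r \<longleftrightarrow> r \<in> L2_per \<and> cell_integral r = 1 \<and>
     (\<forall>\<phi>\<in>H_per 2. L2_inner r (\<lambda>x. - (A x \<bullet> hessian \<phi> x)) = 0)"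

definition is_solution ::
  "(real^'n \<Rightarrow> real^'n^'n) \<Rightarrow> (real^'n \<Rightarrow> real) \<Rightarrow> (real^'n \<Rightarrow> real) \<Rightarrow> bool" where
  "is_solution A f v \<longleftrightarrow> v \<in> H_per 2 \<and>
     (AE x in lebesgue_on unit_cell. - (A x \<bullet> hessian v x) = f x)"

end

theory Submission
  imports Defs
begin

text \<open>
  After multiplication by \<open>\<gamma> = tr A / |A|\<^sup>2\<close> the operator \<open>A : D\<^sup>2\<close> is close to the Laplacian.
  Indeed \<open>\<gamma>\<close> minimises the distance of \<open>t A\<close> from the identity matrix among all reals \<open>t\<close>, and the
  Cordes condition says precisely that the minimal squared distance \<open>n - (tr A)\<^sup>2 / |A|\<^sup>2\<close> is at
  most \<open>1 - \<delta>\<close>. On the torus the Hessian and the Laplacian of a function have the same norm in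
  \<open>L\<^sup>2\<close> (\<open>Miranda_Talenti\<close>), hence \<open>\<Delta>v - \<gamma> A : D\<^sup>2v\<close> has norm at most \<open>\<theta> = sqrt (1 - \<delta>) < 1\<close> times
  that of \<open>\<Delta>v\<close> (\<open>near_Laplacian\<close>). The bound on solutions and their uniqueness up to constants
  follow at once.

  For existence, this estimate and the solvability of \<open>\<Delta>v = g\<close> for every \<open>g\<close> of mean zero
  (\<open>Laplace_solvable\<close>) turn Banach's fixed point theorem into a solution of \<open>\<gamma> A : D\<^sup>2v = h + c\<close>
  with some constant \<open>c\<close>, for every square integrable \<open>h\<close> (\<open>solvable_mod_const\<close>). The invariant
  measure \<open>r\<close> removes the constant: dividing by \<open>\<gamma>\<close> and testing with \<open>r\<close> gives
  \<open>(h / \<gamma>, r) + c (1 / \<gamma>, r) = 0\<close>. The choice \<open>h = \<gamma>\<close> shows that \<open>(1 / \<gamma>, r)\<close> is nonzero, as \<open>r\<close>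
  has integral one; the choice \<open>h = - \<gamma> f\<close> then shows that \<open>c = 0\<close> when \<open>(f, r) = 0\<close>. In the
  variational formulation the test functions \<open>\<Delta>\<phi>\<close> exhaust the functions of mean zero, which again
  determines \<open>\<gamma> (A : D\<^sup>2v + f)\<close> up to a constant.

  The facts about the Laplacian rest on trigonometric polynomials. On these, the Laplacian is
  inverted explicitly, and Parseval's identity gives the equality of the norms as well as bounds
  on the lower order terms. The polynomials are dense in \<open>L\<^sup>2\<close> (\<open>trig_poly_dense\<close>), by the
  Stone--Weierstrass theorem on the torus; completeness (\<open>L2_complete\<close>) carries the solution over
  to arbitrary right-hand sides. Density also implies that weak derivatives are unique and that a
  weakly harmonic function is constant (\<open>weakly_harmonic_const\<close>), so that every function in the
  Sobolev space of order two is, up to a constant, one of the solutions constructed in this way.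
\<close>

section \<open>The space of square integrable periodic functions\<close>

abbreviation cell :: "(real^'n) measure" where
  "cell \<equiv> lebesgue_on unit_cell"

lemma unit_cell_lmeasurable: "(unit_cell :: (real^'n) set) \<in> lmeasurable"
  by (simp add: unit_cell_def)

lemma unit_cell_sets [simp, measurable]: "(unit_cell :: (real^'n) set) \<in> sets lebesgue"
  using unit_cell_lmeasurable by blast

lemma measure_unit_cell: "measure lebesgue (unit_cell :: (real^'n) set) = 1"
proof -
  have "measure lborel (box 0 1 :: (real^'n) set) = (\<Prod>b\<in>(Basis :: (real^'n) set). 1)"
    by (subst measure_lborel_box_eq) (auto simp: Basis_vec_def cart_eq_inner_axis[symmetric] intro!: prod.neutral)
  then show ?thesis
    by (simp add: unit_cell_def)
qed

lemma finite_measure_cell: "finite_measure (cell :: (real^'n) measure)"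
  by (simp add: finite_measure_lebesgue_on unit_cell_lmeasurable)

lemma measure_cell_space: "measure (cell :: (real^'n) measure) (space cell) = 1"
  by (simp add: measure_restrict_space measure_unit_cell)

lemma integrable_cell_const [simp]: "integrable (cell :: (real^'n) measure) (\<lambda>x. c :: real)"
  by (rule finite_measure.integrable_const[OF finite_measure_cell])

lemma cell_integral_const [simp]: "cell_integral (\<lambda>x::real^'n. c) = c"
  using measure_cell_space[where 'n='n] by (simp add: cell_integral_def)

lemma AE_cell_if_AE_lebesgue:
  assumes "AE x in lebesgue. P x"
  shows "AE x in (cell :: (real^'n) measure). P x"
  using assms by (subst AE_restrict_space_iff) auto

lemma ae_periodic_comp:
  assumes "ae_periodic u"
  shows "ae_periodic (\<lambda>x. F (u x))"
  using assms unfolding ae_periodic_def by fastforce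

lemma ae_periodic_comp2:
  assumes "ae_periodic u" "ae_periodic w"
  shows "ae_periodic (\<lambda>x. F (u x) (w x))"
  unfolding ae_periodic_def
proof (intro ballI)
  fix k :: "real^'a" assume "k \<in> int_vecs"
  then have "AE x in lebesgue. u (x + k) = u x" "AE x in lebesgue. w (x + k) = w x"
    using assms by (auto simp: ae_periodic_def)
  then show "AE x in lebesgue. F (u (x + k)) (w (x + k)) = F (u x) (w x)"
    by eventually_elim simp
qed

lemma ae_periodic_const [simp]: "ae_periodic (\<lambda>x. c)"
  by (simp add: ae_periodic_def)

lemma ae_periodic_if_periodic: "periodic u \<Longrightarrow> ae_periodic u"
  by (simp add: ae_periodic_def periodic_def)

lemma L2_per_measurable: "u \<in> L2_per \<Longrightarrow> u \<in> borel_measurable lebesgue"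
  by (simp add: L2_per_def)

lemma L2_per_measurable_cell [measurable_dest]: "u \<in> L2_per \<Longrightarrow> u \<in> borel_measurable cell"
  using L2_per_measurable measurable_restrict_space1 by blast

lemma L2_per_ae_periodic: "u \<in> L2_per \<Longrightarrow> ae_periodic u"
  by (simp add: L2_per_def)

lemma L2_per_square_integrable: "u \<in> L2_per \<Longrightarrow> integrable cell (\<lambda>x. (u x)\<^sup>2)"
  by (simp add: L2_per_def)

lemma L2_per_mult_integrable:
  fixes u w :: "real^'n \<Rightarrow> real"
  assumes "u \<in> L2_per" "w \<in> L2_per"
  shows "integrable cell (\<lambda>x. u x * w x)"
proof (rule Bochner_Integration.integrable_bound)
  show "integrable cell (\<lambda>x. (u x)\<^sup>2 + (w x)\<^sup>2)"
    using assms by (intro Bochner_Integration.integrable_add L2_per_square_integrable)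
  show "(\<lambda>x. u x * w x) \<in> borel_measurable cell"
    using L2_per_measurable_cell assms by (intro borel_measurable_times) auto
  have "2 * \<bar>a * b\<bar> \<le> a\<^sup>2 + b\<^sup>2" for a b :: real
    using sum_squares_bound[of "\<bar>a\<bar>" "\<bar>b\<bar>"] by (simp add: abs_mult)
  then have "\<bar>a * b\<bar> \<le> a\<^sup>2 + b\<^sup>2" for a b :: real
    using abs_ge_zero[of "a * b"] by (smt (verit))
  then show "AE x in cell. norm (u x * w x) \<le> norm ((u x)\<^sup>2 + (w x)\<^sup>2)"
    by simp
qed

lemma L2_per_const [simp]: "(\<lambda>x. c) \<in> L2_per"
  by (simp add: L2_per_def)

lemma L2_per_integrable:
  fixes u :: "real^'n \<Rightarrow> real"
  assumes "u \<in> L2_per"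
  shows "integrable cell u"
  using L2_per_mult_integrable[OF assms L2_per_const[of 1]] by simp

lemma L2_per_add:
  fixes u w :: "real^'n \<Rightarrow> real"
  assumes "u \<in> L2_per" "w \<in> L2_per"
  shows "(\<lambda>x. u x + w x) \<in> L2_per"
proof -
  have "integrable cell (\<lambda>x. (u x)\<^sup>2 + 2 * (u x * w x) + (w x)\<^sup>2)"
    using assms by (intro Bochner_Integration.integrable_add integrable_mult_right
      L2_per_square_integrable L2_per_mult_integrable)
  then have "integrable cell (\<lambda>x. (u x + w x)\<^sup>2)"
    by (simp add: power2_sum algebra_simps)
  then show ?thesis
    using assms ae_periodic_comp2[of u w "\<lambda>a b. a + b"] by (auto simp: L2_per_def)
qed

lemma L2_per_bounded_mult:
  fixes u :: "real^'n \<Rightarrow> real"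
  assumes a: "a \<in> borel_measurable lebesgue" "ae_periodic a" "AE x in lebesgue. \<bar>a x\<bar> \<le> C"
    and u: "u \<in> L2_per"
  shows "(\<lambda>x. a x * u x) \<in> L2_per"
proof -
  have meas: "(\<lambda>x. a x * u x) \<in> borel_measurable lebesgue"
    using a(1) L2_per_measurable[OF u] by (rule borel_measurable_times)
  have "integrable cell (\<lambda>x. (a x * u x)\<^sup>2)"
  proof (rule Bochner_Integration.integrable_bound)
    show "integrable cell (\<lambda>x. C\<^sup>2 * (u x)\<^sup>2)"
      using L2_per_square_integrable[OF u] by simp
    show "(\<lambda>x. (a x * u x)\<^sup>2) \<in> borel_measurable cell"
      using measurable_restrict_space1[OF meas] by (rule borel_measurable_power)
    show "AE x in cell. norm ((a x * u x)\<^sup>2) \<le> norm (C\<^sup>2 * (u x)\<^sup>2)"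
      using AE_cell_if_AE_lebesgue[OF a(3)]
    proof eventually_elim
      case (elim x)
      then have "(a x)\<^sup>2 \<le> C\<^sup>2"
        by (meson abs_ge_zero abs_le_square_iff abs_ge_self order_trans)
      then show ?case
        by (simp add: power_mult_distrib mult_right_mono)
    qed
  qed
  then show ?thesis
    using meas ae_periodic_comp2[OF a(2) L2_per_ae_periodic[OF u], of "\<lambda>a b. a * b"]
    by (simp add: L2_per_def)
qed

lemma L2_per_scale: "u \<in> L2_per \<Longrightarrow> (\<lambda>x. c * u x) \<in> L2_per"
  by (rule L2_per_bounded_mult[where C="\<bar>c\<bar>"]) auto

lemma L2_per_diff: "u \<in> L2_per \<Longrightarrow> w \<in> L2_per \<Longrightarrow> (\<lambda>x. u x - w x) \<in> L2_per"
  using L2_per_add[of u "\<lambda>x. (-1) * w x"] L2_per_scale[of w "-1"] by simp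

lemma L2_per_minus: "u \<in> L2_per \<Longrightarrow> (\<lambda>x. - u x) \<in> L2_per"
  using L2_per_scale[of u "-1"] by simp

lemma L2_per_sum: "(\<And>i. i \<in> I \<Longrightarrow> u i \<in> L2_per) \<Longrightarrow> (\<lambda>x. \<Sum>i\<in>I. u i x) \<in> L2_per"
  by (induction I rule: infinite_finite_induct) (auto intro: L2_per_add)

lemma L2_per_bounded:
  fixes a :: "real^'n \<Rightarrow> real"
  assumes "a \<in> borel_measurable lebesgue" "ae_periodic a" "AE x in lebesgue. \<bar>a x\<bar> \<le> C"
  shows "a \<in> L2_per"
  using L2_per_bounded_mult[OF assms L2_per_const[of 1]] by simp

lemma cell_integral_diff:
  "u \<in> L2_per \<Longrightarrow> w \<in> L2_per \<Longrightarrow> cell_integral (\<lambda>x. u x - w x) = cell_integral u - cell_integral w"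
  by (simp add: cell_integral_def L2_per_integrable)

lemma cell_integral_cong_AE:
  fixes u w :: "real^'n \<Rightarrow> real"
  assumes "u \<in> borel_measurable cell" "w \<in> borel_measurable cell" "AE x in cell. u x = w x"
  shows "cell_integral u = cell_integral w"
  unfolding cell_integral_def using assms by (rule integral_cong_AE)

lemma L2_inner_commute: "L2_inner u w = L2_inner w u"
  by (simp add: L2_inner_def mult.commute)

lemma L2_inner_one: "L2_inner u (\<lambda>x. 1) = cell_integral u"
  by (simp add: L2_inner_def)

lemma L2_inner_add_left:
  fixes u v w :: "real^'n \<Rightarrow> real"
  assumes "u \<in> L2_per" "v \<in> L2_per" "w \<in> L2_per"
  shows "L2_inner (\<lambda>x. u x + v x) w = L2_inner u w + L2_inner v w"
  using assms by (simp add: L2_inner_def cell_integral_def distrib_right L2_per_mult_integrable)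

lemma L2_inner_diff_left:
  fixes u v w :: "real^'n \<Rightarrow> real"
  assumes "u \<in> L2_per" "v \<in> L2_per" "w \<in> L2_per"
  shows "L2_inner (\<lambda>x. u x - v x) w = L2_inner u w - L2_inner v w"
  using assms by (simp add: L2_inner_def cell_integral_def left_diff_distrib L2_per_mult_integrable)

lemma L2_inner_scale_left:
  fixes u w :: "real^'n \<Rightarrow> real"
  assumes "u \<in> L2_per" "w \<in> L2_per"
  shows "L2_inner (\<lambda>x. c * u x) w = c * L2_inner u w"
  using assms by (simp add: L2_inner_def cell_integral_def mult.assoc L2_per_mult_integrable)

lemma L2_inner_sum_left:
  fixes u :: "'i \<Rightarrow> real^'n \<Rightarrow> real"
  assumes "\<And>i. i \<in> I \<Longrightarrow> u i \<in> L2_per" "w \<in> L2_per"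
  shows "L2_inner (\<lambda>x. \<Sum>i\<in>I. u i x) w = (\<Sum>i\<in>I. L2_inner (u i) w)"
  using assms by (simp add: L2_inner_def cell_integral_def sum_distrib_right L2_per_mult_integrable)

lemma L2_inner_add_right:
  fixes u v w :: "real^'n \<Rightarrow> real"
  assumes "u \<in> L2_per" "v \<in> L2_per" "w \<in> L2_per"
  shows "L2_inner w (\<lambda>x. u x + v x) = L2_inner w u + L2_inner w v"
  using L2_inner_add_left[OF assms] by (simp only: L2_inner_commute[of w])

lemma L2_inner_diff_right:
  fixes u v w :: "real^'n \<Rightarrow> real"
  assumes "u \<in> L2_per" "v \<in> L2_per" "w \<in> L2_per"
  shows "L2_inner w (\<lambda>x. u x - v x) = L2_inner w u - L2_inner w v"
  using L2_inner_diff_left[OF assms] by (simp only: L2_inner_commute[of w])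

lemma L2_inner_scale_right:
  fixes u w :: "real^'n \<Rightarrow> real"
  assumes "u \<in> L2_per" "w \<in> L2_per"
  shows "L2_inner w (\<lambda>x. c * u x) = c * L2_inner w u"
  using L2_inner_scale_left[OF assms] by (simp only: L2_inner_commute[of w])

lemma L2_inner_cong_AE:
  fixes u v w :: "real^'n \<Rightarrow> real"
  assumes "u \<in> L2_per" "v \<in> L2_per" "w \<in> L2_per" "AE x in cell. u x = v x"
  shows "L2_inner u w = L2_inner v w"
  unfolding L2_inner_def
proof (rule cell_integral_cong_AE)
  show "(\<lambda>x. u x * w x) \<in> borel_measurable cell" "(\<lambda>x. v x * w x) \<in> borel_measurable cell"
    using assms L2_per_measurable_cell by (auto intro!: borel_measurable_times)
  show "AE x in cell. u x * w x = v x * w x"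
    using assms(4) by eventually_elim simp
qed

lemma L2_inner_self_nonneg: "0 \<le> L2_inner u u"
  by (simp add: L2_inner_def cell_integral_def)

lemma L2_norm_nonneg [simp]: "0 \<le> L2_norm u"
  by (simp add: L2_norm_def L2_inner_self_nonneg)

lemma L2_norm_square: "(L2_norm u)\<^sup>2 = L2_inner u u"
  by (simp add: L2_norm_def L2_inner_self_nonneg)

lemma L2_norm_minus: "L2_norm (\<lambda>x. - u x) = L2_norm u"
  by (simp add: L2_norm_def L2_inner_def)

lemma L2_norm_diff_commute: "L2_norm (\<lambda>x. u x - w x) = L2_norm (\<lambda>x. w x - u x)"
  using L2_norm_minus[of "\<lambda>x. u x - w x"] by simp

lemma L2_norm_zero_AE:
  fixes u :: "real^'n \<Rightarrow> real"
  assumes "u \<in> L2_per" "L2_norm u = 0"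
  shows "AE x in cell. u x = 0"
proof -
  have "integral\<^sup>L cell (\<lambda>x. u x * u x) = 0"
    using L2_norm_square[of u] assms(2) by (simp add: L2_inner_def cell_integral_def)
  then have "AE x in cell. u x * u x = 0"
    using L2_per_mult_integrable[OF assms(1,1)] by (subst (asm) integral_nonneg_eq_0_iff_AE) auto
  then show ?thesis
    by simp
qed

lemma L2_norm_mono_AE:
  fixes u w :: "real^'n \<Rightarrow> real"
  assumes "u \<in> L2_per" "w \<in> L2_per" "AE x in cell. \<bar>u x\<bar> \<le> \<bar>w x\<bar>"
  shows "L2_norm u \<le> L2_norm w"
proof -
  have "L2_inner u u \<le> L2_inner w w"
    unfolding L2_inner_def cell_integral_def
  proof (rule integral_mono_AE)
    show "AE x in cell. u x * u x \<le> w x * w x"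
      using assms(3) by eventually_elim (metis abs_le_square_iff power2_eq_square)
  qed (use assms in \<open>auto intro: L2_per_mult_integrable\<close>)
  then show ?thesis
    by (simp add: L2_norm_def)
qed

lemma L2_norm_cong_AE:
  fixes u w :: "real^'n \<Rightarrow> real"
  assumes "u \<in> L2_per" "w \<in> L2_per" "AE x in cell. u x = w x"
  shows "L2_norm u = L2_norm w"
  using assms by (intro antisym L2_norm_mono_AE) (auto elim: eventually_mono)

lemma L2_Cauchy_Schwarz:
  fixes u w :: "real^'n \<Rightarrow> real"
  assumes u: "u \<in> L2_per" and w: "w \<in> L2_per"
  shows "\<bar>L2_inner u w\<bar> \<le> L2_norm u * L2_norm w"
proof -
  have quad: "0 \<le> L2_inner u u + 2 * t * L2_inner u w + t\<^sup>2 * L2_inner w w" for t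
  proof -
    let ?z = "\<lambda>x. u x + t * w x"
    have z: "?z \<in> L2_per" and tw: "(\<lambda>x. t * w x) \<in> L2_per"
      using u w by (auto intro: L2_per_add L2_per_scale)
    have "L2_inner ?z ?z = L2_inner u u + 2 * t * L2_inner u w + t\<^sup>2 * L2_inner w w"
      using u w z tw L2_inner_commute[of w u]
      by (simp add: L2_inner_add_left L2_inner_add_right L2_inner_scale_left L2_inner_scale_right
          power2_eq_square algebra_simps)
    then show ?thesis
      using L2_inner_self_nonneg[of ?z] by simp
  qed
  have "(L2_inner u w)\<^sup>2 \<le> L2_inner u u * L2_inner w w"
  proof (cases "L2_inner w w = 0")
    case True
    have "L2_inner u w = 0"
    proof (rule ccontr)
      assume "L2_inner u w \<noteq> 0"
      then show False
        using quad[of "- (L2_inner u u + 1) / (2 * L2_inner u w)"] True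
        by (simp add: divide_simps)
    qed
    then show ?thesis using True by simp
  next
    case False
    then have pos: "0 < L2_inner w w"
      using L2_inner_self_nonneg[of w] by simp
    have "0 \<le> L2_inner u u - (L2_inner u w)\<^sup>2 / L2_inner w w"
      using quad[of "- L2_inner u w / L2_inner w w"] pos
      by (simp add: power2_eq_square field_simps)
    then show ?thesis
      using pos by (simp add: field_simps)
  qed
  then have "sqrt ((L2_inner u w)\<^sup>2) \<le> sqrt (L2_inner u u * L2_inner w w)"
    by (rule real_sqrt_le_mono)
  then show ?thesis
    by (simp add: L2_norm_def real_sqrt_mult)
qed

lemma L2_norm_triangle:
  fixes u w :: "real^'n \<Rightarrow> real"
  assumes u: "u \<in> L2_per" and w: "w \<in> L2_per"
  shows "L2_norm (\<lambda>x. u x + w x) \<le> L2_norm u + L2_norm w"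
proof (rule power2_le_imp_le)
  let ?z = "\<lambda>x. u x + w x"
  have z: "?z \<in> L2_per"
    using u w by (rule L2_per_add)
  have "L2_inner ?z ?z = L2_inner u u + 2 * L2_inner u w + L2_inner w w"
    using u w z L2_inner_commute[of w u] by (simp add: L2_inner_add_left L2_inner_add_right)
  also have "\<dots> \<le> (L2_norm u + L2_norm w)\<^sup>2"
    using L2_Cauchy_Schwarz[OF u w] by (simp add: power2_sum L2_norm_square)
  finally show "(L2_norm ?z)\<^sup>2 \<le> (L2_norm u + L2_norm w)\<^sup>2"
    by (simp add: L2_norm_square)
qed simp

lemma L2_norm_triangle_diff:
  fixes u v w :: "real^'n \<Rightarrow> real"
  assumes "u \<in> L2_per" "v \<in> L2_per" "w \<in> L2_per"
  shows "L2_norm (\<lambda>x. u x - w x) \<le> L2_norm (\<lambda>x. u x - v x) + L2_norm (\<lambda>x. v x - w x)"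
  using L2_norm_triangle[of "\<lambda>x. u x - v x" "\<lambda>x. v x - w x"] assms by (simp add: L2_per_diff)

lemma L2_norm_scale: "L2_norm (\<lambda>x. c * u x) = \<bar>c\<bar> * L2_norm u"
proof -
  have "L2_inner (\<lambda>x. c * u x) (\<lambda>x. c * u x) = c\<^sup>2 * L2_inner u u"
    by (simp add: L2_inner_def cell_integral_def power2_eq_square mult_ac
        flip: integral_mult_right_zero)
  then show ?thesis
    by (simp add: L2_norm_def real_sqrt_mult)
qed

lemma L2_norm_const: "L2_norm (\<lambda>x. c) = \<bar>c\<bar>"
  by (simp add: L2_norm_def L2_inner_def)

lemma cell_integral_le_L2_norm: "u \<in> L2_per \<Longrightarrow> \<bar>cell_integral u\<bar> \<le> L2_norm u"
  using L2_Cauchy_Schwarz[of u "\<lambda>x. 1"] by (simp add: L2_inner_one L2_norm_const)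

lemma L2_norm_minus_mean_le:
  fixes u :: "real^'n \<Rightarrow> real"
  assumes "u \<in> L2_per"
  shows "L2_norm (\<lambda>x. u x - cell_integral u) \<le> L2_norm u"
proof -
  let ?m = "cell_integral u"
  have "L2_inner (\<lambda>x. ?m) w = ?m * cell_integral w" for w :: "real^'n \<Rightarrow> real"
    by (simp add: L2_inner_def cell_integral_def)
  then have "L2_inner (\<lambda>x. u x - ?m) (\<lambda>x. u x - ?m) = L2_inner u u - ?m\<^sup>2"
    using assms L2_inner_commute[of u "\<lambda>x. ?m"]
    by (simp add: L2_inner_diff_left L2_inner_diff_right L2_per_diff cell_integral_diff power2_eq_square)
  then show ?thesis
    by (simp add: L2_norm_def)
qed

text \<open>
  Convergence in the seminorm; a limit is determined up to a null set. Membership in the space is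
  part of the relation because the integral of a function that is not integrable is zero by
  default, so that a small value of the seminorm alone would carry no information.
\<close>

definition L2_lim :: "(nat \<Rightarrow> real^'n \<Rightarrow> real) \<Rightarrow> (real^'n \<Rightarrow> real) \<Rightarrow> bool" where
  "L2_lim F u \<longleftrightarrow> (\<forall>m. F m \<in> L2_per) \<and> u \<in> L2_per \<and> (\<lambda>m. L2_norm (\<lambda>x. F m x - u x)) \<longlonglongrightarrow> 0"

lemma L2_lim_inner:
  assumes F: "L2_lim F u" and w: "w \<in> L2_per"
  shows "(\<lambda>m. L2_inner (F m) w) \<longlonglongrightarrow> L2_inner u w"
proof -
  have "(\<lambda>m. L2_inner (F m) w - L2_inner u w) \<longlonglongrightarrow> 0"
  proof (rule tendsto_rabs_zero_cancel, rule tendsto_sandwich[where f="\<lambda>_. 0"])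
    show "(\<lambda>m. L2_norm (\<lambda>x. F m x - u x) * L2_norm w) \<longlonglongrightarrow> 0"
      using F by (auto simp: L2_lim_def intro: tendsto_mult_left_zero)
    show "\<forall>\<^sub>F m in sequentially. \<bar>L2_inner (F m) w - L2_inner u w\<bar> \<le> L2_norm (\<lambda>x. F m x - u x) * L2_norm w"
      using F w L2_Cauchy_Schwarz[OF L2_per_diff w]
      by (intro always_eventually) (simp add: L2_lim_def L2_inner_diff_left[symmetric])
  qed auto
  then show ?thesis
    by (rule LIM_zero_cancel)
qed

lemma L2_lim_norm:
  assumes F: "L2_lim F u"
  shows "(\<lambda>m. L2_norm (F m)) \<longlonglongrightarrow> L2_norm u"
proof -
  have "(\<lambda>m. L2_norm (F m) - L2_norm u) \<longlonglongrightarrow> 0"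
  proof (rule tendsto_rabs_zero_cancel, rule tendsto_sandwich[where f="\<lambda>_. 0"])
    show "(\<lambda>m. L2_norm (\<lambda>x. F m x - u x)) \<longlonglongrightarrow> 0"
      using F by (simp add: L2_lim_def)
    show "\<forall>\<^sub>F m in sequentially. \<bar>L2_norm (F m) - L2_norm u\<bar> \<le> L2_norm (\<lambda>x. F m x - u x)"
    proof (rule always_eventually, rule allI)
      fix m
      have "F m \<in> L2_per" "u \<in> L2_per"
        using F by (auto simp: L2_lim_def)
      then show "\<bar>L2_norm (F m) - L2_norm u\<bar> \<le> L2_norm (\<lambda>x. F m x - u x)"
        using L2_norm_triangle_diff[of "F m" u "\<lambda>x. 0"] L2_norm_triangle_diff[of u "F m" "\<lambda>x. 0"]
          L2_norm_diff_commute[of u "F m"] by simp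
    qed
  qed auto
  then show ?thesis
    by (rule LIM_zero_cancel)
qed

lemma L2_lim_sum:
  fixes F :: "'i \<Rightarrow> nat \<Rightarrow> real^'n \<Rightarrow> real"
  assumes "\<And>i. i \<in> I \<Longrightarrow> L2_lim (F i) (u i)"
  shows "L2_lim (\<lambda>m x. \<Sum>i\<in>I. F i m x) (\<lambda>x. \<Sum>i\<in>I. u i x)"
  using assms
proof (induction I rule: infinite_finite_induct)
  case (insert i I)
  let ?S = "\<lambda>m x. \<Sum>i\<in>I. F i m x" and ?s = "\<lambda>x. \<Sum>i\<in>I. u i x"
  have S: "L2_lim ?S ?s" and Fi: "L2_lim (F i) (u i)"
    using insert by auto
  have "(\<lambda>m. L2_norm (\<lambda>x. (F i m x + ?S m x) - (u i x + ?s x))) \<longlonglongrightarrow> 0"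
  proof (rule tendsto_sandwich[where f="\<lambda>_. 0"])
    show "(\<lambda>m. L2_norm (\<lambda>x. F i m x - u i x) + L2_norm (\<lambda>x. ?S m x - ?s x)) \<longlonglongrightarrow> 0"
      using S Fi unfolding L2_lim_def by (auto intro: tendsto_add_zero)
    have "L2_norm (\<lambda>x. (F i m x + ?S m x) - (u i x + ?s x))
        \<le> L2_norm (\<lambda>x. F i m x - u i x) + L2_norm (\<lambda>x. ?S m x - ?s x)" for m
      using L2_norm_triangle[of "\<lambda>x. F i m x - u i x" "\<lambda>x. ?S m x - ?s x"] S Fi
      by (simp add: L2_lim_def L2_per_diff algebra_simps)
    then show "\<forall>\<^sub>F m in sequentially. L2_norm (\<lambda>x. (F i m x + ?S m x) - (u i x + ?s x))
        \<le> L2_norm (\<lambda>x. F i m x - u i x) + L2_norm (\<lambda>x. ?S m x - ?s x)"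
      by simp
  qed auto
  then show ?case
    using insert.hyps S Fi by (simp add: L2_lim_def L2_per_add)
qed (auto simp: L2_lim_def L2_norm_const)

lemma L2_lim_unique:
  fixes u w :: "real^'n \<Rightarrow> real"
  assumes F: "L2_lim F u" and G: "L2_lim F w"
  shows "AE x in cell. u x = w x"
proof -
  have mem: "u \<in> L2_per" "w \<in> L2_per" "\<And>m. F m \<in> L2_per"
    using assms by (auto simp: L2_lim_def)
  have lim: "(\<lambda>m. L2_norm (\<lambda>x. F m x - u x) + L2_norm (\<lambda>x. F m x - w x)) \<longlonglongrightarrow> 0"
    using assms unfolding L2_lim_def by (auto intro: tendsto_add_zero)
  have "L2_norm (\<lambda>x. u x - w x) \<le> L2_norm (\<lambda>x. F m x - u x) + L2_norm (\<lambda>x. F m x - w x)" for m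
    using L2_norm_triangle_diff[OF mem(1,3,2), of m] by (simp add: L2_norm_diff_commute[of u])
  then have "L2_norm (\<lambda>x. u x - w x) \<le> 0"
    using lim by (intro LIMSEQ_le_const[OF lim]) auto
  then have "L2_norm (\<lambda>x. u x - w x) = 0"
    by (simp add: antisym)
  then show ?thesis
    using L2_norm_zero_AE[OF L2_per_diff[OF mem(1,2)]] by simp
qed

text \<open>
  Riesz--Fischer. A Cauchy sequence is also Cauchy for the \<open>L\<^sup>1\<close> norm, so a subsequence converges
  pointwise almost everywhere, and Fatou's lemma turns this limit into a limit in the mean. As the
  limit is taken pointwise on the whole space, it inherits periodicity from the sequence.
\<close>

theorem L2_complete:
  fixes F :: "nat \<Rightarrow> real^'n \<Rightarrow> real"
  assumes F: "\<And>m. F m \<in> L2_per"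
    and cauchy: "\<And>e. e > 0 \<Longrightarrow> \<exists>N. \<forall>i\<ge>N. \<forall>j\<ge>N. L2_norm (\<lambda>x. F i x - F j x) < e"
  shows "\<exists>u. L2_lim F u"
proof -
  have meas: "F m \<in> borel_measurable cell" for m
    using F L2_per_measurable_cell by blast
  have "\<exists>N. \<forall>i\<ge>N. \<forall>j\<ge>N. integral\<^sup>L cell (\<lambda>x. norm (F i x - F j x)) < e" if e: "e > 0" for e
  proof -
    obtain N where N: "\<And>i j. i \<ge> N \<Longrightarrow> j \<ge> N \<Longrightarrow> L2_norm (\<lambda>x. F i x - F j x) < e"
      using cauchy[OF e] by blast
    have "integral\<^sup>L cell (\<lambda>x. norm (F i x - F j x)) \<le> L2_norm (\<lambda>x. F i x - F j x)" for i j
    proof -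
      let ?a = "\<lambda>x. \<bar>F i x - F j x\<bar>"
      have d: "(\<lambda>x. F i x - F j x) \<in> L2_per"
        using F by (intro L2_per_diff)
      then have a: "?a \<in> L2_per"
        using ae_periodic_comp[of "\<lambda>x. F i x - F j x" abs] by (auto simp: L2_per_def)
      have "cell_integral ?a \<le> L2_norm ?a"
        using cell_integral_le_L2_norm[OF a] by simp
      also have "\<dots> = L2_norm (\<lambda>x. F i x - F j x)"
        by (simp add: L2_norm_def L2_inner_def flip: power2_eq_square)
      finally show ?thesis
        by (simp add: cell_integral_def)
    qed
    then show ?thesis
      using N by (meson le_less_trans)
  qed
  then obtain r where r: "strict_mono r" and ae: "AE x in cell. Cauchy (\<lambda>i. F (r i) x)"
    using cauchy_L1_AE_cauchy_subseq[of cell F] L2_per_integrable[OF F] by blast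
  define u where "u x = lim (\<lambda>i. F (r i) x)" for x
  have u_meas: "u \<in> borel_measurable lebesgue"
    unfolding u_def using F L2_per_measurable by (intro borel_measurable_lim_metric) blast
  have u_per: "ae_periodic u"
    unfolding ae_periodic_def
  proof (intro ballI)
    fix k :: "real^'n" assume "k \<in> int_vecs"
    then have "AE x in lebesgue. \<forall>i. F (r i) (x + k) = F (r i) x"
      using F by (subst AE_all_countable) (auto simp: L2_per_def ae_periodic_def)
    then show "AE x in lebesgue. u (x + k) = u x"
      by eventually_elim (simp add: u_def)
  qed
  have conv: "AE x in cell. (\<lambda>i. F (r i) x) \<longlonglongrightarrow> u x"
    using ae by eventually_elim (simp add: u_def real_Cauchy_convergent convergent_LIMSEQ_iff[symmetric])
  have nn: "(\<integral>\<^sup>+x. ennreal ((w x)\<^sup>2) \<partial>cell) = ennreal ((L2_norm w)\<^sup>2)" if "w \<in> L2_per" for w :: "real^'n \<Rightarrow> real"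
    using nn_integral_eq_integral[OF L2_per_square_integrable[OF that]]
    by (simp add: L2_norm_square[unfolded power2_eq_square] L2_inner_def cell_integral_def power2_eq_square)
  have est: "(\<integral>\<^sup>+x. ennreal ((F m x - u x)\<^sup>2) \<partial>cell) \<le> ennreal (e\<^sup>2)"
    if N: "\<And>j. j \<ge> N \<Longrightarrow> L2_norm (\<lambda>x. F m x - F j x) < e" for m N e
  proof -
    have "(\<integral>\<^sup>+x. ennreal ((F m x - u x)\<^sup>2) \<partial>cell)
        = (\<integral>\<^sup>+x. liminf (\<lambda>i. ennreal ((F m x - F (r i) x)\<^sup>2)) \<partial>cell)"
    proof (rule nn_integral_cong_AE)
      show "AE x in cell. ennreal ((F m x - u x)\<^sup>2) = liminf (\<lambda>i. ennreal ((F m x - F (r i) x)\<^sup>2))"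
        using conv
      proof eventually_elim
        case (elim x)
        then have "(\<lambda>i. ennreal ((F m x - F (r i) x)\<^sup>2)) \<longlonglongrightarrow> ennreal ((F m x - u x)\<^sup>2)"
          by (intro tendsto_ennrealI tendsto_intros)
        then show ?case
          using lim_imp_Liminf[OF trivial_limit_sequentially] by metis
      qed
    qed
    also have "\<dots> \<le> liminf (\<lambda>i. \<integral>\<^sup>+x. ennreal ((F m x - F (r i) x)\<^sup>2) \<partial>cell)"
      using meas by (intro nn_integral_liminf) measurable
    also have "\<dots> \<le> ennreal (e\<^sup>2)"
    proof -
      have "\<forall>\<^sub>F i in sequentially. (\<integral>\<^sup>+x. ennreal ((F m x - F (r i) x)\<^sup>2) \<partial>cell) \<le> ennreal (e\<^sup>2)"
        using eventually_ge_at_top[of N]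
      proof eventually_elim
        case (elim i)
        then have "r i \<ge> N"
          using seq_suble[OF r, of i] by simp
        then have "(L2_norm (\<lambda>x. F m x - F (r i) x))\<^sup>2 \<le> e\<^sup>2"
          using N by (intro power_mono) (auto intro: less_imp_le)
        then show ?case
          using nn[OF L2_per_diff[OF F F]] by (simp add: ennreal_leI)
      qed
      then show ?thesis
        by (intro order_trans[OF Liminf_le_Limsup Limsup_bounded]) auto
    qed
    finally show ?thesis .
  qed
  have u_diff: "(\<lambda>x. F m x - u x) \<in> borel_measurable lebesgue" "ae_periodic (\<lambda>x. F m x - u x)" for m
    using borel_measurable_diff[OF L2_per_measurable[OF F] u_meas]
      ae_periodic_comp2[OF L2_per_ae_periodic[OF F] u_per, of "\<lambda>a b. a - b"] by auto
  have diff_mem: "(\<lambda>x. F m x - u x) \<in> L2_per"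
    if "(\<integral>\<^sup>+x. ennreal ((F m x - u x)\<^sup>2) \<partial>cell) \<le> ennreal (e\<^sup>2)" for m e
  proof -
    have "integrable cell (\<lambda>x. (F m x - u x)\<^sup>2)"
    proof (rule integrableI_bounded)
      show "(\<lambda>x. (F m x - u x)\<^sup>2) \<in> borel_measurable cell"
        using measurable_restrict_space1[OF u_diff(1)] by (rule borel_measurable_power)
      show "(\<integral>\<^sup>+x. ennreal (norm ((F m x - u x)\<^sup>2)) \<partial>cell) < \<infinity>"
        using that by (auto simp: le_less_trans)
    qed
    then show ?thesis
      using u_diff by (simp add: L2_per_def)
  qed
  obtain N where "\<forall>i\<ge>N. \<forall>j\<ge>N. L2_norm (\<lambda>x. F i x - F j x) < 1"
    using cauchy[of 1] by auto
  then have "(\<lambda>x. F N x - (F N x - u x)) \<in> L2_per"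
    using F by (intro L2_per_diff diff_mem[where e=1] est[where N=N]) auto
  then have u: "u \<in> L2_per"
    by simp
  have "(\<lambda>m. L2_norm (\<lambda>x. F m x - u x)) \<longlonglongrightarrow> 0"
  proof (rule LIMSEQ_I)
    fix e :: real assume e: "0 < e"
    then obtain N where N: "\<forall>i\<ge>N. \<forall>j\<ge>N. L2_norm (\<lambda>x. F i x - F j x) < e / 2"
      using cauchy[of "e / 2"] by auto
    have "L2_norm (\<lambda>x. F m x - u x) < e" if "m \<ge> N" for m
    proof -
      have "ennreal ((L2_norm (\<lambda>x. F m x - u x))\<^sup>2) \<le> ennreal ((e / 2)\<^sup>2)"
        using est[of N m "e / 2"] N that nn[OF L2_per_diff[OF F u]] by simp
      then have "(L2_norm (\<lambda>x. F m x - u x))\<^sup>2 \<le> (e / 2)\<^sup>2"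
        by (subst (asm) ennreal_le_iff) simp_all
      then have "L2_norm (\<lambda>x. F m x - u x) \<le> e / 2"
        by (rule power2_le_imp_le) (use e in simp)
      then show ?thesis using e by simp
    qed
    then show "\<exists>N. \<forall>m\<ge>N. norm (L2_norm (\<lambda>x. F m x - u x) - 0) < e"
      by auto
  qed
  then show ?thesis
    using F u by (auto simp: L2_lim_def)
qed

section \<open>Integration by parts on the torus\<close>

lemma axis_in_int_vecs: "axis i 1 \<in> int_vecs"
  by (simp add: int_vecs_def axis_def)

lemma integrable_indicator_unit_cell:
  fixes g :: "real^'n \<Rightarrow> real"
  assumes g: "continuous_on UNIV g"
  shows "integrable lborel (\<lambda>x. indicator unit_cell x *\<^sub>R g x)"
proof (rule Bochner_Integration.integrable_bound)
  show "integrable lborel (\<lambda>x. indicator (cbox 0 1 :: (real^'n) set) x *\<^sub>R g x)"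
    using g by (intro borel_integrable_compact) (auto intro: continuous_on_subset)
  have [measurable]: "g \<in> borel_measurable borel"
    using g by (rule borel_measurable_continuous_onI)
  show "(\<lambda>x. indicator unit_cell x *\<^sub>R g x) \<in> borel_measurable lborel"
    by (simp add: unit_cell_def)
  show "AE x in lborel. norm (indicator unit_cell x *\<^sub>R g x)
      \<le> norm (indicator (cbox 0 1 :: (real^'n) set) x *\<^sub>R g x)"
    using box_subset_cbox[of 0 "1 :: real^'n"]
    by (intro AE_I2) (auto simp: unit_cell_def indicator_def)
qed

lemma cell_integral_eq_lborel:
  fixes g :: "real^'n \<Rightarrow> real"
  assumes g: "continuous_on UNIV g"
  shows "cell_integral g = (\<integral>x. indicator unit_cell x *\<^sub>R g x \<partial>lborel)"
proof -
  have "(\<lambda>x. indicator unit_cell x *\<^sub>R g x) \<in> borel_measurable lborel"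
    using integrable_indicator_unit_cell[OF g] by (rule borel_measurable_integrable)
  then show ?thesis
    by (simp add: cell_integral_def integral_restrict_space integral_completion)
qed

lemma partial_along_axis:
  fixes u :: "real^'n \<Rightarrow> real"
  assumes "u differentiable (at (p + y *\<^sub>R axis i 1))"
  shows "((\<lambda>y. u (p + y *\<^sub>R axis i 1)) has_field_derivative partial i u (p + y *\<^sub>R axis i 1)) (at y)"
proof -
  let ?D = "frechet_derivative u (at (p + y *\<^sub>R axis i 1))"
  have D: "(u has_derivative ?D) (at (p + y *\<^sub>R axis i 1))"
    using assms frechet_derivative_works by blast
  have "((\<lambda>y. p + y *\<^sub>R axis i 1) has_derivative (\<lambda>h. h *\<^sub>R axis i 1)) (at y)"
    by (auto intro!: derivative_eq_intros)
  then have "((\<lambda>y. u (p + y *\<^sub>R axis i 1)) has_derivative (\<lambda>h. ?D (h *\<^sub>R axis i 1))) (at y)"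
    using D by (rule has_derivative_compose)
  moreover have "?D (h *\<^sub>R axis i 1) = partial i u (p + y *\<^sub>R axis i 1) * h" for h
    using linear_scale[OF has_derivative_linear[OF D]] by (simp add: partial_def)
  ultimately show ?thesis
    by (simp add: has_field_derivative_def)
qed

text \<open>
  The boundary terms on opposite faces of the cell cancel: by Fubini's theorem the coordinate
  \<open>x\<^sub>i\<close> can be integrated first, and the fundamental theorem of calculus leaves the difference of
  the values at two points that differ by a lattice vector.
\<close>

lemma cell_integral_partial_eq_0:
  fixes u :: "real^'n \<Rightarrow> real"
  assumes diff: "\<And>x. u differentiable (at x)"
    and cont: "continuous_on UNIV (partial i u)"
    and per: "periodic u"
  shows "cell_integral (partial i u) = 0"
proof -
  interpret product_sigma_finite "\<lambda>_::real^'n. lborel :: real measure"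
    by standard
  define e :: "real^'n" where "e = axis i 1"
  define h where "h x = indicator unit_cell x *\<^sub>R partial i u x" for x
  define S where "S f = (\<Sum>b\<in>Basis. f b *\<^sub>R b)" for f :: "real^'n \<Rightarrow> real"
  define P where "P B = (\<Pi>\<^sub>M b\<in>B. (lborel :: real measure))" for B :: "(real^'n) set"
  have e: "e \<in> Basis" by (simp add: e_def)
  have lborel: "(lborel :: (real^'n) measure) = distr (P Basis) borel S"
    unfolding P_def S_def by (rule lborel_eq)
  have S_meas: "S \<in> measurable (P Basis) borel"
    unfolding P_def S_def by measurable
  have h_int: "integrable lborel h"
    unfolding h_def using cont by (rule integrable_indicator_unit_cell)
  then have h_meas: "h \<in> borel_measurable borel"
    by (simp add: borel_measurable_integrable)
  have Bas: "Basis = insert e (Basis - {e})"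
    using e by blast
  have hS_int: "integrable (P Basis) (\<lambda>f. h (S f))"
    using h_int h_meas S_meas unfolding lborel by (simp add: integrable_distr_eq)
  have slice: "(\<integral>y. h (S (f(e := y))) \<partial>lborel) = 0" for f
  proof -
    define p where "p = (\<Sum>b\<in>Basis - {e}. f b *\<^sub>R b)"
    have S: "S (f(e := y)) = p + y *\<^sub>R e" for y
    proof -
      have "S (f(e := y)) = y *\<^sub>R e + (\<Sum>b\<in>Basis - {e}. (f(e := y)) b *\<^sub>R b)"
        unfolding S_def by (subst Bas) (subst sum.insert, auto)
      also have "(\<Sum>b\<in>Basis - {e}. (f(e := y)) b *\<^sub>R b) = p"
        unfolding p_def by (rule sum.cong) auto
      finally show ?thesis by (simp only: add.commute)
    qed
    have "p $ i = p \<bullet> e"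
      by (simp add: e_def inner_axis)
    also have "\<dots> = (\<Sum>b\<in>Basis - {e}. f b * (b \<bullet> e))"
      by (simp add: p_def inner_sum_left)
    also have "\<dots> = 0"
      using e by (intro sum.neutral) (auto simp: inner_Basis)
    finally have "p $ i = 0" .
    then have pi: "(p + y *\<^sub>R e) $ j = (if j = i then y else p $ j)" for j y
      by (simp add: e_def axis_def)
    define Q where "Q \<longleftrightarrow> (\<forall>j. j \<noteq> i \<longrightarrow> 0 < p $ j \<and> p $ j < 1)"
    have cell: "p + y *\<^sub>R e \<in> unit_cell \<longleftrightarrow> Q \<and> 0 < y \<and> y < 1" for y
      unfolding unit_cell_eq mem_Collect_eq pi Q_def by auto
    show ?thesis
    proof (cases Q)
      case False
      then show ?thesis
        using cell by (simp add: S h_def indicator_def)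
    next
      case True
      have "(\<integral>y. h (S (f(e := y))) \<partial>lborel)
          = (\<integral>y. partial i u (p + y *\<^sub>R e) * indicator {0..1} y \<partial>lborel)"
      proof (rule integral_cong_AE)
        have [measurable]: "partial i u \<in> borel_measurable borel"
          using cont by (rule borel_measurable_continuous_onI)
        show "(\<lambda>y. partial i u (p + y *\<^sub>R e) * indicator {0..1} y) \<in> borel_measurable lborel"
          by measurable
        show "(\<lambda>y. h (S (f(e := y)))) \<in> borel_measurable lborel"
          unfolding S using h_meas by measurable
        show "AE y in lborel. h (S (f(e := y))) = partial i u (p + y *\<^sub>R e) * indicator {0..1} y"
          using AE_lborel_singleton[of "0::real"] AE_lborel_singleton[of "1::real"]
        proof eventually_elim
          case (elim y)
          then show ?case
            using True cell[of y] by (auto simp: S h_def indicator_def)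
        qed
      qed
      also have "\<dots> = u (p + 1 *\<^sub>R e) - u (p + 0 *\<^sub>R e)"
      proof (rule integral_FTC_Icc_real)
        show "DERIV (\<lambda>y. u (p + y *\<^sub>R e)) y :> partial i u (p + y *\<^sub>R e)" for y
          unfolding e_def using diff by (rule partial_along_axis)
        have "isCont (\<lambda>y. p + y *\<^sub>R e) y" "isCont (partial i u) (p + y *\<^sub>R e)" for y
          using cont by (auto intro!: continuous_intros simp: continuous_on_eq_continuous_at)
        then show "isCont (\<lambda>y. partial i u (p + y *\<^sub>R e)) y" for y
          by (rule isCont_o2)
      qed simp
      also have "\<dots> = 0"
        using per axis_in_int_vecs[of i] by (simp add: periodic_def e_def)
      finally show ?thesis .
    qed
  qed
  have "cell_integral (partial i u) = integral\<^sup>L lborel h"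
    unfolding h_def using cont by (rule cell_integral_eq_lborel)
  also have "\<dots> = integral\<^sup>L (P Basis) (\<lambda>f. h (S f))"
    by (subst lborel) (rule integral_distr[OF S_meas h_meas])
  also have "\<dots> = integral\<^sup>L (P (insert e (Basis - {e}))) (\<lambda>f. h (S f))"
    by (simp only: Bas[symmetric])
  also have "\<dots> = (\<integral>f. (\<integral>y. h (S (f(e := y))) \<partial>lborel) \<partial>P (Basis - {e}))"
    unfolding P_def
  proof (rule product_integral_insert)
    show "integrable (Pi\<^sub>M (insert e (Basis - {e})) (\<lambda>_. lborel)) (\<lambda>f. h (S f))"
      using hS_int by (simp only: P_def Bas[symmetric])
  qed auto
  also have "\<dots> = 0"
    by (simp add: slice)
  finally show ?thesis .
qed

lemma smooth_perD:
  assumes "u \<in> smooth_per"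
  shows "u differentiable (at x)" "continuous_on UNIV u" "continuous_on UNIV (partial i u)" "periodic u"
proof -
  have "C_diff 0 u" "C_diff (Suc 0) u" "periodic u"
    using assms unfolding smooth_per_def by blast+
  then show "u differentiable (at x)" "continuous_on UNIV u" "continuous_on UNIV (partial i u)" "periodic u"
    by auto
qed

lemma partial_translate:
  fixes u :: "real^'n \<Rightarrow> real"
  assumes "u differentiable (at x)" "\<And>x. u (x + k) = u x" 
  shows "partial i u (x + k) = partial i u x"
proof -
  let ?D = "frechet_derivative u (at x)"
  have "(u has_derivative ?D) (at ((x + k) - k))"
    using assms(1) frechet_derivative_works by fastforce
  moreover have "((\<lambda>z. z - k) has_derivative (\<lambda>h. h)) (at (x + k))"
    by (auto intro!: derivative_eq_intros)
  ultimately have "((\<lambda>z. u (z - k)) has_derivative ?D) (at (x + k))"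
    using has_derivative_compose by blast
  moreover have "u (z - k) = u z" for z
    using assms(2)[of "z - k"] by simp
  ultimately have "(u has_derivative ?D) (at (x + k))"
    by simp
  then have "?D = frechet_derivative u (at (x + k))"
    by (rule frechet_derivative_at)
  then show ?thesis
    by (simp add: partial_def)
qed

lemma partial_smooth_per:
  assumes "u \<in> smooth_per"
  shows "partial i u \<in> smooth_per"
proof -
  have "C_diff (Suc k) u" for k
    using assms unfolding smooth_per_def by blast
  then have "C_diff k (partial i u)" for k
    by simp
  moreover have "periodic (partial i u)"
    using smooth_perD[OF assms] by (auto simp: periodic_def intro!: partial_translate)
  ultimately show ?thesis
    by (simp add: smooth_per_def)
qed

lemma continuous_periodic_L2_per:
  fixes u :: "real^'n \<Rightarrow> real"
  assumes cont: "continuous_on UNIV u" and per: "periodic u"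
  shows "u \<in> L2_per"
proof -
  have meas: "u \<in> borel_measurable lebesgue"
    using borel_measurable_continuous_onI[OF cont] by (simp add: measurable_completion)
  have cont2: "continuous_on UNIV (\<lambda>x. (u x)\<^sup>2)"
    using cont by (intro continuous_intros)
  have "integrable lebesgue (\<lambda>x. indicator unit_cell x *\<^sub>R (u x)\<^sup>2)"
    using integrable_indicator_unit_cell[OF cont2]
    by (simp add: integrable_completion borel_measurable_integrable)
  then have "integrable cell (\<lambda>x. (u x)\<^sup>2)"
    by (simp add: integrable_restrict_space)
  then show ?thesis
    using meas per by (simp add: L2_per_def ae_periodic_if_periodic)
qed

lemma smooth_per_L2_per: "u \<in> smooth_per \<Longrightarrow> u \<in> L2_per"
  using smooth_perD continuous_periodic_L2_per by blast

lemma partial_mult: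
  fixes u w :: "real^'n \<Rightarrow> real"
  assumes "u differentiable (at x)" "w differentiable (at x)"
  shows "partial i (\<lambda>x. u x * w x) x = u x * partial i w x + partial i u x * w x"
proof -
  have "((\<lambda>x. u x * w x) has_derivative
      (\<lambda>h. u x * frechet_derivative w (at x) h + frechet_derivative u (at x) h * w x)) (at x)"
    using assms by (intro has_derivative_mult) (simp_all add: frechet_derivative_works[symmetric])
  from frechet_derivative_at[OF this] show ?thesis
    by (simp add: partial_def fun_eq_iff)
qed

lemma weak_partial_smooth:
  fixes u :: "real^'n \<Rightarrow> real"
  assumes u: "u \<in> smooth_per"
  shows "weak_partial i u (partial i u)"
proof -
  have L2: "u \<in> L2_per" "partial i u \<in> L2_per"
    using u partial_smooth_per smooth_per_L2_per by blast+
  moreover have "L2_inner u (partial i w) = - L2_inner (partial i u) w" if w: "w \<in> smooth_per" for w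
  proof -
    have prod: "partial i (\<lambda>x. u x * w x) = (\<lambda>x. u x * partial i w x + partial i u x * w x)"
      using smooth_perD[OF u] smooth_perD[OF w] by (intro ext partial_mult)
    have "cell_integral (partial i (\<lambda>x. u x * w x)) = 0"
    proof (rule cell_integral_partial_eq_0)
      show "(\<lambda>x. u x * w x) differentiable (at x)" for x
        using smooth_perD[OF u] smooth_perD[OF w] by (intro derivative_intros)
      show "continuous_on UNIV (partial i (\<lambda>x. u x * w x))"
        unfolding prod using smooth_perD[OF u] smooth_perD[OF w] by (intro continuous_intros)
      show "periodic (\<lambda>x. u x * w x)"
        using smooth_perD[OF u] smooth_perD[OF w] by (simp add: periodic_def)
    qed
    moreover have "integrable cell (\<lambda>x. u x * partial i w x)" "integrable cell (\<lambda>x. partial i u x * w x)"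
      using L2 w partial_smooth_per[OF w] smooth_per_L2_per by (auto intro!: L2_per_mult_integrable)
    ultimately have "L2_inner u (partial i w) + L2_inner (partial i u) w = 0"
      by (simp add: prod L2_inner_def cell_integral_def)
    then show ?thesis by simp
  qed
  ultimately show ?thesis
    by (simp add: weak_partial_def)
qed

section \<open>Trigonometric polynomials\<close>

definition wave :: "real^'n \<Rightarrow> real^'n \<Rightarrow> complex" where
  "wave k x = cis (2 * pi * (k \<bullet> x))"

definition wave_sum :: "(real^'n) set \<Rightarrow> (real^'n \<Rightarrow> complex) \<Rightarrow> real^'n \<Rightarrow> complex" where
  "wave_sum K c x = (\<Sum>k\<in>K. c k * wave k x)"

definition wave_span :: "(real^'n) set \<Rightarrow> (real^'n \<Rightarrow> complex) set" where
  "wave_span Z = {P. \<exists>K c. finite K \<and> K \<subseteq> Z \<and> P = wave_sum K c}"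

text \<open>
  Being real is imposed on the values and not through a symmetry of the coefficients. Sums,
  products and differences then stay in the class without any comparison of coefficients, while
  Parseval's identity can be applied to the complex expansion.
\<close>

definition trig_poly :: "(real^'n) set \<Rightarrow> (real^'n \<Rightarrow> real) set" where
  "trig_poly Z = {p. (\<lambda>x. complex_of_real (p x)) \<in> wave_span Z}"

lemma wave_0 [simp]: "wave 0 x = 1"
  by (simp add: wave_def)

lemma wave_mult: "wave k x * wave l x = wave (k + l) x"
  by (simp add: wave_def cis_mult inner_add_left distrib_left)

lemma cnj_wave: "cnj (wave k x) = wave (- k) x"
  by (simp add: wave_def cis_cnj)

lemma int_vecs_simps [simp]: "0 \<in> int_vecs" "k \<in> int_vecs \<Longrightarrow> - k \<in> int_vecs"
    "k \<in> int_vecs \<Longrightarrow> l \<in> int_vecs \<Longrightarrow> k + l \<in> int_vecs"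
    "k \<in> int_vecs \<Longrightarrow> l \<in> int_vecs \<Longrightarrow> k - l \<in> int_vecs"
  by (auto simp: int_vecs_def)

lemma inner_int_vecs: "k \<in> int_vecs \<Longrightarrow> l \<in> int_vecs \<Longrightarrow> k \<bullet> l \<in> \<int>"
  by (auto simp: inner_vec_def int_vecs_def intro!: Ints_sum)

lemma wave_periodic:
  assumes "k \<in> int_vecs" "l \<in> int_vecs"
  shows "wave k (x + l) = wave k x"
proof -
  obtain m where "k \<bullet> l = of_int m"
    using inner_int_vecs[OF assms] Ints_cases by blast
  then show ?thesis
    by (simp add: wave_def inner_add_right distrib_left flip: cis_mult)
qed

lemma wave_has_derivative:
  "(wave k has_derivative (\<lambda>h. 2 * pi * \<i> * of_real (k \<bullet> h) * wave k x)) (at x within S)"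
proof -
  have "((\<lambda>x. 2 * pi * (k \<bullet> x)) has_derivative (\<lambda>h. 2 * pi * (k \<bullet> h))) (at x within S)"
    by (intro has_derivative_mult_right bounded_linear_imp_has_derivative bounded_linear_inner_right)
  then have "((\<lambda>x. \<i> * complex_of_real (2 * pi * (k \<bullet> x))) has_derivative
      (\<lambda>h. \<i> * complex_of_real (2 * pi * (k \<bullet> h)))) (at x within S)"
    by (rule has_derivative_mult_right[OF has_derivative_of_real])
  from has_derivative_compose[OF this DERIV_exp[THEN has_field_derivative_imp_has_derivative]]
  show ?thesis
    by (simp add: wave_def[abs_def] cis_conv_exp mult_ac)
qed

lemma wave_sum_has_derivative:
  "(wave_sum K c has_derivative (\<lambda>h. \<Sum>k\<in>K. c k * (2 * pi * \<i> * of_real (k \<bullet> h) * wave k x))) (at x)"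
  unfolding wave_sum_def[abs_def]
  by (intro has_derivative_sum has_derivative_mult_right wave_has_derivative)

text \<open>
  The action of the \<open>i\<close>-th partial derivative on Fourier coefficients.
\<close>

definition dsymbol :: "'n \<Rightarrow> (real^'n \<Rightarrow> complex) \<Rightarrow> real^'n \<Rightarrow> complex" where
  "dsymbol i c k = 2 * pi * \<i> * of_real (k $ i) * c k"

lemma dsymbol_twice: "dsymbol i (dsymbol j c) k = - of_real ((2 * pi)\<^sup>2 * (k $ i * k $ j)) * c k"
  by (simp add: dsymbol_def power2_eq_square mult_ac complex_i_mult_minus)

lemma Re_wave_sum_differentiable: "(\<lambda>x. Re (wave_sum K c x)) differentiable (at x)"
  and partial_Re_wave_sum: "partial i (\<lambda>x. Re (wave_sum K c x)) = (\<lambda>x. Re (wave_sum K (dsymbol i c) x))"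
proof -
  have D: "((\<lambda>x. Re (wave_sum K c x)) has_derivative
      (\<lambda>h. Re (\<Sum>k\<in>K. c k * (2 * pi * \<i> * of_real (k \<bullet> h) * wave k x)))) (at x)" for x
    by (rule has_derivative_Re[OF wave_sum_has_derivative])
  then show "(\<lambda>x. Re (wave_sum K c x)) differentiable (at x)"
    using differentiableI by blast
  show "partial i (\<lambda>x. Re (wave_sum K c x)) = (\<lambda>x. Re (wave_sum K (dsymbol i c) x))"
  proof
    fix x
    have "partial i (\<lambda>x. Re (wave_sum K c x)) x
        = Re (\<Sum>k\<in>K. c k * (2 * pi * \<i> * of_real (k \<bullet> axis i 1) * wave k x))"
      unfolding partial_def frechet_derivative_at[OF D, symmetric] by simp
    also have "\<dots> = Re (wave_sum K (dsymbol i c) x)"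
      by (simp add: wave_sum_def dsymbol_def inner_axis mult_ac)
    finally show "partial i (\<lambda>x. Re (wave_sum K c x)) x = Re (wave_sum K (dsymbol i c) x)" .
  qed
qed

lemma Re_wave_sum_smooth_per:
  fixes K :: "(real^'n) set"
  assumes "K \<subseteq> int_vecs"
  shows "(\<lambda>x. Re (wave_sum K c x)) \<in> smooth_per"
proof -
  have "C_diff n (\<lambda>x. Re (wave_sum K c x))" for n
  proof (induction n arbitrary: c)
    case 0
    have "(\<lambda>x. Re (wave_sum K c x)) differentiable_on UNIV"
      by (simp add: differentiable_on_def Re_wave_sum_differentiable)
    then show ?case
      by (simp add: differentiable_imp_continuous_on)
  next
    case (Suc n)
    then show ?case
      by (simp add: Re_wave_sum_differentiable partial_Re_wave_sum)
  qed
  moreover have "periodic (\<lambda>x. Re (wave_sum K c x))"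
    unfolding periodic_def
  proof (intro ballI allI)
    fix l :: "real^'n" and x assume l: "l \<in> int_vecs"
    have "wave_sum K c (x + l) = wave_sum K c x"
      unfolding wave_sum_def using l assms
      by (intro sum.cong) (auto simp: wave_periodic subset_iff)
    then show "Re (wave_sum K c (x + l)) = Re (wave_sum K c x)"
      by simp
  qed
  ultimately show ?thesis
    by (simp add: smooth_per_def)
qed

lemma trig_poly_wave_sum:
  assumes "p \<in> trig_poly Z"
  shows "\<exists>K c. finite K \<and> K \<subseteq> Z \<and> (\<forall>x. complex_of_real (p x) = wave_sum K c x)"
  using assms unfolding trig_poly_def wave_span_def by (auto dest: fun_cong)

lemma trig_poly_eq_Re:
  assumes "\<And>x. complex_of_real (p x) = wave_sum K c x"
  shows "p = (\<lambda>x. Re (wave_sum K c x))"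
  using assms by (metis Re_complex_of_real)

lemma trig_poly_smooth_per:
  assumes "p \<in> trig_poly Z" "Z \<subseteq> int_vecs"
  shows "p \<in> smooth_per"
proof -
  obtain K c where K: "K \<subseteq> Z" "\<And>x. complex_of_real (p x) = wave_sum K c x"
    using trig_poly_wave_sum[OF assms(1)] by blast
  show ?thesis
    unfolding trig_poly_eq_Re[OF K(2)] using K(1) assms(2) by (intro Re_wave_sum_smooth_per) auto
qed

text \<open>
  The real derivative of \<open>p\<close> can be read off from the complex expansion because derivatives are
  unique: embedding the reals into the complex numbers commutes with differentiation.
\<close>

lemma partial_of_wave_sum:
  fixes p :: "real^'n \<Rightarrow> real"
  assumes p: "\<And>x. complex_of_real (p x) = wave_sum K c x"
  shows "complex_of_real (partial i p x) = wave_sum K (dsymbol i c) x"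
proof -
  have "(p has_derivative frechet_derivative p (at x)) (at x)"
    unfolding trig_poly_eq_Re[OF p] using Re_wave_sum_differentiable frechet_derivative_works by blast
  then have "((\<lambda>x. complex_of_real (p x)) has_derivative
      (\<lambda>h. complex_of_real (frechet_derivative p (at x) h))) (at x)"
    by (rule has_derivative_of_real)
  then have "(wave_sum K c has_derivative (\<lambda>h. complex_of_real (frechet_derivative p (at x) h))) (at x)"
    unfolding p by simp
  then have "(\<lambda>h. complex_of_real (frechet_derivative p (at x) h))
      = (\<lambda>h. \<Sum>k\<in>K. c k * (2 * pi * \<i> * of_real (k \<bullet> h) * wave k x))"
    using wave_sum_has_derivative by (rule has_derivative_unique)
  from fun_cong[OF this, of "axis i 1"] show ?thesis
    by (simp add: partial_def wave_sum_def dsymbol_def inner_axis mult_ac)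
qed

subsection \<open>Algebraic closure properties\<close>

lemma wave_sum_mono:
  assumes "finite K'" "K \<subseteq> K'"
  shows "wave_sum K c = wave_sum K' (\<lambda>k. if k \<in> K then c k else 0)"
proof
  fix x
  have "(\<Sum>k\<in>K'. (if k \<in> K then c k else 0) * wave k x) = (\<Sum>k\<in>K. (if k \<in> K then c k else 0) * wave k x)"
    using assms by (intro sum.mono_neutral_right) auto
  then show "wave_sum K c x = wave_sum K' (\<lambda>k. if k \<in> K then c k else 0) x"
    by (simp add: wave_sum_def)
qed

lemma wave_span_add:
  assumes "P \<in> wave_span Z" "Q \<in> wave_span Z"
  shows "(\<lambda>x. P x + Q x) \<in> wave_span Z"
proof -
  obtain K c L d where K: "finite K" "K \<subseteq> Z" "P = wave_sum K c"
    and L: "finite L" "L \<subseteq> Z" "Q = wave_sum L d"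
    using assms by (auto simp: wave_span_def)
  have "P = wave_sum (K \<union> L) (\<lambda>k. if k \<in> K then c k else 0)"
       "Q = wave_sum (K \<union> L) (\<lambda>k. if k \<in> L then d k else 0)"
    unfolding K(3) L(3) using K(1) L(1) by (intro wave_sum_mono; simp)+
  then have "(\<lambda>x. P x + Q x)
      = wave_sum (K \<union> L) (\<lambda>k. (if k \<in> K then c k else 0) + (if k \<in> L then d k else 0))"
    by (simp add: wave_sum_def[abs_def] sum.distrib distrib_right)
  then show ?thesis
    using K L unfolding wave_span_def by blast
qed

lemma wave_span_scale:
  assumes "P \<in> wave_span Z"
  shows "(\<lambda>x. a * P x) \<in> wave_span Z"
proof -
  obtain K c where K: "finite K" "K \<subseteq> Z" "P = wave_sum K c"
    using assms by (auto simp: wave_span_def)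
  then have "(\<lambda>x. a * P x) = wave_sum K (\<lambda>k. a * c k)"
    by (simp add: wave_sum_def[abs_def] sum_distrib_left mult.assoc)
  then show ?thesis
    using K unfolding wave_span_def by blast
qed

lemma wave_span_0: "(\<lambda>x. 0) \<in> wave_span Z"
  unfolding wave_span_def mem_Collect_eq by (intro exI[of _ "{}"]) (simp add: wave_sum_def[abs_def])

lemma wave_span_wave:
  assumes "k \<in> Z"
  shows "wave k \<in> wave_span Z"
proof -
  have "wave k = wave_sum {k} (\<lambda>_. 1)"
    by (simp add: wave_sum_def[abs_def])
  then show ?thesis
    using assms unfolding wave_span_def by blast
qed

lemma wave_span_sum:
  "(\<And>i. i \<in> I \<Longrightarrow> P i \<in> wave_span Z) \<Longrightarrow> (\<lambda>x. \<Sum>i\<in>I. P i x) \<in> wave_span Z"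
  by (induction I rule: infinite_finite_induct) (auto intro: wave_span_add wave_span_0)

lemma wave_span_mult:
  assumes "P \<in> wave_span int_vecs" "Q \<in> wave_span int_vecs"
  shows "(\<lambda>x. P x * Q x) \<in> wave_span int_vecs"
proof -
  obtain K c L d where K: "finite K" "K \<subseteq> int_vecs" "P = wave_sum K c"
    and L: "finite L" "L \<subseteq> int_vecs" "Q = wave_sum L d"
    using assms by (auto simp: wave_span_def)
  have "P x * Q x = (\<Sum>k\<in>K. \<Sum>l\<in>L. (c k * d l) * wave (k + l) x)" for x
    by (simp add: K(3) L(3) wave_sum_def sum_product wave_mult[symmetric] mult_ac)
  moreover have "(\<lambda>x. \<Sum>k\<in>K. \<Sum>l\<in>L. (c k * d l) * wave (k + l) x) \<in> wave_span int_vecs"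
    using K(2) L(2) by (intro wave_span_sum wave_span_scale wave_span_wave) (auto simp: subset_iff)
  ultimately show ?thesis
    by simp
qed

lemma wave_span_cnj:
  assumes "P \<in> wave_span Z" "\<And>k. k \<in> Z \<Longrightarrow> - k \<in> Z"
  shows "(\<lambda>x. cnj (P x)) \<in> wave_span Z"
proof -
  obtain K c where K: "finite K" "K \<subseteq> Z" "P = wave_sum K c"
    using assms by (auto simp: wave_span_def)
  have "cnj (P x) = (\<Sum>k\<in>K. cnj (c k) * wave (- k) x)" for x
    by (simp add: K(3) wave_sum_def cnj_wave)
  moreover have "(\<lambda>x. \<Sum>k\<in>K. cnj (c k) * wave (- k) x) \<in> wave_span Z"
    using K(2) assms(2) by (intro wave_span_sum wave_span_scale wave_span_wave) auto
  ultimately show ?thesis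
    by simp
qed

lemma trig_poly_Re:
  assumes "P \<in> wave_span Z" "\<And>k. k \<in> Z \<Longrightarrow> - k \<in> Z"
  shows "(\<lambda>x. Re (P x)) \<in> trig_poly Z"
proof -
  have "complex_of_real (Re z) = (1/2) * (z + cnj z)" for z
    by (simp add: complex_eq_iff)
  then have "(\<lambda>x. complex_of_real (Re (P x))) = (\<lambda>x. (1/2) * (P x + cnj (P x)))"
    by auto
  also have "\<dots> \<in> wave_span Z"
    using assms by (intro wave_span_scale wave_span_add wave_span_cnj)
  finally show ?thesis
    by (simp add: trig_poly_def)
qed

lemma trig_poly_add:
  "p \<in> trig_poly Z \<Longrightarrow> q \<in> trig_poly Z \<Longrightarrow> (\<lambda>x. p x + q x) \<in> trig_poly Z"
  using wave_span_add unfolding trig_poly_def by fastforce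

lemma trig_poly_scale: "p \<in> trig_poly Z \<Longrightarrow> (\<lambda>x. a * p x) \<in> trig_poly Z"
  using wave_span_scale[where a="complex_of_real a"] unfolding trig_poly_def by fastforce

lemma trig_poly_diff:
  "p \<in> trig_poly Z \<Longrightarrow> q \<in> trig_poly Z \<Longrightarrow> (\<lambda>x. p x - q x) \<in> trig_poly Z"
  using trig_poly_add[of p Z "\<lambda>x. (-1) * q x"] trig_poly_scale[of q Z "-1"] by simp

lemma trig_poly_mult:
  "p \<in> trig_poly int_vecs \<Longrightarrow> q \<in> trig_poly int_vecs \<Longrightarrow> (\<lambda>x. p x * q x) \<in> trig_poly int_vecs"
  using wave_span_mult unfolding trig_poly_def by fastforce

lemma trig_poly_sum:
  "(\<And>i. i \<in> I \<Longrightarrow> p i \<in> trig_poly Z) \<Longrightarrow> (\<lambda>x. \<Sum>i\<in>I. p i x) \<in> trig_poly Z"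
  using wave_span_sum[of I "\<lambda>i x. complex_of_real (p i x)"] unfolding trig_poly_def by simp

lemma trig_poly_const: "(\<lambda>x. a) \<in> trig_poly int_vecs"
  using wave_span_scale[OF wave_span_wave[OF int_vecs_simps(1)], of "complex_of_real a"]
  by (simp add: trig_poly_def)

subsection \<open>Parseval's identity\<close>

text \<open>
  A wave with a nonzero frequency is, up to a factor, a derivative of itself, and derivatives of
  periodic functions integrate to zero.
\<close>

lemma cell_integral_wave:
  fixes k :: "real^'n"
  assumes k: "k \<in> int_vecs"
  shows "cell_integral (\<lambda>x. Re (a * wave k x)) = (if k = 0 then Re a else 0)"
proof (cases "k = 0")
  case False
  then obtain i where i: "k $ i \<noteq> 0"
    by (auto simp: vec_eq_iff)
  define c where "c = (\<lambda>l::real^'n. a / (2 * pi * \<i> * of_real (k $ i)))"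
  have "dsymbol i c k = a"
    using i by (simp add: dsymbol_def c_def)
  then have "(\<lambda>x. Re (a * wave k x)) = partial i (\<lambda>x. Re (wave_sum {k} c x))"
    unfolding partial_Re_wave_sum by (simp add: wave_sum_def del: times_complex.sel)
  moreover have "(\<lambda>x. Re (wave_sum {k} c x)) \<in> smooth_per"
    using k by (intro Re_wave_sum_smooth_per) simp
  ultimately show ?thesis
    using False cell_integral_partial_eq_0 smooth_perD by metis
qed simp

lemma wave_sum_Parseval:
  fixes K :: "(real^'n) set"
  assumes "finite K" "K \<subseteq> int_vecs"
  shows "cell_integral (\<lambda>x. (cmod (wave_sum K c x))\<^sup>2) = (\<Sum>k\<in>K. (cmod (c k))\<^sup>2)"
proof -
  have "(cmod (wave_sum K c x))\<^sup>2 = (\<Sum>k\<in>K. \<Sum>l\<in>K. Re ((c k * cnj (c l)) * wave (k - l) x))" for x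
  proof -
    have "(cmod (wave_sum K c x))\<^sup>2 = Re (wave_sum K c x * cnj (wave_sum K c x))"
      by (metis Re_complex_of_real complex_norm_square)
    also have "wave_sum K c x * cnj (wave_sum K c x)
        = (\<Sum>k\<in>K. \<Sum>l\<in>K. (c k * cnj (c l)) * (wave k x * wave (- l) x))"
      by (simp add: wave_sum_def sum_product cnj_wave mult_ac)
    finally show ?thesis
      by (simp only: wave_mult Re_sum diff_conv_add_uminus)
  qed
  then have "cell_integral (\<lambda>x. (cmod (wave_sum K c x))\<^sup>2)
      = cell_integral (\<lambda>x. \<Sum>k\<in>K. \<Sum>l\<in>K. Re ((c k * cnj (c l)) * wave (k - l) x))"
    by simp
  also have "\<dots> = (\<Sum>k\<in>K. \<Sum>l\<in>K. cell_integral (\<lambda>x. Re ((c k * cnj (c l)) * wave (k - l) x)))"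
  proof -
    have "integrable cell (\<lambda>x. Re ((c k * cnj (c l)) * wave (k - l) x))" if "k \<in> K" "l \<in> K" for k l
    proof -
      have "(\<lambda>x. Re (wave_sum {k - l} (\<lambda>_. c k * cnj (c l)) x)) \<in> smooth_per"
        using that assms by (intro Re_wave_sum_smooth_per) (auto simp: subset_iff)
      then show ?thesis
        using L2_per_integrable[OF smooth_per_L2_per] by (force simp: wave_sum_def)
    qed
    then show ?thesis
      unfolding cell_integral_def by (simp add: Bochner_Integration.integral_sum)
  qed
  also have "\<dots> = (\<Sum>k\<in>K. \<Sum>l\<in>K. if k = l then Re (c k * cnj (c l)) else 0)"
    using assms by (intro sum.cong refl) (auto simp: cell_integral_wave subset_iff simp del: times_complex.sel)
  also have "\<dots> = (\<Sum>k\<in>K. (cmod (c k))\<^sup>2)"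
    using assms by (simp add: complex_norm_square[symmetric] del: of_real_power)
  finally show ?thesis .
qed

lemma trig_poly_norm:
  assumes "finite K" "K \<subseteq> int_vecs" "\<And>x. complex_of_real (p x) = wave_sum K c x"
  shows "(L2_norm p)\<^sup>2 = (\<Sum>k\<in>K. (cmod (c k))\<^sup>2)"
proof -
  have "p x * p x = (cmod (wave_sum K c x))\<^sup>2" for x
    unfolding assms(3)[symmetric] by (simp add: power2_eq_square)
  then show ?thesis
    using wave_sum_Parseval[OF assms(1,2)] by (simp add: L2_norm_square L2_inner_def)
qed

lemma trig_poly_mean_0:
  assumes "p \<in> trig_poly (int_vecs - {0})"
  shows "cell_integral p = 0"
proof -
  obtain K c where K: "finite K" "K \<subseteq> int_vecs - {0}" "\<And>x. complex_of_real (p x) = wave_sum K c x"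
    using trig_poly_wave_sum[OF assms] by blast
  have "integrable cell (\<lambda>x. Re (c k * wave k x))" if "k \<in> K" for k
  proof -
    have "(\<lambda>x. Re (wave_sum {k} c x)) \<in> smooth_per"
      using that K by (intro Re_wave_sum_smooth_per) auto
    then show ?thesis
      using L2_per_integrable[OF smooth_per_L2_per] by (force simp: wave_sum_def)
  qed
  then have "cell_integral p = (\<Sum>k\<in>K. cell_integral (\<lambda>x. Re (c k * wave k x)))"
    unfolding trig_poly_eq_Re[OF K(3)]
    by (simp add: cell_integral_def wave_sum_def Re_sum del: times_complex.sel)
  also have "\<dots> = 0"
    using K(2) by (intro sum.neutral) (auto simp: cell_integral_wave subset_iff simp del: times_complex.sel)
  finally show ?thesis .
qed

subsection \<open>Inverting the Laplacian on trigonometric polynomials\<close>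

definition classical_laplacian :: "(real^'n \<Rightarrow> real) \<Rightarrow> real^'n \<Rightarrow> real" where
  "classical_laplacian u x = (\<Sum>i\<in>UNIV. partial i (partial i u) x)"

lemma int_vec_norm_ge_1:
  fixes k :: "real^'n"
  assumes "k \<in> int_vecs" "k \<noteq> 0"
  shows "1 \<le> (norm k)\<^sup>2"
proof -
  obtain i where i: "k $ i \<noteq> 0"
    using assms by (auto simp: vec_eq_iff)
  have "1 \<le> \<bar>k $ i\<bar>"
    using assms(1) i Ints_nonzero_abs_ge1 by (auto simp: int_vecs_def)
  also have "\<dots> \<le> norm k"
    by (rule component_le_norm_cart)
  finally show ?thesis
    by (simp add: one_le_power)
qed

lemma norm_square_sum: "(norm (k :: real^'n))\<^sup>2 = (\<Sum>i\<in>UNIV. (k $ i)\<^sup>2)"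
  unfolding power2_norm_eq_inner inner_vec_def by (simp add: power2_eq_square)

lemma sum_dsymbol_twice:
  "(\<Sum>i\<in>UNIV. dsymbol i (dsymbol i c) k) = - of_real ((2 * pi)\<^sup>2 * (norm k)\<^sup>2) * c k"
proof -
  have "(\<Sum>i\<in>UNIV. dsymbol i (dsymbol i c) k)
      = (\<Sum>i\<in>UNIV. of_real ((k $ i)\<^sup>2) * (- of_real ((2 * pi)\<^sup>2) * c k))"
    by (intro sum.cong refl) (simp add: dsymbol_twice power2_eq_square)
  also have "\<dots> = of_real (\<Sum>i\<in>UNIV. (k $ i)\<^sup>2) * (- of_real ((2 * pi)\<^sup>2) * c k)"
    unfolding of_real_sum by (rule sum_distrib_right[symmetric])
  finally show ?thesis
    by (simp add: norm_square_sum)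
qed

lemma lap_of_wave_sum:
  fixes p :: "real^'n \<Rightarrow> real"
  assumes p: "\<And>x. complex_of_real (p x) = wave_sum K c x"
  shows "complex_of_real (classical_laplacian p x) = wave_sum K (\<lambda>k. - of_real ((2 * pi)\<^sup>2 * (norm k)\<^sup>2) * c k) x"
proof -
  have "complex_of_real (classical_laplacian p x) = (\<Sum>i\<in>UNIV. wave_sum K (dsymbol i (dsymbol i c)) x)"
    unfolding classical_laplacian_def of_real_sum by (intro sum.cong refl partial_of_wave_sum p)
  also have "\<dots> = (\<Sum>k\<in>K. \<Sum>i\<in>UNIV. dsymbol i (dsymbol i c) k * wave k x)"
    unfolding wave_sum_def by (rule sum.swap)
  also have "\<dots> = wave_sum K (\<lambda>k. - of_real ((2 * pi)\<^sup>2 * (norm k)\<^sup>2) * c k) x"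
    unfolding wave_sum_def sum_distrib_right[symmetric] sum_dsymbol_twice ..
  finally show ?thesis .
qed

text \<open>
  On the Fourier side the second derivatives act by the symbols \<open>-4\<pi>\<^sup>2 k\<^sub>i k\<^sub>j\<close>, and the squares
  of \<open>k\<^sub>i k\<^sub>j\<close> add up to the fourth power of \<open>norm k\<close>. Poincare's inequality holds because a
  nonzero lattice vector has length at least one.
\<close>

lemma
  fixes q :: "real^'n \<Rightarrow> real"
  assumes q: "q \<in> trig_poly (int_vecs - {0})"
  shows trig_poly_hessian_norm: "(\<Sum>i\<in>UNIV. \<Sum>j\<in>UNIV. (L2_norm (partial i (partial j q)))\<^sup>2) = (L2_norm (classical_laplacian q))\<^sup>2"
    and trig_poly_gradient_norm: "L2_norm (partial i q) \<le> L2_norm (classical_laplacian q)"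
    and trig_poly_Poincare: "L2_norm q \<le> L2_norm (classical_laplacian q)"
proof -
  obtain K c where K: "finite K" "K \<subseteq> int_vecs - {0}" "\<And>x. complex_of_real (q x) = wave_sum K c x"
    using trig_poly_wave_sum[OF q] by blast
  have K': "K \<subseteq> int_vecs"
    using K(2) by blast
  note norm = trig_poly_norm[OF K(1) K']
  define N where "N k = (2 * pi)\<^sup>2 * (norm k)\<^sup>2" for k :: "real^'n"
  have N: "(L2_norm (classical_laplacian q))\<^sup>2 = (\<Sum>k\<in>K. (N k)\<^sup>2 * (cmod (c k))\<^sup>2)"
    unfolding norm[OF lap_of_wave_sum[OF K(3)]] N_def[symmetric]
    by (simp add: norm_mult power_mult_distrib)
  have N1: "1 \<le> N k" "(2 * pi)\<^sup>2 * (k $ i)\<^sup>2 \<le> N k" if "k \<in> K" for k i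
  proof -
    have "1 \<le> (norm k)\<^sup>2"
      using that K(2) int_vec_norm_ge_1 by blast
    moreover have "1 \<le> (2 * pi)\<^sup>2"
      using pi_gt3 by (intro one_le_power) simp
    ultimately show "1 \<le> N k"
      unfolding N_def using mult_mono[of 1 "(2 * pi)\<^sup>2" 1 "(norm k)\<^sup>2"] by simp
    have "(k $ i)\<^sup>2 \<le> (norm k)\<^sup>2"
      using component_le_norm_cart[of k i] by (metis abs_le_square_iff abs_norm_cancel)
    then show "(2 * pi)\<^sup>2 * (k $ i)\<^sup>2 \<le> N k"
      unfolding N_def by (intro mult_left_mono) simp_all
  qed
  have N2: "N k \<le> (N k)\<^sup>2" if "k \<in> K" for k
    using N1(1)[OF that] by (simp add: power2_eq_square)
  have "(L2_norm (partial i q))\<^sup>2 \<le> (L2_norm (classical_laplacian q))\<^sup>2"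
    unfolding norm[OF partial_of_wave_sum[OF K(3)]] N
  proof (rule sum_mono)
    fix k assume k: "k \<in> K"
    have "(cmod (dsymbol i c k))\<^sup>2 = ((2 * pi)\<^sup>2 * (k $ i)\<^sup>2) * (cmod (c k))\<^sup>2"
      by (simp add: dsymbol_def norm_mult power_mult_distrib)
    also have "\<dots> \<le> (N k)\<^sup>2 * (cmod (c k))\<^sup>2"
      using N1(2)[OF k, of i] N2[OF k] by (intro mult_right_mono) auto
    finally show "(cmod (dsymbol i c k))\<^sup>2 \<le> (N k)\<^sup>2 * (cmod (c k))\<^sup>2" .
  qed
  then show "L2_norm (partial i q) \<le> L2_norm (classical_laplacian q)"
    by (rule power2_le_imp_le) simp
  have "(L2_norm q)\<^sup>2 \<le> (L2_norm (classical_laplacian q))\<^sup>2"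
    unfolding norm[OF K(3)] N
  proof (rule sum_mono)
    fix k assume k: "k \<in> K"
    show "(cmod (c k))\<^sup>2 \<le> (N k)\<^sup>2 * (cmod (c k))\<^sup>2"
      using mult_right_mono[of 1 "(N k)\<^sup>2" "(cmod (c k))\<^sup>2"] N1(1)[OF k] N2[OF k] by simp
  qed
  then show "L2_norm q \<le> L2_norm (classical_laplacian q)"
    by (rule power2_le_imp_le) simp
  have "(\<Sum>i\<in>UNIV. \<Sum>j\<in>UNIV. (L2_norm (partial i (partial j q)))\<^sup>2)
      = (\<Sum>i\<in>UNIV. \<Sum>j\<in>UNIV. \<Sum>k\<in>K. (cmod (dsymbol i (dsymbol j c) k))\<^sup>2)"
    by (intro sum.cong refl norm partial_of_wave_sum K(3))
  also have "\<dots> = (\<Sum>k\<in>K. \<Sum>i\<in>UNIV. \<Sum>j\<in>UNIV. (cmod (dsymbol i (dsymbol j c) k))\<^sup>2)"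
    by (subst sum.swap[of _ K]) (intro sum.cong refl sum.swap)
  also have "\<dots> = (\<Sum>k\<in>K. (N k)\<^sup>2 * (cmod (c k))\<^sup>2)"
  proof (intro sum.cong refl)
    fix k
    have "(cmod (dsymbol i (dsymbol j c) k))\<^sup>2 = ((2 * pi)\<^sup>2)\<^sup>2 * (cmod (c k))\<^sup>2 * ((k $ i)\<^sup>2 * (k $ j)\<^sup>2)" for i j
      by (simp add: dsymbol_twice norm_mult norm_power power_mult_distrib)
    then show "(\<Sum>i\<in>UNIV. \<Sum>j\<in>UNIV. (cmod (dsymbol i (dsymbol j c) k))\<^sup>2) = (N k)\<^sup>2 * (cmod (c k))\<^sup>2"
      by (simp add: N_def norm_square_sum power_mult_distrib power2_eq_square[of "sum _ _"] sum_product
          flip: sum_distrib_left)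
  qed
  finally show "(\<Sum>i\<in>UNIV. \<Sum>j\<in>UNIV. (L2_norm (partial i (partial j q)))\<^sup>2) = (L2_norm (classical_laplacian q))\<^sup>2"
    using N by simp
qed

lemma lap_diff:
  fixes u w :: "real^'n \<Rightarrow> real"
  assumes "u \<in> smooth_per" "w \<in> smooth_per"
  shows "classical_laplacian (\<lambda>x. u x - w x) x = classical_laplacian u x - classical_laplacian w x"
    and partial_diff: "partial i (\<lambda>x. u x - w x) = (\<lambda>x. partial i u x - partial i w x)"
proof -
  have d: "partial i (\<lambda>x. u x - w x) = (\<lambda>x. partial i u x - partial i w x)"
    if "u \<in> smooth_per" "w \<in> smooth_per" for i and u w :: "real^'n \<Rightarrow> real"
  proof
    fix x
    have "((\<lambda>x. u x - w x) has_derivative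
      (\<lambda>h. frechet_derivative u (at x) h - frechet_derivative w (at x) h)) (at x)"
      using that by (intro has_derivative_diff) (simp_all add: frechet_derivative_works[symmetric] smooth_perD)
    from frechet_derivative_at[OF this]
    show "partial i (\<lambda>x. u x - w x) x = partial i u x - partial i w x"
      by (simp add: partial_def fun_eq_iff)
  qed
  then show "partial i (\<lambda>x. u x - w x) = (\<lambda>x. partial i u x - partial i w x)"
    using assms by blast
  show "classical_laplacian (\<lambda>x. u x - w x) x = classical_laplacian u x - classical_laplacian w x"
    using assms by (simp add: classical_laplacian_def d partial_smooth_per sum_subtractf)
qed

text \<open>
  The coefficients with nonzero frequency are divided by the multiplier of the Laplacian. Taking
  the real part of the resulting sum makes the solution real and does not affect the equation, as
  \<open>p\<close> is real.
\<close>

lemma trig_poly_lap_surj: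
  fixes p :: "real^'n \<Rightarrow> real"
  assumes p: "p \<in> trig_poly int_vecs"
  shows "\<exists>q\<in>trig_poly (int_vecs - {0}). \<forall>x. classical_laplacian q x = p x - cell_integral p"
proof -
  obtain K c where K: "finite K" "K \<subseteq> int_vecs" "\<And>x. complex_of_real (p x) = wave_sum K c x"
    using trig_poly_wave_sum[OF p] by blast
  define d where "d k = - c k / of_real ((2 * pi)\<^sup>2 * (norm k)\<^sup>2)" for k :: "real^'n"
  let ?K = "K - {0}"
  define q where "q x = Re (wave_sum ?K d x)" for x
  have "wave_sum ?K d \<in> wave_span (int_vecs - {0})"
    using K unfolding wave_span_def by blast
  then have q: "q \<in> trig_poly (int_vecs - {0})"
    unfolding q_def[abs_def] by (rule trig_poly_Re) auto
  have classical_laplacian: "classical_laplacian q x = Re (wave_sum ?K c x)" for x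
  proof -
    have "classical_laplacian q x = (\<Sum>i\<in>UNIV. Re (wave_sum ?K (dsymbol i (dsymbol i d)) x))"
      unfolding classical_laplacian_def q_def[abs_def] by (simp add: partial_Re_wave_sum)
    also have "\<dots> = Re (\<Sum>k\<in>?K. \<Sum>i\<in>UNIV. dsymbol i (dsymbol i d) k * wave k x)"
      unfolding wave_sum_def Re_sum[symmetric] by (subst sum.swap) simp
    also have "(\<Sum>k\<in>?K. \<Sum>i\<in>UNIV. dsymbol i (dsymbol i d) k * wave k x) = wave_sum ?K c x"
      unfolding wave_sum_def
      sum_distrib_right[symmetric] sum_dsymbol_twice
      by (intro sum.cong refl) (auto simp: d_def)
    finally show ?thesis .
  qed
  define m where "m = (if 0 \<in> K then Re (c 0) else 0)"
  have pm: "p x = classical_laplacian q x + m" for x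
    unfolding classical_laplacian trig_poly_eq_Re[OF K(3)] wave_sum_def m_def using K(1)
    by (cases "0 \<in> K") (simp_all add: sum.remove)
  have "cell_integral (classical_laplacian q) = 0"
  proof -
    have "wave_sum ?K c \<in> wave_span (int_vecs - {0})"
      using K unfolding wave_span_def by blast
    then have "(\<lambda>x. Re (wave_sum ?K c x)) \<in> trig_poly (int_vecs - {0})"
      by (rule trig_poly_Re) auto
    then show ?thesis
      using trig_poly_mean_0 classical_laplacian by (metis (no_types, lifting) ext)
  qed
  moreover have "p \<in> L2_per"
    using trig_poly_smooth_per[OF p] smooth_per_L2_per by auto
  ultimately have "cell_integral p = m"
    using cell_integral_diff[of p "\<lambda>x. m"] pm by (simp add: add_diff_eq)
  then have "\<forall>x. classical_laplacian q x = p x - cell_integral p"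
    using pm by simp
  then show ?thesis
    using q by blast
qed

section \<open>Density of the trigonometric polynomials\<close>

definition torus_map :: "real^'n \<Rightarrow> complex^'n" where
  "torus_map x = (\<chi> i. cis (2 * pi * x $ i))"

lemma trig_poly_torus_component:
  assumes "b \<in> (Basis :: (complex^'n) set)"
  shows "(\<lambda>x. torus_map x \<bullet> b) \<in> trig_poly int_vecs"
proof -
  obtain i u where b: "b = axis i u"
    using assms by (auto simp: Basis_vec_def)
  have "torus_map x \<bullet> b = Re (cnj u * wave (axis i 1) x)" for x :: "real^'n"
    by (simp add: b inner_axis torus_map_def wave_def inner_axis' inner_complex_def)
  moreover have "(\<lambda>x. Re (cnj u * wave (axis i 1) x)) \<in> trig_poly int_vecs"
    using axis_in_int_vecs by (intro trig_poly_Re wave_span_scale wave_span_wave) auto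
  ultimately show ?thesis
    by simp
qed

lemma trig_poly_polynomial_torus:
  fixes g :: "complex^'n \<Rightarrow> real"
  assumes "real_polynomial_function g"
  shows "(\<lambda>x. g (torus_map x)) \<in> trig_poly int_vecs"
  using assms
proof induction
  case (linear f)
  interpret bounded_linear f by fact
  have "f (torus_map x) = (\<Sum>b\<in>Basis. f b * (torus_map x \<bullet> b))" for x :: "real^'n"
  proof -
    have "f (torus_map x) = f (\<Sum>b\<in>Basis. (torus_map x \<bullet> b) *\<^sub>R b)"
      by (simp only: euclidean_representation)
    also have "\<dots> = (\<Sum>b\<in>Basis. f b * (torus_map x \<bullet> b))"
      by (simp add: sum scaleR mult.commute)
    finally show ?thesis .
  qed
  moreover have "(\<lambda>x. \<Sum>b\<in>Basis. f b * (torus_map x \<bullet> b)) \<in> trig_poly int_vecs"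
    by (intro trig_poly_sum trig_poly_scale trig_poly_torus_component)
  ultimately show ?case
    by simp
qed (auto intro: trig_poly_const trig_poly_add trig_poly_mult)

text \<open>
  Points of the closed cube that are identified on the torus differ by one in some coordinate,
  hence both lie on the boundary.
\<close>

lemma torus_map_eq_cube:
  assumes "x \<in> cbox 0 1" "y \<in> cbox 0 1" "torus_map x = torus_map y" "x \<noteq> y"
  shows "x \<notin> unit_cell \<and> y \<notin> unit_cell"
proof -
  obtain i where i: "x $ i \<noteq> y $ i"
    using assms(4) by (auto simp: vec_eq_iff)
  have "cis (2 * pi * x $ i) = cis (2 * pi * y $ i)"
    using assms(3) by (simp add: torus_map_def vec_eq_iff)
  then have "cis (2 * pi * (x $ i - y $ i)) = 1"
    by (simp add: right_diff_distrib flip: cis_divide)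
  then have "cos (2 * pi * (x $ i - y $ i)) = 1"
    by (simp add: complex_eq_iff)
  then obtain m :: int where m: "2 * pi * (x $ i - y $ i) = of_int m * 2 * pi"
    using cos_one_2pi_int by blast
  then have m: "x $ i - y $ i = of_int m"
    by simp
  moreover have "0 \<le> x $ i" "x $ i \<le> 1" "0 \<le> y $ i" "y $ i \<le> 1"
    using assms(1,2) by (auto simp: mem_box_cart)
  moreover have "m \<noteq> 0"
    using i m by auto
  ultimately have "m = 1 \<or> m = -1"
    by linarith
  then have "\<not> (0 < x $ i \<and> x $ i < 1) \<and> \<not> (0 < y $ i \<and> y $ i < 1)"
    using m \<open>0 \<le> x $ i\<close> \<open>x $ i \<le> 1\<close> \<open>0 \<le> y $ i\<close> \<open>y $ i \<le> 1\<close> by auto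
  then show ?thesis
    unfolding unit_cell_eq by blast
qed

text \<open>
  A continuous function on the closed cube that vanishes on the boundary descends to the torus,
  which is a quotient of the cube; on the compact image of the torus the Stone--Weierstrass
  theorem applies, and polynomials restrict to trigonometric polynomials there.
\<close>

lemma trig_poly_uniform_approx:
  fixes h :: "real^'n \<Rightarrow> real"
  assumes cont: "continuous_on (cbox 0 1) h"
    and bdry: "\<And>x. x \<in> cbox 0 1 \<Longrightarrow> x \<notin> unit_cell \<Longrightarrow> h x = 0"
    and e: "0 < e"
  shows "\<exists>p\<in>trig_poly int_vecs. \<forall>x\<in>unit_cell. \<bar>h x - p x\<bar> < e"
proof -
  let ?Q = "cbox 0 1 :: (real^'n) set"
  define T where "T = torus_map ` ?Q"
  define F where "F z = h (SOME x. x \<in> ?Q \<and> torus_map x = z)" for z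
  have F: "F (torus_map x) = h x" if x: "x \<in> ?Q" for x
  proof -
    define y where "y = (SOME y. y \<in> ?Q \<and> torus_map y = torus_map x)"
    have y: "y \<in> ?Q \<and> torus_map y = torus_map x"
      unfolding y_def by (rule someI[of _ x]) (use x in simp)
    have "h y = h x"
    proof (cases "x = y")
      case False
      then show ?thesis
        using torus_map_eq_cube[OF x, of y] y x bdry by auto
    qed simp
    then show ?thesis
      by (simp add: F_def y_def)
  qed
  have tm: "continuous_on ?Q torus_map"
    unfolding torus_map_def by (intro continuous_intros)
  have quot: "quotient_map (top_of_set ?Q) (top_of_set T) torus_map"
  proof (rule T1_Spaces.continuous_imp_quotient_map)
    show "continuous_map (top_of_set ?Q) (top_of_set T) torus_map"
      using tm by (simp add: continuous_map_in_subtopology T_def)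
    show "compact_space (top_of_set ?Q)"
      by (simp add: compact_space_subtopology)
    show "Hausdorff_space (top_of_set T)"
      by (simp add: Hausdorff_space_subtopology)
  qed (simp add: T_def)
  have "continuous_on ?Q (F \<circ> torus_map)"
    using cont F by (simp cong: continuous_on_cong)
  then have "continuous_map (top_of_set ?Q) euclidean (F \<circ> torus_map)"
    by (simp only: continuous_map_iff_continuous)
  then have "continuous_map (top_of_set T) euclidean F"
    using continuous_compose_quotient_map_eq[OF quot] by blast
  then have "continuous_on T F"
    by (simp only: continuous_map_iff_continuous)
  moreover have "compact T"
    unfolding T_def using tm by (intro compact_continuous_image) auto
  ultimately obtain g where g: "real_polynomial_function g" "\<And>z. z \<in> T \<Longrightarrow> \<bar>F z - g z\<bar> < e"
    using Stone_Weierstrass_real_polynomial_function e by blast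
  have "\<bar>h x - g (torus_map x)\<bar> < e" if "x \<in> unit_cell" for x
  proof -
    have "x \<in> ?Q"
      using that box_subset_cbox unfolding unit_cell_def by blast
    then show ?thesis
      using g(2)[of "torus_map x"] F by (simp add: T_def)
  qed
  then have "\<forall>x\<in>unit_cell. \<bar>h x - g (torus_map x)\<bar> < e"
    by simp
  then show ?thesis
    using trig_poly_polynomial_torus[OF g(1)] by (rule bexI)
qed

definition clip :: "real \<Rightarrow> real \<Rightarrow> real" where
  "clip M t = max (- M) (min M t)"

lemma abs_clip_le: "0 \<le> M \<Longrightarrow> \<bar>clip M t\<bar> \<le> M"
  by (auto simp: clip_def)

lemma continuous_on_clip [continuous_intros]:
  "continuous_on S f \<Longrightarrow> continuous_on S (\<lambda>x. clip M (f x))"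
  unfolding clip_def by (intro continuous_intros)

lemma clip_measurable [measurable]: "clip M \<in> borel_measurable borel"
  unfolding clip_def by measurable

lemma clip_tendsto: "(\<lambda>m. clip (real m) t) \<longlonglongrightarrow> t"
proof (rule tendsto_eventually)
  obtain N :: nat where N: "\<bar>t\<bar> \<le> real N"
    using real_arch_simple by blast
  have "clip (real m) t = t" if "N \<le> m" for m
  proof -
    have "real N \<le> real m"
      using that by simp
    then have "\<bar>t\<bar> \<le> real m"
      using N by linarith
    then show ?thesis
      unfolding clip_def by linarith
  qed
  then show "\<forall>\<^sub>F m in sequentially. clip (real m) t = t"
    by (rule eventually_sequentiallyI)
qed

lemma clip_approx:
  fixes u :: "real^'n \<Rightarrow> real"
  assumes u: "u \<in> L2_per"
  shows "(\<lambda>m. cell_integral (\<lambda>x. (u x - clip (real m) (u x))\<^sup>2)) \<longlonglongrightarrow> 0"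
proof -
  have [measurable]: "u \<in> borel_measurable cell"
    using u by (rule L2_per_measurable_cell)
  have "(\<lambda>m. integral\<^sup>L cell (\<lambda>x. (u x - clip (real m) (u x))\<^sup>2)) \<longlonglongrightarrow> integral\<^sup>L (cell :: (real^'n) measure) (\<lambda>x. 0)"
  proof (rule integral_dominated_convergence[where w="\<lambda>x. (u x)\<^sup>2"])
    show "integrable cell (\<lambda>x. (u x)\<^sup>2)"
      using u by (rule L2_per_square_integrable)
    show "AE x in cell. (\<lambda>m. (u x - clip (real m) (u x))\<^sup>2) \<longlonglongrightarrow> 0"
    proof (rule AE_I2)
      fix x
      have "(\<lambda>m. (u x - clip (real m) (u x))\<^sup>2) \<longlonglongrightarrow> (u x - u x)\<^sup>2"
        by (intro tendsto_intros clip_tendsto)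
      then show "(\<lambda>m. (u x - clip (real m) (u x))\<^sup>2) \<longlonglongrightarrow> 0"
        by simp
    qed
    show "AE x in cell. norm ((u x - clip (real m) (u x))\<^sup>2) \<le> (u x)\<^sup>2" for m
    proof (rule AE_I2)
      fix x
      have "\<bar>u x - clip (real m) (u x)\<bar> \<le> \<bar>u x\<bar>"
        by (auto simp: clip_def)
      then show "norm ((u x - clip (real m) (u x))\<^sup>2) \<le> (u x)\<^sup>2"
        by (simp add: abs_le_square_iff)
    qed
  qed measurable
  then show ?thesis
    by (simp add: cell_integral_def)
qed

text \<open>
  A measurable function is almost everywhere a limit of continuous functions. Clipping them at the
  bound \<open>M\<close> allows dominated convergence, and the cutoff \<open>min 1 (n * (\<Prod>i. x\<^sub>i (1 - x\<^sub>i)))\<close>, which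
  increases to one inside the cube, makes them vanish on the boundary, so that they descend to the
  torus.
\<close>

lemma continuous_approx_bounded:
  fixes u :: "real^'n \<Rightarrow> real"
  assumes u: "u \<in> borel_measurable cell" and bound: "\<And>x. \<bar>u x\<bar> \<le> M" and e: "0 < e"
  shows "\<exists>h. continuous_on (cbox 0 1) h \<and> (\<forall>x\<in>cbox 0 1. x \<notin> unit_cell \<longrightarrow> h x = 0) \<and>
    (\<forall>x\<in>cbox 0 1. \<bar>h x\<bar> \<le> M) \<and> cell_integral (\<lambda>x. (u x - h x)\<^sup>2) < e"
proof -
  have M: "0 \<le> M"
    using bound[of 0] by linarith
  have [measurable]: "u \<in> borel_measurable cell" by fact
  have "u measurable_on unit_cell"
    using u by (simp add: measurable_on_iff_borel_measurable)
  then obtain N g where N: "negligible N" and g: "\<And>n. continuous_on UNIV (g n)"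
    and lim0: "\<And>x. x \<notin> N \<Longrightarrow> (\<lambda>n. g n x) \<longlonglongrightarrow> (if x \<in> unit_cell then u x else 0)"
    unfolding measurable_on_def by blast
  have lim: "(\<lambda>n. g n x) \<longlonglongrightarrow> u x" if "x \<notin> N" "x \<in> unit_cell" for x
    using lim0[OF that(1)] that(2) by simp
  define c where "c x = (\<Prod>i\<in>UNIV. x $ i * (1 - x $ i))" for x :: "real^'n"
  define h where "h n x = min 1 (real n * c x) * clip M (g n x)" for n x
  have c_nonneg: "0 \<le> c x" if "x \<in> cbox 0 1" for x
    using that unfolding c_def by (intro prod_nonneg) (auto simp: mem_box_cart)
  have c_pos: "0 < c x" if "x \<in> unit_cell" for x
    using that unfolding c_def unit_cell_eq by (intro prod_pos) auto
  have c_zero: "c x = 0" if x: "x \<in> cbox 0 1" "x \<notin> unit_cell" for x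
  proof -
    obtain i where "\<not> (0 < x $ i \<and> x $ i < 1)"
      using x(2) unfolding unit_cell_eq by blast
    moreover have "0 \<le> x $ i \<and> x $ i \<le> 1"
      using x(1) by (simp add: mem_box_cart)
    ultimately have "x $ i = 0 \<or> x $ i = 1"
      by linarith
    then show ?thesis
      unfolding c_def by (intro prod_zero) (auto intro!: bexI[of _ i])
  qed
  have h_cont: "continuous_on UNIV (h n)" for n
    unfolding h_def c_def using g by (intro continuous_intros)
  have h_bound: "\<bar>h n x\<bar> \<le> M" if "x \<in> cbox 0 1" for n x
  proof -
    have "\<bar>min 1 (real n * c x)\<bar> \<le> 1"
      using c_nonneg[OF that] by auto
    then have "\<bar>min 1 (real n * c x)\<bar> * \<bar>clip M (g n x)\<bar> \<le> 1 * M"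
      using abs_clip_le[OF M] by (intro mult_mono) auto
    then show ?thesis
      by (simp add: h_def abs_mult)
  qed
  have cell_sub: "x \<in> cbox 0 1" if "x \<in> unit_cell" for x :: "real^'n"
    using that box_subset_cbox unfolding unit_cell_def by blast
  have "(\<lambda>n. integral\<^sup>L cell (\<lambda>x. (u x - h n x)\<^sup>2)) \<longlonglongrightarrow> integral\<^sup>L (cell :: (real^'n) measure) (\<lambda>x. 0)"
  proof (rule integral_dominated_convergence[where w="\<lambda>x. (2 * M)\<^sup>2"])
    have [measurable]: "h n \<in> borel_measurable cell" for n
    proof -
      have "h n \<in> borel_measurable lebesgue"
        using borel_measurable_continuous_onI[OF h_cont] by (simp add: measurable_completion)
      then show ?thesis
        by (rule measurable_restrict_space1)
    qed
    show "(\<lambda>x. (u x - h n x)\<^sup>2) \<in> borel_measurable cell" for n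
      by measurable
    show "AE x in cell. (\<lambda>n. (u x - h n x)\<^sup>2) \<longlonglongrightarrow> 0"
    proof -
      have "AE x in lebesgue. x \<notin> N"
        using N by (simp add: negligible_iff_null_sets AE_not_in)
      then have "AE x in cell. x \<notin> N"
        by (rule AE_cell_if_AE_lebesgue)
      then show ?thesis
        using AE_space
      proof eventually_elim
        case (elim x)
        then have x: "x \<in> unit_cell"
          by simp
        have "(\<lambda>n. clip M (g n x)) \<longlonglongrightarrow> clip M (u x)"
          unfolding clip_def using lim[OF elim(1) x] by (intro tendsto_intros)
        moreover have "clip M (u x) = u x"
          using bound[of x] by (auto simp: clip_def)
        moreover have "(\<lambda>n. min 1 (real n * c x)) \<longlonglongrightarrow> 1"
        proof (rule tendsto_eventually)
          obtain m :: nat where m: "1 \<le> real m * c x"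
            using reals_Archimedean3[OF c_pos[OF x], THEN spec[of _ 1]] by (auto intro: less_imp_le)
          have "min 1 (real n * c x) = 1" if "n \<ge> m" for n
          proof -
            have "real m * c x \<le> real n * c x"
              using that c_pos[OF x] by (intro mult_right_mono) auto
            then show ?thesis
              using m by linarith
          qed
          then show "\<forall>\<^sub>F n in sequentially. min 1 (real n * c x) = 1"
            by (rule eventually_sequentiallyI)
        qed
        ultimately have "(\<lambda>n. h n x) \<longlonglongrightarrow> 1 * u x"
          unfolding h_def by (intro tendsto_mult) auto
        then have "(\<lambda>n. (u x - h n x)\<^sup>2) \<longlonglongrightarrow> (u x - 1 * u x)\<^sup>2"
          by (intro tendsto_intros)
        then show ?case
          by simp
      qed
    qed
    show "AE x in cell. norm ((u x - h n x)\<^sup>2) \<le> (2 * M)\<^sup>2" for n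
      using AE_space
    proof eventually_elim
      case (elim x)
      then have "x \<in> cbox 0 1"
        using cell_sub by simp
      then have "\<bar>u x - h n x\<bar> \<le> \<bar>2 * M\<bar>"
        using h_bound[of x n] bound[of x] by linarith
      then show ?case
        by (simp add: abs_le_square_iff)
    qed
  qed auto
  then have "(\<lambda>n. cell_integral (\<lambda>x. (u x - h n x)\<^sup>2)) \<longlonglongrightarrow> 0"
    by (simp add: cell_integral_def)
  then have "\<forall>\<^sub>F n in sequentially. cell_integral (\<lambda>x. (u x - h n x)\<^sup>2) < e"
    using e by (rule order_tendstoD)
  then obtain n where "cell_integral (\<lambda>x. (u x - h n x)\<^sup>2) < e"
    by (auto simp: eventually_sequentially)
  moreover have "continuous_on (cbox 0 1) (h n)"
    using h_cont continuous_on_subset by blast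
  moreover have "h n x = 0" if "x \<in> cbox 0 1" "x \<notin> unit_cell" for x
    using c_zero[OF that] by (simp add: h_def)
  ultimately show ?thesis
    using h_bound by blast
qed

text \<open>
  Three approximations are combined: by a bounded function, by a continuous function on the cube
  that vanishes on the boundary, and uniformly by a trigonometric polynomial.
\<close>

theorem trig_poly_dense:
  fixes u :: "real^'n \<Rightarrow> real"
  assumes u: "u \<in> L2_per" and e: "0 < e"
  shows "\<exists>p\<in>trig_poly int_vecs. L2_norm (\<lambda>x. u x - p x) < e"
proof -
  \<comment> \<open>The square of a sum of three errors is at most \<open>3 (d + d + d) = 9 d < e\<^sup>2\<close>.\<close>
  define d where "d = e\<^sup>2 / 10"
  have d: "0 < d" using e by (simp add: d_def)
  have [measurable]: "u \<in> borel_measurable cell"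
    using u by (rule L2_per_measurable_cell)
  have "\<forall>\<^sub>F m in sequentially. cell_integral (\<lambda>x. (u x - clip (real m) (u x))\<^sup>2) < d"
    using clip_approx[OF u] d by (rule order_tendstoD)
  then obtain m where m: "cell_integral (\<lambda>x. (u x - clip (real m) (u x))\<^sup>2) < d"
    by (auto simp: eventually_sequentially)
  define w where "w x = clip (real m) (u x)" for x
  have w_meas [measurable]: "w \<in> borel_measurable cell"
    unfolding w_def by measurable
  have w_bound: "\<bar>w x\<bar> \<le> real m" for x
    by (simp add: w_def abs_clip_le)
  obtain h where h: "continuous_on (cbox 0 1) h" "\<And>x. x \<in> cbox 0 1 \<Longrightarrow> x \<notin> unit_cell \<Longrightarrow> h x = 0"
    "\<And>x. x \<in> cbox 0 1 \<Longrightarrow> \<bar>h x\<bar> \<le> real m" "cell_integral (\<lambda>x. (w x - h x)\<^sup>2) < d"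
    using continuous_approx_bounded[OF w_meas w_bound d] by blast
  have "0 < sqrt d"
    using d by simp
  from trig_poly_uniform_approx[OF h(1,2) this]
  obtain p where p: "p \<in> trig_poly int_vecs" "\<And>x. x \<in> unit_cell \<Longrightarrow> \<bar>h x - p x\<bar> < sqrt d"
    by blast
  have pL: "p \<in> L2_per"
    using trig_poly_smooth_per[OF p(1)] smooth_per_L2_per by blast
  have cell_sub: "unit_cell \<subseteq> (cbox 0 1 :: (real^'n) set)"
    unfolding unit_cell_def by (rule box_subset_cbox)
  have h_meas [measurable]: "h \<in> borel_measurable cell"
    using h(1) cell_sub
    by (intro continuous_imp_measurable_on_sets_lebesgue) (auto intro: continuous_on_subset)
  have uw: "integrable cell (\<lambda>x. (u x - w x)\<^sup>2)"
  proof (rule Bochner_Integration.integrable_bound[OF L2_per_square_integrable[OF u]])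
    show "AE x in cell. norm ((u x - w x)\<^sup>2) \<le> norm ((u x)\<^sup>2)"
    proof (rule AE_I2)
      fix x
      have "\<bar>u x - clip (real m) (u x)\<bar> \<le> \<bar>u x\<bar>"
        by (auto simp: clip_def)
      then show "norm ((u x - w x)\<^sup>2) \<le> norm ((u x)\<^sup>2)"
        by (simp add: abs_le_square_iff w_def)
    qed
  qed measurable
  have wh: "integrable cell (\<lambda>x. (w x - h x)\<^sup>2)"
  proof (rule Bochner_Integration.integrable_bound[OF integrable_cell_const[of "(2 * real m)\<^sup>2"]])
    show "AE x in cell. norm ((w x - h x)\<^sup>2) \<le> norm ((2 * real m)\<^sup>2)"
      using AE_space
    proof eventually_elim
      case (elim x)
      then have "\<bar>w x - h x\<bar> \<le> \<bar>2 * real m\<bar>"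
        using h(3)[of x] w_bound[of x] cell_sub by fastforce
      then have "(w x - h x)\<^sup>2 \<le> (2 * real m)\<^sup>2"
        by (simp only: abs_le_square_iff)
      then show ?case
        by simp
    qed
  qed measurable
  have le: "(u x - p x)\<^sup>2 \<le> 3 * ((u x - w x)\<^sup>2 + (w x - h x)\<^sup>2 + d)" if "x \<in> unit_cell" for x
  proof -
    have "\<bar>h x - p x\<bar> \<le> sqrt d"
      using p(2)[OF that] by simp
    then have hp: "(h x - p x)\<^sup>2 \<le> d"
      using d by (metis abs_ge_zero power2_abs power_mono real_sqrt_pow2 less_imp_le)
    have "(a + b + c)\<^sup>2 \<le> 3 * (a\<^sup>2 + b\<^sup>2 + c\<^sup>2)" for a b c :: real
      using sum_squares_bound[of a b] sum_squares_bound[of b c] sum_squares_bound[of a c]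
      by (simp add: power2_eq_square algebra_simps)
    from this[of "u x - w x" "w x - h x" "h x - p x"] hp show ?thesis
      by simp
  qed
  have "(L2_norm (\<lambda>x. u x - p x))\<^sup>2 = integral\<^sup>L cell (\<lambda>x. (u x - p x)\<^sup>2)"
    by (simp only: L2_norm_square L2_inner_def cell_integral_def flip: power2_eq_square)
  also have "\<dots> \<le> integral\<^sup>L cell (\<lambda>x. 3 * ((u x - w x)\<^sup>2 + (w x - h x)\<^sup>2 + d))"
  proof (rule integral_mono)
    show "integrable cell (\<lambda>x. (u x - p x)\<^sup>2)"
      using u pL by (intro L2_per_square_integrable L2_per_diff)
  qed (use uw wh le in auto)
  also have "\<dots> = 3 * (cell_integral (\<lambda>x. (u x - w x)\<^sup>2) + cell_integral (\<lambda>x. (w x - h x)\<^sup>2) + d)"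
    using uw wh measure_cell_space[where 'n='n] by (simp add: cell_integral_def)
  also have "\<dots> < 3 * (d + d + d)"
    using m h(4) by (simp add: w_def)
  also have "\<dots> < e\<^sup>2"
    using e by (simp add: d_def)
  finally have "(L2_norm (\<lambda>x. u x - p x))\<^sup>2 < e\<^sup>2" .
  then have "L2_norm (\<lambda>x. u x - p x) < e"
    using e by (simp add: power_less_imp_less_base)
  then show ?thesis
    using p(1) by blast
qed

lemma trig_poly_sequence:
  fixes u :: "real^'n \<Rightarrow> real"
  assumes u: "u \<in> L2_per"
  shows "\<exists>p. (\<forall>m. p m \<in> trig_poly int_vecs) \<and> L2_lim p u"
proof -
  have "\<forall>m. \<exists>p. p \<in> trig_poly int_vecs \<and> L2_norm (\<lambda>x. u x - p x) < 1 / real (Suc m)"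
    using trig_poly_dense[OF u] by (meson of_nat_0_less_iff zero_less_Suc zero_less_divide_1_iff)
  then obtain p where p: "\<And>m. p m \<in> trig_poly int_vecs" "\<And>m. L2_norm (\<lambda>x. u x - p m x) < 1 / real (Suc m)"
    by metis
  have "(\<lambda>m. L2_norm (\<lambda>x. p m x - u x)) \<longlonglongrightarrow> 0"
  proof (rule tendsto_sandwich[where f="\<lambda>_. 0"])
    show "(\<lambda>m. 1 / real (Suc m)) \<longlonglongrightarrow> 0"
      using LIMSEQ_inverse_real_of_nat by (simp add: inverse_eq_divide)
    show "\<forall>\<^sub>F m in sequentially. L2_norm (\<lambda>x. p m x - u x) \<le> 1 / real (Suc m)"
      using p(2) by (intro always_eventually allI) (simp only: L2_norm_diff_commute[of _ u] less_imp_le)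
  qed auto
  moreover have "p m \<in> L2_per" for m
    using trig_poly_smooth_per[OF p(1)] smooth_per_L2_per by blast
  ultimately show ?thesis
    using u p(1) by (auto simp: L2_lim_def)
qed

text \<open>
  The fundamental lemma of the calculus of variations: by density the function is a limit of
  functions that are orthogonal to it. This is what makes weak derivatives unique.
\<close>

lemma L2_orthogonal_trig_poly_zero:
  fixes u :: "real^'n \<Rightarrow> real"
  assumes u: "u \<in> L2_per" and orth: "\<And>p. p \<in> trig_poly int_vecs \<Longrightarrow> L2_inner u p = 0"
  shows "AE x in cell. u x = 0"
proof -
  obtain p where p: "\<And>m. p m \<in> trig_poly int_vecs" "L2_lim p u"
    using trig_poly_sequence[OF u] by blast
  have "(\<lambda>m. L2_inner (p m) u) \<longlonglongrightarrow> L2_inner u u"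
    using p(2) u by (rule L2_lim_inner)
  moreover have "L2_inner (p m) u = 0" for m
    using orth[OF p(1)] L2_inner_commute[of u "p m"] by simp
  ultimately have "L2_inner u u = 0"
    by (simp add: LIMSEQ_const_iff)
  then have "L2_norm u = 0"
    by (simp add: L2_norm_def)
  then show ?thesis
    using u by (intro L2_norm_zero_AE)
qed

section \<open>The periodic Laplace equation\<close>

lemma weak_partial_L2_per:
  assumes "weak_partial i u g"
  shows "u \<in> L2_per" "g \<in> L2_per"
  using assms by (auto simp: weak_partial_def)

lemma weak_partial_test:
  "weak_partial i u g \<Longrightarrow> \<phi> \<in> smooth_per \<Longrightarrow> L2_inner u (partial i \<phi>) = - L2_inner g \<phi>"
  by (auto simp: weak_partial_def)

lemma weak_partial_cong_AE:
  assumes "weak_partial i u g" "u' \<in> L2_per" "g' \<in> L2_per"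
    and "AE x in cell. u x = u' x" "AE x in cell. g x = g' x"
  shows "weak_partial i u' g'"
proof -
  have "L2_inner u' (partial i \<phi>) = - L2_inner g' \<phi>" if \<phi>: "\<phi> \<in> smooth_per" for \<phi>
  proof -
    have "L2_inner u' (partial i \<phi>) = L2_inner u (partial i \<phi>)"
      using assms weak_partial_L2_per[OF assms(1)] smooth_per_L2_per[OF partial_smooth_per[OF \<phi>]]
      by (intro L2_inner_cong_AE[symmetric]) auto
    moreover have "L2_inner g \<phi> = L2_inner g' \<phi>"
      using assms weak_partial_L2_per[OF assms(1)] smooth_per_L2_per[OF \<phi>]
      by (intro L2_inner_cong_AE) auto
    ultimately show ?thesis
      using weak_partial_test[OF assms(1) \<phi>] by simp
  qed
  then show ?thesis
    using assms by (simp add: weak_partial_def)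
qed

lemma weak_partial_unique:
  assumes g: "weak_partial i u g" and g': "weak_partial i u g'"
  shows "AE x in cell. g x = g' x"
proof -
  have mem: "g \<in> L2_per" "g' \<in> L2_per"
    using assms weak_partial_L2_per by blast+
  have "AE x in cell. g x - g' x = 0"
  proof (rule L2_orthogonal_trig_poly_zero)
    show "(\<lambda>x. g x - g' x) \<in> L2_per"
      using mem by (rule L2_per_diff)
    fix p :: "real^'a \<Rightarrow> real" assume "p \<in> trig_poly int_vecs"
    then have p: "p \<in> smooth_per"
      by (rule trig_poly_smooth_per) simp
    show "L2_inner (\<lambda>x. g x - g' x) p = 0"
      using weak_partial_test[OF g p] weak_partial_test[OF g' p] mem smooth_per_L2_per[OF p]
      by (simp add: L2_inner_diff_left)
  qed
  then show ?thesis
    by simp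
qed

lemma weak_partial_diff:
  assumes g: "weak_partial i u g" and h: "weak_partial i w h"
  shows "weak_partial i (\<lambda>x. u x - w x) (\<lambda>x. g x - h x)"
proof -
  have "L2_inner (\<lambda>x. u x - w x) (partial i \<phi>) = - L2_inner (\<lambda>x. g x - h x) \<phi>" if \<phi>: "\<phi> \<in> smooth_per" for \<phi>
    using weak_partial_test[OF g \<phi>] weak_partial_test[OF h \<phi>] weak_partial_L2_per[OF g]
      weak_partial_L2_per[OF h] smooth_per_L2_per[OF \<phi>] smooth_per_L2_per[OF partial_smooth_per[OF \<phi>]]
    by (simp add: L2_inner_diff_left)
  then show ?thesis
    using weak_partial_L2_per[OF g] weak_partial_L2_per[OF h] by (simp add: weak_partial_def L2_per_diff)
qed

lemma weak_partial_const:
  fixes c :: real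
  shows "weak_partial i (\<lambda>x. c) (\<lambda>x. 0)"
proof -
  have "(\<lambda>x::real^'a. c) \<in> smooth_per"
    by (rule trig_poly_smooth_per[OF trig_poly_const]) simp
  moreover have "partial i (\<lambda>x::real^'a. c) = (\<lambda>x. 0)"
    by (simp add: partial_def fun_eq_iff)
  ultimately show ?thesis
    using weak_partial_smooth by metis
qed

lemma weak_partial_mean_0:
  assumes "weak_partial i u g"
  shows "cell_integral g = 0"
proof -
  have "L2_inner u (partial i (\<lambda>x. 1)) = - L2_inner g (\<lambda>x. 1)"
    by (rule weak_partial_test[OF assms]) (rule trig_poly_smooth_per[OF trig_poly_const], simp)
  moreover have "partial i (\<lambda>x::real^'a. 1) = (\<lambda>x. 0)"
    by (simp add: partial_def fun_eq_iff)
  ultimately show ?thesis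
    by (simp add: L2_inner_one) (simp add: L2_inner_def)
qed

text \<open>
  The set of pairs of a function and its weak derivative is closed, since only inner products with
  fixed test functions enter.
\<close>

lemma weak_partial_lim:
  assumes "L2_lim F u" "L2_lim G g" "\<And>m. weak_partial i (F m) (G m)"
  shows "weak_partial i u g"
proof -
  have "L2_inner u (partial i \<phi>) = - L2_inner g \<phi>" if \<phi>: "\<phi> \<in> smooth_per" for \<phi>
  proof (rule LIMSEQ_unique)
    show "(\<lambda>m. L2_inner (F m) (partial i \<phi>)) \<longlonglongrightarrow> L2_inner u (partial i \<phi>)"
      using smooth_per_L2_per[OF partial_smooth_per[OF \<phi>]] by (rule L2_lim_inner[OF assms(1)])
    have "(\<lambda>m. - L2_inner (G m) \<phi>) \<longlonglongrightarrow> - L2_inner g \<phi>"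
      using L2_lim_inner[OF assms(2) smooth_per_L2_per[OF \<phi>]] by (rule tendsto_minus)
    then show "(\<lambda>m. L2_inner (F m) (partial i \<phi>)) \<longlonglongrightarrow> - L2_inner g \<phi>"
      using weak_partial_test[OF assms(3) \<phi>] by simp
  qed
  then show ?thesis
    using assms by (simp add: weak_partial_def L2_lim_def)
qed

lemma wpartial_weak_partial:
  assumes "weak_partial i u g"
  shows "weak_partial i u (wpartial i u)"
  unfolding wpartial_def using someI[of "weak_partial i u", OF assms] by simp

text \<open>
  The chosen representative \<open>wpartial i v\<close> is an arbitrary weak derivative. It agrees almost
  everywhere with the one that is known to be differentiable once more, and weak differentiability
  depends only on the class modulo null sets; so second derivatives may be computed with the
  chosen representatives.
\<close>

lemma H_per_2D:
  assumes "v \<in> H_per 2"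
  shows "v \<in> L2_per" "weak_partial i v (wpartial i v)"
    "weak_partial j (wpartial i v) (wpartial j (wpartial i v))"
proof -
  have v: "v \<in> H_per (Suc (Suc 0))"
    using assms by (simp add: numeral_2_eq_2)
  then show "v \<in> L2_per"
    by simp
  obtain g where g: "weak_partial i v g" "g \<in> H_per (Suc 0)"
    using v unfolding H_per.simps(2)[of "Suc 0"] by blast
  then obtain h where h: "weak_partial j g h"
    by auto
  show w: "weak_partial i v (wpartial i v)"
    using g(1) by (rule wpartial_weak_partial)
  have "weak_partial j (wpartial i v) h"
    using h weak_partial_L2_per[OF w] weak_partial_L2_per[OF h] weak_partial_unique[OF g(1) w]
    by (intro weak_partial_cong_AE[OF h]) auto
  then show "weak_partial j (wpartial i v) (wpartial j (wpartial i v))"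
    by (rule wpartial_weak_partial)
qed

lemma
  assumes G: "\<And>i. weak_partial i v (G i)" and H: "\<And>i j. weak_partial j (G i) (H j i)"
  shows H_per_2I: "v \<in> H_per 2"
    and wpartial_wpartial_AE: "AE x in cell. wpartial j (wpartial i v) x = H j i x"
proof -
  have "G i \<in> H_per (Suc 0)" for i
    using H weak_partial_L2_per by (fastforce simp: H_per.simps)
  then have "v \<in> H_per (Suc (Suc 0))"
    unfolding H_per.simps(2)[of "Suc 0"] using G weak_partial_L2_per by blast
  then show v: "v \<in> H_per 2"
    by (simp add: numeral_2_eq_2)
  have "AE x in cell. G i x = wpartial i v x"
    using G H_per_2D(2)[OF v] by (rule weak_partial_unique)
  then have "weak_partial j (wpartial i v) (H j i)"
    using H weak_partial_L2_per H_per_2D(2)[OF v] by (intro weak_partial_cong_AE[OF H]) blast+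
  with H_per_2D(3)[OF v] show "AE x in cell. wpartial j (wpartial i v) x = H j i x"
    by (rule weak_partial_unique)
qed

definition hess_entry :: "(real^'n \<Rightarrow> real) \<Rightarrow> 'n \<Rightarrow> 'n \<Rightarrow> real^'n \<Rightarrow> real" where
  "hess_entry v i j = wpartial i (wpartial j v)"

lemma hess_entry_L2_per: "v \<in> H_per 2 \<Longrightarrow> hess_entry v i j \<in> L2_per"
  unfolding hess_entry_def using H_per_2D(3) weak_partial_L2_per by blast

lemma hessian_nth: "hessian v x $ i $ j = hess_entry v i j x"
  by (simp add: hessian_def hess_entry_def)

lemma laplacian_eq: "laplacian v x = (\<Sum>i\<in>UNIV. hess_entry v i i x)"
  by (simp add: laplacian_def hess_entry_def)

lemma laplacian_L2_per: "v \<in> H_per 2 \<Longrightarrow> laplacian v \<in> L2_per"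
  unfolding laplacian_eq[abs_def] by (intro L2_per_sum hess_entry_L2_per)

lemma laplacian_mean_0:
  assumes "v \<in> H_per 2"
  shows "cell_integral (laplacian v) = 0"
proof -
  have "L2_inner (laplacian v) (\<lambda>x. 1) = (\<Sum>i\<in>UNIV. L2_inner (hess_entry v i i) (\<lambda>x. 1))"
    unfolding laplacian_eq[abs_def] using assms by (intro L2_inner_sum_left hess_entry_L2_per) auto
  also have "\<dots> = 0"
    using weak_partial_mean_0[OF H_per_2D(3)[OF assms]] by (simp add: L2_inner_one hess_entry_def)
  finally show ?thesis
    by (simp add: L2_inner_one)
qed

lemma
  assumes v: "v \<in> H_per 2" and w: "w \<in> H_per 2"
  shows H_per_2_diff: "(\<lambda>x. v x - w x) \<in> H_per 2"
    and hess_entry_diff: "AE x in cell. hess_entry (\<lambda>x. v x - w x) i j x = hess_entry v i j x - hess_entry w i j x"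
proof -
  have G: "weak_partial i (\<lambda>x. v x - w x) (\<lambda>x. wpartial i v x - wpartial i w x)" for i
    using v w by (intro weak_partial_diff H_per_2D)
  have H: "weak_partial j (\<lambda>x. wpartial i v x - wpartial i w x)
      (\<lambda>x. wpartial j (wpartial i v) x - wpartial j (wpartial i w) x)" for i j
    using v w by (intro weak_partial_diff H_per_2D)
  show "(\<lambda>x. v x - w x) \<in> H_per 2"
    by (rule H_per_2I[OF G H])
  show "AE x in cell. hess_entry (\<lambda>x. v x - w x) i j x = hess_entry v i j x - hess_entry w i j x"
    unfolding hess_entry_def by (rule wpartial_wpartial_AE[OF G H])
qed

lemma
  shows H_per_2_const: "(\<lambda>x. c) \<in> H_per 2"
    and hess_entry_const: "AE x in cell. hess_entry (\<lambda>x. c) i j x = 0"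
  using H_per_2I[OF weak_partial_const weak_partial_const]
    wpartial_wpartial_AE[OF weak_partial_const weak_partial_const]
  by (auto simp: hess_entry_def)

lemma hessian_diff_AE:
  fixes v w :: "real^'n \<Rightarrow> real"
  assumes "v \<in> H_per 2" "w \<in> H_per 2"
  shows "AE x in cell. hessian (\<lambda>x. v x - w x) x = hessian v x - hessian w x"
proof -
  have "AE x in cell. \<forall>i\<in>UNIV. \<forall>j\<in>UNIV.
      hess_entry (\<lambda>x. v x - w x) i j x = hess_entry v i j x - hess_entry w i j x"
    using hess_entry_diff[OF assms] by (intro AE_finite_allI) auto
  then show ?thesis
    by eventually_elim (simp add: vec_eq_iff hessian_nth)
qed

lemma laplacian_diff_AE:
  fixes v w :: "real^'n \<Rightarrow> real"
  assumes "v \<in> H_per 2" "w \<in> H_per 2"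
  shows "AE x in cell. laplacian (\<lambda>x. v x - w x) x = laplacian v x - laplacian w x"
  using hessian_diff_AE[OF assms]
proof eventually_elim
  case (elim x)
  have tr: "laplacian u x = trace (hessian u x)" for u
    by (simp add: laplacian_eq trace_def hessian_nth)
  show ?case
    unfolding tr elim by (simp add: trace_def sum_subtractf)
qed

text \<open>
  Liouville's theorem on the torus: a weakly harmonic function is orthogonal to the Laplacian of
  every trigonometric polynomial, hence to every trigonometric polynomial of mean zero.
\<close>

lemma weakly_harmonic_const:
  fixes w :: "real^'n \<Rightarrow> real"
  assumes w: "w \<in> H_per 2" and harm: "AE x in cell. laplacian w x = 0"
  shows "AE x in cell. w x = cell_integral w"
proof -
  have wL: "w \<in> L2_per"
    using w by (rule H_per_2D)
  have lap0: "L2_inner w (classical_laplacian q) = 0" if q: "q \<in> smooth_per" for q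
  proof -
    have "L2_inner w (partial i (partial i q)) = L2_inner (hess_entry w i i) q" for i
      using weak_partial_test[OF H_per_2D(2)[OF w] partial_smooth_per[OF q], of i i]
        weak_partial_test[OF H_per_2D(3)[OF w] q, of i i] by (simp add: hess_entry_def)
    moreover have "L2_inner w (classical_laplacian q) = (\<Sum>i\<in>UNIV. L2_inner w (partial i (partial i q)))"
      unfolding classical_laplacian_def[abs_def] L2_inner_commute[of w]
      using wL by (intro L2_inner_sum_left) (auto intro: smooth_per_L2_per partial_smooth_per q)
    moreover have "L2_inner (laplacian w) q = (\<Sum>i\<in>UNIV. L2_inner (hess_entry w i i) q)"
      unfolding laplacian_eq[abs_def] using w q
      by (intro L2_inner_sum_left hess_entry_L2_per smooth_per_L2_per)
    moreover have "L2_inner (laplacian w) q = L2_inner (\<lambda>x. 0) q"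
      using harm laplacian_L2_per[OF w] smooth_per_L2_per[OF q] by (intro L2_inner_cong_AE) auto
    ultimately show ?thesis
      by (simp add: L2_inner_def)
  qed
  have "AE x in cell. w x - cell_integral w = 0"
  proof (rule L2_orthogonal_trig_poly_zero)
    show "(\<lambda>x. w x - cell_integral w) \<in> L2_per"
      using wL by (simp add: L2_per_diff)
    fix p :: "real^'n \<Rightarrow> real" assume p: "p \<in> trig_poly int_vecs"
    obtain q where q: "q \<in> trig_poly (int_vecs - {0})" "\<And>x. classical_laplacian q x = p x - cell_integral p"
      using trig_poly_lap_surj[OF p] by blast
    have pL: "p \<in> L2_per"
      using trig_poly_smooth_per[OF p] smooth_per_L2_per by blast
    have "q \<in> smooth_per"
      using q(1) by (rule trig_poly_smooth_per) blast
    then have "L2_inner w (\<lambda>x. p x - cell_integral p) = 0"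
      using lap0 q(2) by (metis (no_types, lifting) ext)
    then have "L2_inner w p = cell_integral p * cell_integral w"
      using wL pL L2_inner_scale_right[OF L2_per_const wL, of "cell_integral p" 1]
      by (simp add: L2_inner_diff_right L2_inner_one)
    moreover have "L2_inner (\<lambda>x. cell_integral w) p = cell_integral w * cell_integral p"
      by (simp add: L2_inner_def cell_integral_def)
    ultimately show "L2_inner (\<lambda>x. w x - cell_integral w) p = 0"
      using wL pL by (simp add: L2_inner_diff_left)
  qed
  then show ?thesis
    by simp
qed

text \<open>
  An a priori bound of the differences of one sequence by those of a convergent one transfers
  convergence.
\<close>

lemma L2_lim_of_Cauchy_bound:
  fixes F P :: "nat \<Rightarrow> real^'n \<Rightarrow> real"
  assumes F: "\<And>m. F m \<in> L2_per" and P: "L2_lim P g"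
    and le: "\<And>m l. L2_norm (\<lambda>x. F m x - F l x) \<le> L2_norm (\<lambda>x. P m x - P l x)"
  shows "\<exists>u. L2_lim F u"
proof (rule L2_complete[OF F])
  fix e :: real assume e: "0 < e"
  have P': "\<And>m. P m \<in> L2_per" "g \<in> L2_per" "(\<lambda>m. L2_norm (\<lambda>x. P m x - g x)) \<longlonglongrightarrow> 0"
    using P by (auto simp: L2_lim_def)
  have "\<forall>\<^sub>F m in sequentially. L2_norm (\<lambda>x. P m x - g x) < e / 2"
    using P'(3) e by (intro order_tendstoD(2)[where y=0]) auto
  then obtain N where N: "\<And>m. m \<ge> N \<Longrightarrow> L2_norm (\<lambda>x. P m x - g x) < e / 2"
    by (auto simp: eventually_sequentially)
  have "L2_norm (\<lambda>x. F i x - F j x) < e" if "i \<ge> N" "j \<ge> N" for i j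
  proof -
    have "L2_norm (\<lambda>x. F i x - F j x) \<le> L2_norm (\<lambda>x. P i x - g x) + L2_norm (\<lambda>x. g x - P j x)"
      using le[of i j] L2_norm_triangle_diff[OF P'(1) P'(2) P'(1), of i j] by simp
    also have "\<dots> < e"
      using N[OF that(1)] N[OF that(2)] by (simp add: L2_norm_diff_commute[of g])
    finally show ?thesis .
  qed
  then show "\<exists>N. \<forall>i\<ge>N. \<forall>j\<ge>N. L2_norm (\<lambda>x. F i x - F j x) < e"
    by blast
qed

text \<open>
  The right-hand side is approximated by trigonometric polynomials, for which the equation is
  solved explicitly; the a priori bounds make the solutions and their derivatives up to order two
  Cauchy sequences.
\<close>

theorem Laplace_solvable:
  fixes g :: "real^'n \<Rightarrow> real"
  assumes g: "g \<in> L2_per" and mean: "cell_integral g = 0"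
  shows "\<exists>v\<in>H_per 2. (AE x in cell. laplacian v x = g x) \<and>
    (\<Sum>i\<in>UNIV. \<Sum>j\<in>UNIV. (L2_norm (hess_entry v i j))\<^sup>2) = (L2_norm g)\<^sup>2"
proof -
  obtain p where p: "\<And>m. p m \<in> trig_poly int_vecs" "L2_lim p g"
    using trig_poly_sequence[OF g] by blast
  have pL: "p m \<in> L2_per" for m
    using p(2) by (simp add: L2_lim_def)
  have "\<forall>m. \<exists>q. q \<in> trig_poly (int_vecs - {0}) \<and> (\<forall>x. classical_laplacian q x = p m x - cell_integral (p m))"
    using trig_poly_lap_surj[OF p(1)] by blast
  then obtain q where q: "\<And>m. q m \<in> trig_poly (int_vecs - {0})"
    and lap_q: "\<And>m. classical_laplacian (q m) = (\<lambda>x. p m x - cell_integral (p m))"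
    by (metis (no_types, lifting) ext)
  have qs: "q m \<in> smooth_per" for m
    using q by (rule trig_poly_smooth_per) blast
  have lap_lim: "L2_lim (\<lambda>m. classical_laplacian (q m)) g"
  proof -
    have "(\<lambda>m. L2_norm (\<lambda>x. classical_laplacian (q m) x - g x)) \<longlonglongrightarrow> 0"
    proof (rule tendsto_sandwich[where f="\<lambda>_. 0"])
      show "(\<lambda>m. L2_norm (\<lambda>x. p m x - g x)) \<longlonglongrightarrow> 0"
        using p(2) by (simp add: L2_lim_def)
      have "L2_norm (\<lambda>x. classical_laplacian (q m) x - g x) \<le> L2_norm (\<lambda>x. p m x - g x)" for m
      proof -
        have "(\<lambda>x. classical_laplacian (q m) x - g x) = (\<lambda>x. (p m x - g x) - cell_integral (\<lambda>x. p m x - g x))"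
          using mean pL g by (simp add: lap_q cell_integral_diff algebra_simps)
        then show ?thesis
          using L2_norm_minus_mean_le[OF L2_per_diff[OF pL g]] by simp
      qed
      then show "\<forall>\<^sub>F m in sequentially. L2_norm (\<lambda>x. classical_laplacian (q m) x - g x) \<le> L2_norm (\<lambda>x. p m x - g x)"
        by simp
    qed auto
    then show ?thesis
      using pL g by (simp add: L2_lim_def lap_q L2_per_diff)
  qed
  have lap_d: "classical_laplacian (\<lambda>x. q m x - q l x) = (\<lambda>x. classical_laplacian (q m) x - classical_laplacian (q l) x)" for m l
    using lap_diff[OF qs qs] by blast
  have partial_d: "partial i (\<lambda>x. q m x - q l x) = (\<lambda>x. partial i (q m) x - partial i (q l) x)" for i m l
    by (rule partial_diff[OF qs qs])
  have partial_d2: "partial j (\<lambda>x. partial i (q m) x - partial i (q l) x)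
      = (\<lambda>x. partial j (partial i (q m)) x - partial j (partial i (q l)) x)" for i j m l
    by (intro partial_diff partial_smooth_per qs)
  have q_diff: "(\<lambda>x. q m x - q l x) \<in> trig_poly (int_vecs - {0})" for m l
    by (rule trig_poly_diff[OF q q])
  have "\<exists>v. L2_lim q v"
    using trig_poly_Poincare[OF q_diff] smooth_per_L2_per[OF qs]
    by (intro L2_lim_of_Cauchy_bound[OF _ lap_lim]) (simp_all add: lap_d)
  then obtain v where v: "L2_lim q v" by blast
  have "\<exists>G. L2_lim (\<lambda>m. partial i (q m)) G" for i
    using trig_poly_gradient_norm[OF q_diff] smooth_per_L2_per[OF partial_smooth_per[OF qs]]
    by (intro L2_lim_of_Cauchy_bound[OF _ lap_lim]) (simp_all add: lap_d partial_d)
  then obtain G where G: "\<And>i. L2_lim (\<lambda>m. partial i (q m)) (G i)" by metis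
  have "\<exists>H. L2_lim (\<lambda>m. partial j (partial i (q m))) H" for i j
  proof (rule L2_lim_of_Cauchy_bound[OF _ lap_lim])
    show "partial j (partial i (q m)) \<in> L2_per" for m
      by (intro smooth_per_L2_per partial_smooth_per qs)
    show "L2_norm (\<lambda>x. partial j (partial i (q m)) x - partial j (partial i (q l)) x)
        \<le> L2_norm (\<lambda>x. classical_laplacian (q m) x - classical_laplacian (q l) x)" for m l
    proof (rule power2_le_imp_le)
      let ?d = "\<lambda>x. q m x - q l x"
      have "(L2_norm (partial j (partial i ?d)))\<^sup>2 \<le> (\<Sum>i\<in>UNIV. (L2_norm (partial j (partial i ?d)))\<^sup>2)"
        by (rule member_le_sum) auto
      also have "\<dots> \<le> (\<Sum>j\<in>UNIV. \<Sum>i\<in>UNIV. (L2_norm (partial j (partial i ?d)))\<^sup>2)"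
        by (rule member_le_sum) (auto intro: sum_nonneg)
      also have "\<dots> = (L2_norm (classical_laplacian ?d))\<^sup>2"
        by (rule trig_poly_hessian_norm[OF q_diff])
      finally show "(L2_norm (\<lambda>x. partial j (partial i (q m)) x - partial j (partial i (q l)) x))\<^sup>2
          \<le> (L2_norm (\<lambda>x. classical_laplacian (q m) x - classical_laplacian (q l) x))\<^sup>2"
        by (simp add: lap_d partial_d partial_d2)
    qed simp
  qed
  then obtain H where H: "\<And>j i. L2_lim (\<lambda>m. partial j (partial i (q m))) (H j i)" by metis
  have wG: "weak_partial i v (G i)" for i
    using v G weak_partial_smooth[OF qs] by (rule weak_partial_lim)
  have wH: "weak_partial j (G i) (H j i)" for i j
    using G H weak_partial_smooth[OF partial_smooth_per[OF qs]] by (rule weak_partial_lim)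
  have v2: "v \<in> H_per 2"
    using wG wH by (rule H_per_2I)
  have entry: "AE x in cell. hess_entry v j i x = H j i x" for i j
    unfolding hess_entry_def using wG wH by (rule wpartial_wpartial_AE)
  have "L2_lim (\<lambda>m x. \<Sum>i\<in>UNIV. partial i (partial i (q m)) x) (\<lambda>x. \<Sum>i\<in>UNIV. H i i x)"
    using H by (intro L2_lim_sum)
  then have "AE x in cell. (\<Sum>i\<in>UNIV. H i i x) = g x"
    using lap_lim unfolding classical_laplacian_def[abs_def] by (rule L2_lim_unique)
  moreover have "AE x in cell. \<forall>i\<in>UNIV. hess_entry v i i x = H i i x"
    using entry by (intro AE_finite_allI) auto
  ultimately have "AE x in cell. laplacian v x = g x"
    by eventually_elim (simp add: laplacian_eq)
  moreover have "(\<Sum>i\<in>UNIV. \<Sum>j\<in>UNIV. (L2_norm (hess_entry v i j))\<^sup>2) = (L2_norm g)\<^sup>2"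
  proof -
    have "L2_norm (hess_entry v i j) = L2_norm (H i j)" for i j
      using entry v2 H by (intro L2_norm_cong_AE hess_entry_L2_per) (auto simp: L2_lim_def)
    moreover have "(\<Sum>i\<in>UNIV. \<Sum>j\<in>UNIV. (L2_norm (H i j))\<^sup>2) = (L2_norm g)\<^sup>2"
    proof (rule LIMSEQ_unique)
      show "(\<lambda>m. \<Sum>i\<in>UNIV. \<Sum>j\<in>UNIV. (L2_norm (partial i (partial j (q m))))\<^sup>2)
          \<longlonglongrightarrow> (\<Sum>i\<in>UNIV. \<Sum>j\<in>UNIV. (L2_norm (H i j))\<^sup>2)"
        using H by (intro tendsto_intros L2_lim_norm)
      show "(\<lambda>m. \<Sum>i\<in>UNIV. \<Sum>j\<in>UNIV. (L2_norm (partial i (partial j (q m))))\<^sup>2) \<longlonglongrightarrow> (L2_norm g)\<^sup>2"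
        unfolding trig_poly_hessian_norm[OF q] using lap_lim by (intro tendsto_intros L2_lim_norm)
    qed
    ultimately show ?thesis
      by simp
  qed
  ultimately show ?thesis
    using v2 by blast
qed

text \<open>
  The Miranda--Talenti identity holds for the solution constructed above, and by Liouville's
  theorem every function in the Sobolev space of order two differs from such a solution by a
  constant.
\<close>

theorem Miranda_Talenti:
  fixes v :: "real^'n \<Rightarrow> real"
  assumes v: "v \<in> H_per 2"
  shows "(\<Sum>i\<in>UNIV. \<Sum>j\<in>UNIV. (L2_norm (hess_entry v i j))\<^sup>2) = (L2_norm (laplacian v))\<^sup>2"
proof -
  obtain w where w: "w \<in> H_per 2" "AE x in cell. laplacian w x = laplacian v x"
    and norm: "(\<Sum>i\<in>UNIV. \<Sum>j\<in>UNIV. (L2_norm (hess_entry w i j))\<^sup>2) = (L2_norm (laplacian v))\<^sup>2"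
    using Laplace_solvable[OF laplacian_L2_per[OF v] laplacian_mean_0[OF v]] by blast
  let ?z = "\<lambda>x. v x - w x"
  have z: "?z \<in> H_per 2"
    using v w(1) by (rule H_per_2_diff)
  have "AE x in cell. laplacian ?z x = 0"
    using laplacian_diff_AE[OF v w(1)] w(2) by eventually_elim simp
  then have const: "AE x in cell. ?z x = cell_integral ?z"
    by (rule weakly_harmonic_const[OF z])
  have zL: "?z \<in> L2_per"
    using z by (rule H_per_2D)
  have "weak_partial j ?z (\<lambda>x. 0)" for j
    using const zL by (intro weak_partial_cong_AE[OF weak_partial_const]) auto
  then have z0: "AE x in cell. hess_entry ?z i j x = 0" for i j
    unfolding hess_entry_def using weak_partial_const by (rule wpartial_wpartial_AE)
  have "AE x in cell. hess_entry v i j x = hess_entry w i j x" for i j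
    using z0[of i j] hess_entry_diff[OF v w(1), of i j] by eventually_elim simp
  then have "L2_norm (hess_entry v i j) = L2_norm (hess_entry w i j)" for i j
    using v w(1) by (intro L2_norm_cong_AE hess_entry_L2_per)
  then show ?thesis
    using norm by simp
qed

section \<open>Extension of almost everywhere properties by periodicity\<close>

lemma countable_int_vecs: "countable (int_vecs :: (real^'n) set)"
proof -
  have "(int_vecs :: (real^'n) set) \<subseteq> range (\<lambda>m::'n \<Rightarrow> int. \<chi> i. of_int (m i))"
  proof
    fix k :: "real^'n" assume "k \<in> int_vecs"
    then have "k = (\<chi> i. of_int \<lfloor>k $ i\<rfloor>)"
      by (auto simp: int_vecs_def vec_eq_iff Ints_def)
    then show "k \<in> range (\<lambda>m::'n \<Rightarrow> int. \<chi> i. of_int (m i))"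
      by (intro image_eqI[where x="\<lambda>i. \<lfloor>k $ i\<rfloor>"]) auto
  qed
  then show ?thesis
    by (rule countable_subset) simp
qed

lemma AE_lebesgue_iff_negligible: "(AE x in lebesgue. P x) \<longleftrightarrow> negligible {x. \<not> P x}"
proof
  assume "AE x in lebesgue. P x"
  then obtain N where "{x \<in> space lebesgue. \<not> P x} \<subseteq> N" "N \<in> null_sets lebesgue"
    unfolding eventually_ae_filter by blast
  then show "negligible {x. \<not> P x}"
    using negligible_subset[of N] by (simp add: negligible_iff_null_sets)
qed (auto simp: negligible_iff_null_sets intro: AE_I')

text \<open>
  The integer translates of the closed cube cover the space. The exceptional set is therefore
  contained in a countable union of translates of null sets: the exceptional points in the cube,
  its boundary, and for every lattice vector the points where periodicity fails.
\<close>

lemma ae_periodic_AE_cell: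
  fixes u :: "real^'n \<Rightarrow> 'b"
  assumes per: "ae_periodic u" and ae: "AE x in cell. P (u x)"
  shows "AE x in lebesgue. P (u x)"
proof -
  define N where "N = {x \<in> cbox 0 1. \<not> P (u x)}"
  define M where "M k = {x. u (x + k) \<noteq> u x}" for k
  have "AE x in lebesgue. x \<in> unit_cell \<longrightarrow> P (u x)"
    using ae by (subst (asm) AE_restrict_space_iff) auto
  then have "negligible {x. \<not> (x \<in> unit_cell \<longrightarrow> P (u x))}"
    by (simp only: AE_lebesgue_iff_negligible)
  moreover have "negligible (cbox 0 1 - (unit_cell :: (real^'n) set))"
    unfolding unit_cell_def by (rule negligible_frontier_interval)
  ultimately have "negligible ({x. \<not> (x \<in> unit_cell \<longrightarrow> P (u x))} \<union> (cbox 0 1 - unit_cell))"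
    by (rule negligible_Un)
  then have N: "negligible N"
    by (rule negligible_subset) (auto simp: N_def)
  have M: "negligible (M k)" if "k \<in> int_vecs" for k
    using per that unfolding ae_periodic_def M_def by (simp add: AE_lebesgue_iff_negligible)
  have "negligible (\<Union> ((\<lambda>k. (+) k ` (N \<union> M k)) ` int_vecs))"
  proof (rule negligible_countable_Union)
    show "countable ((\<lambda>k. (+) k ` (N \<union> M k)) ` int_vecs)"
      using countable_int_vecs by (rule countable_image)
    show "negligible S" if "S \<in> (\<lambda>k. (+) k ` (N \<union> M k)) ` int_vecs" for S
      using that N M by (auto intro!: negligible_translation negligible_Un)
  qed
  moreover have "{x. \<not> P (u x)} \<subseteq> \<Union> ((\<lambda>k. (+) k ` (N \<union> M k)) ` int_vecs)"
  proof
    fix x assume "x \<in> {x. \<not> P (u x)}"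
    then have x: "\<not> P (u x)" by simp
    define k :: "real^'n" where "k = (\<chi> i. of_int \<lfloor>x $ i\<rfloor>)"
    have k: "k \<in> int_vecs"
      by (simp add: k_def int_vecs_def)
    have "0 \<le> x $ i - of_int \<lfloor>x $ i\<rfloor> \<and> x $ i - of_int \<lfloor>x $ i\<rfloor> \<le> 1" for i
      by linarith
    then have "x - k \<in> cbox 0 1"
      by (simp add: mem_box_cart k_def)
    then have "x - k \<in> N \<union> M k"
      using x by (auto simp: N_def M_def)
    then have "k + (x - k) \<in> (+) k ` (N \<union> M k)"
      by (rule imageI)
    then show "x \<in> \<Union> ((\<lambda>k. (+) k ` (N \<union> M k)) ` int_vecs)"
      using k by auto
  qed
  ultimately have "negligible {x. \<not> P (u x)}"
    by (rule negligible_subset)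
  then show ?thesis
    by (simp only: AE_lebesgue_iff_negligible)
qed

section \<open>The Cordes condition\<close>

lemma trace_eq_inner_mat_1: "trace P = P \<bullet> (mat 1 :: real^'n^'n)"
  by (simp add: trace_def inner_vec_def mat_def if_distrib cong: if_cong)

lemma inner_mat_1_mat_1: "(mat 1 :: real^'n^'n) \<bullet> mat 1 = real CARD('n)"
  using trace_eq_inner_mat_1[of "mat 1 :: real^'n^'n"] by (simp add: trace_I)

text \<open>
  The Cauchy--Schwarz inequality between \<open>P\<close> and the identity matrix gives
  \<open>(trace P)\<^sup>2 \<le> n (norm P)\<^sup>2\<close>. The scaling factor is thus at most \<open>n / trace P\<close>, and
  \<open>n / trace P \<le> 1 / l \<le> L / l\<^sup>2\<close>.
\<close>

lemma
  fixes P :: "real^'n^'n"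
  assumes ell: "\<And>\<xi>. \<xi> \<noteq> 0 \<Longrightarrow> l * (norm \<xi>)\<^sup>2 \<le> (P *v \<xi>) \<bullet> \<xi> \<and> (P *v \<xi>) \<bullet> \<xi> \<le> L * (norm \<xi>)\<^sup>2"
    and l: "0 < l"
  shows elliptic_trace: "real CARD('n) * l \<le> trace P"
    and elliptic_norm: "0 < norm P"
    and elliptic_scaling_pos: "0 < trace P / (norm P)\<^sup>2"
    and elliptic_scaling_le: "trace P / (norm P)\<^sup>2 \<le> L / l\<^sup>2"
proof -
  let ?n = "real CARD('n)"
  have n: "0 < ?n" by simp
  have ax: "(P *v axis i 1) \<bullet> axis i 1 = P $ i $ i" for i
    by (simp add: inner_axis matrix_vector_mult_basis column_def)
  have diag: "l \<le> P $ i $ i" "P $ i $ i \<le> L" for i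
    using ell[of "axis i 1"] by (simp_all add: ax axis_eq_0_iff)
  have "(\<Sum>i\<in>(UNIV::'n set). l) \<le> trace P"
    unfolding trace_def using diag by (intro sum_mono) auto
  then show tr: "?n * l \<le> trace P"
    by simp
  then have tr_pos: "0 < trace P"
    using l n mult_pos_pos[OF n l] by linarith
  then show nP: "0 < norm P"
    by (auto simp: trace_def)
  then show "0 < trace P / (norm P)\<^sup>2"
    using tr_pos by simp
  have "(trace P)\<^sup>2 \<le> (norm P)\<^sup>2 * ?n"
    using Cauchy_Schwarz_ineq[of P "mat 1"]
    by (simp add: trace_eq_inner_mat_1 inner_mat_1_mat_1 power2_norm_eq_inner)
  then have "trace P / (norm P)\<^sup>2 \<le> ?n / trace P"
    using tr_pos nP by (simp add: field_simps power2_eq_square)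
  also have "\<dots> \<le> ?n / (?n * l)"
    using tr n l tr_pos by (intro divide_left_mono) auto
  also have "\<dots> = l / l\<^sup>2"
    using n l by (simp add: power2_eq_square)
  also have "\<dots> \<le> L / l\<^sup>2"
    using order_trans[OF diag(1) diag(2)] by (rule divide_right_mono) simp
  finally show "trace P / (norm P)\<^sup>2 \<le> L / l\<^sup>2" .
qed

text \<open>
  The scaling factor is the \<open>t\<close> that minimises the distance of \<open>t P\<close> from the identity matrix, and
  the minimum is \<open>n - (trace P)\<^sup>2 / (norm P)\<^sup>2\<close>.
\<close>

lemma Cordes_near_identity:
  fixes P H :: "real^'n^'n"
  assumes tr: "0 < trace P" and P: "0 < norm P" and \<delta>: "0 < \<delta>"
    and cordes: "(norm P)\<^sup>2 / (trace P)\<^sup>2 \<le> 1 / (real CARD('n) - 1 + \<delta>)"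
  shows "(trace H - trace P / (norm P)\<^sup>2 * (P \<bullet> H))\<^sup>2 \<le> (1 - \<delta>) * (norm H)\<^sup>2"
proof -
  define t where "t = trace P / (norm P)\<^sup>2"
  let ?n = "real CARD('n)" and ?D = "mat 1 - t *\<^sub>R P"
  have "1 \<le> ?n"
    by (simp add: Suc_le_eq)
  then have n: "0 < ?n - 1 + \<delta>"
    using \<delta> by linarith
  have "?n - 1 + \<delta> \<le> (trace P)\<^sup>2 / (norm P)\<^sup>2"
    using cordes n tr P by (simp add: field_simps)
  moreover have "(norm ?D)\<^sup>2 = ?n - (trace P)\<^sup>2 / (norm P)\<^sup>2"
  proof -
    have "(norm ?D)\<^sup>2 = ?n - 2 * t * trace P + t\<^sup>2 * (norm P)\<^sup>2"
      using trace_eq_inner_mat_1[of P] unfolding power2_norm_eq_inner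
      by (simp add: inner_diff_left inner_diff_right inner_mat_1_mat_1
          inner_commute[of "mat 1" P] power2_eq_square algebra_simps)
    then show ?thesis
      using P by (simp add: t_def power2_eq_square field_simps)
  qed
  ultimately have D: "(norm ?D)\<^sup>2 \<le> 1 - \<delta>"
    by simp
  have "trace H - t * (P \<bullet> H) = ?D \<bullet> H"
    by (simp add: inner_diff_left trace_eq_inner_mat_1 inner_commute[of H])
  then have "(trace H - t * (P \<bullet> H))\<^sup>2 \<le> (norm ?D)\<^sup>2 * (norm H)\<^sup>2"
    using Cauchy_Schwarz_ineq[of ?D H] by (simp add: power2_norm_eq_inner)
  also have "\<dots> \<le> (1 - \<delta>) * (norm H)\<^sup>2"
    using D by (rule mult_right_mono) simp
  finally show ?thesis
    by (simp add: t_def)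
qed

lemma norm_hessian_square: "(norm (hessian v x))\<^sup>2 = (\<Sum>i\<in>UNIV. \<Sum>j\<in>UNIV. (hess_entry v i j x)\<^sup>2)"
  unfolding power2_norm_eq_inner matrix_inner_eq by (simp add: hessian_nth power2_eq_square)

lemma laplacian_eq_trace: "laplacian v x = trace (hessian v x)"
  by (simp add: laplacian_eq trace_def hessian_nth)

text \<open>
  Banach's fixed point theorem for the seminorm, with a fixed point modulo null sets. The constant
  \<open>B\<close> in the proof, the sum of a geometric series, bounds the distance of every iterate from the
  initial function, and \<open>\<theta> ^ m * B\<close> then bounds the distance of the \<open>m\<close>-th iterate from all later
  ones.
\<close>

lemma L2_contraction_fixed_point:
  fixes \<Phi> :: "(real^'n \<Rightarrow> real) \<Rightarrow> real^'n \<Rightarrow> real"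
  assumes \<Phi>: "\<And>u. u \<in> L2_per \<Longrightarrow> \<Phi> u \<in> L2_per"
    and contr: "\<And>u w. u \<in> L2_per \<Longrightarrow> w \<in> L2_per \<Longrightarrow>
      L2_norm (\<lambda>x. \<Phi> u x - \<Phi> w x) \<le> \<theta> * L2_norm (\<lambda>x. u x - w x)"
    and \<theta>: "0 \<le> \<theta>" "\<theta> < 1"
  shows "\<exists>u\<in>L2_per. AE x in cell. \<Phi> u x = u x"
proof -
  define G where "G m = (\<Phi> ^^ m) (\<lambda>x. 0)" for m
  have G_Suc: "G (Suc m) = \<Phi> (G m)" for m
    by (simp add: G_def)
  have GL: "G m \<in> L2_per" for m
    by (induction m) (simp_all add: G_Suc \<Phi>, simp add: G_def)
  define B where "B = L2_norm (\<lambda>x. G 1 x - G 0 x) / (1 - \<theta>)"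
  have B: "0 \<le> B"
    using \<theta> by (simp add: B_def)
  have B_eq: "\<theta> * B + L2_norm (\<lambda>x. G 1 x - G 0 x) = B"
    using \<theta> by (simp add: B_def field_simps)
  have bound: "L2_norm (\<lambda>x. G k x - G 0 x) \<le> B" for k
  proof (induction k)
    case 0
    then show ?case
      using B L2_norm_const[of 0, where 'a='n] by simp
  next
    case (Suc k)
    have "L2_norm (\<lambda>x. G (Suc k) x - G 0 x)
        \<le> L2_norm (\<lambda>x. G (Suc k) x - G 1 x) + L2_norm (\<lambda>x. G 1 x - G 0 x)"
      by (rule L2_norm_triangle_diff[OF GL GL GL])
    also have "L2_norm (\<lambda>x. G (Suc k) x - G 1 x) \<le> \<theta> * L2_norm (\<lambda>x. G k x - G 0 x)"
      using contr[OF GL[of k] GL[of 0]] by (simp add: G_Suc[symmetric])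
    also have "\<dots> \<le> \<theta> * B"
      using Suc \<theta>(1) by (rule mult_left_mono)
    finally show ?case
      using B_eq by simp
  qed
  have shift: "L2_norm (\<lambda>x. G (m + k) x - G m x) \<le> \<theta> ^ m * B" for m k
  proof (induction m)
    case 0
    then show ?case using bound by simp
  next
    case (Suc m)
    have "L2_norm (\<lambda>x. G (Suc m + k) x - G (Suc m) x) \<le> \<theta> * L2_norm (\<lambda>x. G (m + k) x - G m x)"
      using contr[OF GL GL] by (simp add: G_Suc)
    also have "\<dots> \<le> \<theta> * (\<theta> ^ m * B)"
      using Suc \<theta>(1) by (rule mult_left_mono)
    finally show ?case
      by (simp add: mult.assoc)
  qed
  have pow: "(\<lambda>m. \<theta> ^ m * B) \<longlonglongrightarrow> 0"
    using LIMSEQ_power_zero[of \<theta>] \<theta> by (intro tendsto_mult_left_zero) simp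
  have "\<exists>u. L2_lim G u"
  proof (rule L2_complete[OF GL])
    fix e :: real assume e: "0 < e"
    have "\<forall>\<^sub>F m in sequentially. \<theta> ^ m * B < e / 2"
      using pow e by (intro order_tendstoD(2)[where y=0]) auto
    then obtain N where N: "\<theta> ^ N * B < e / 2"
      by (auto simp: eventually_sequentially)
    have near: "L2_norm (\<lambda>x. G i x - G N x) < e / 2" if "i \<ge> N" for i
      using shift[of N "i - N"] N that by simp
    have "L2_norm (\<lambda>x. G i x - G j x) < e" if "i \<ge> N" "j \<ge> N" for i j
      using L2_norm_triangle_diff[OF GL[of i] GL[of N] GL[of j]] near[OF that(1)] near[OF that(2)]
      by (simp add: L2_norm_diff_commute[of "G N"])
    then show "\<exists>N. \<forall>i\<ge>N. \<forall>j\<ge>N. L2_norm (\<lambda>x. G i x - G j x) < e"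
      by blast
  qed
  then obtain u where u: "L2_lim G u" by blast
  then have uL: "u \<in> L2_per" and lim: "(\<lambda>m. L2_norm (\<lambda>x. G m x - u x)) \<longlonglongrightarrow> 0"
    by (auto simp: L2_lim_def)
  have "L2_lim (\<lambda>m. G (Suc m)) (\<Phi> u)"
  proof -
    have "(\<lambda>m. L2_norm (\<lambda>x. G (Suc m) x - \<Phi> u x)) \<longlonglongrightarrow> 0"
    proof (rule tendsto_sandwich[where f="\<lambda>_. 0"])
      show "(\<lambda>m. \<theta> * L2_norm (\<lambda>x. G m x - u x)) \<longlonglongrightarrow> 0"
        using lim by (rule tendsto_mult_right_zero)
      show "\<forall>\<^sub>F m in sequentially. L2_norm (\<lambda>x. G (Suc m) x - \<Phi> u x) \<le> \<theta> * L2_norm (\<lambda>x. G m x - u x)"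
        using contr[OF GL uL] by (simp add: G_Suc)
    qed auto
    then show ?thesis
      using GL \<Phi>[OF uL] by (simp add: L2_lim_def)
  qed
  moreover have "L2_lim (\<lambda>m. G (Suc m)) u"
    using u LIMSEQ_Suc[OF lim] by (simp add: L2_lim_def)
  ultimately have "AE x in cell. \<Phi> u x = u x"
    by (rule L2_lim_unique)
  then show ?thesis
    using uL by blast
qed

section \<open>Operators near the Laplacian\<close>

locale cordes_coefficient =
  fixes A :: "real^'n \<Rightarrow> real^'n^'n" and l L \<delta> :: real
  assumes l: "0 < l" and L: "0 < L" and A: "A \<in> coeff_class l L" and \<delta>: "0 < \<delta>" "\<delta> \<le> 1" and cordes: "cordes \<delta> A"
begin

abbreviation \<gamma> :: "real^'n \<Rightarrow> real" where
  "\<gamma> \<equiv> cordes_scaling A"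

definition A_hess :: "(real^'n \<Rightarrow> real) \<Rightarrow> real^'n \<Rightarrow> real" where
  "A_hess v x = A x \<bullet> hessian v x"

definition \<theta> :: real where
  "\<theta> = sqrt (1 - \<delta>)"

lemma \<theta>: "0 \<le> \<theta>" "\<theta> < 1" "\<theta>\<^sup>2 = 1 - \<delta>"
proof -
  show "0 \<le> \<theta>" and sq: "\<theta>\<^sup>2 = 1 - \<delta>"
    using \<delta> by (auto simp: \<theta>_def)
  show "\<theta> < 1"
    using \<delta> by (simp add: \<theta>_def)
qed

lemma A_measurable: "A \<in> borel_measurable lebesgue"
  and A_periodic: "ae_periodic A"
  and A_bounded: "\<exists>C. AE x in lebesgue. norm (A x) \<le> C"
  and A_elliptic: "AE x in lebesgue. \<forall>\<xi>. \<xi> \<noteq> 0 \<longrightarrow>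
        l * (norm \<xi>)\<^sup>2 \<le> (A x *v \<xi>) \<bullet> \<xi> \<and> (A x *v \<xi>) \<bullet> \<xi> \<le> L * (norm \<xi>)\<^sup>2"
  using A by (auto simp: coeff_class_def)

lemma A_comp_measurable:
  assumes "continuous_on UNIV F"
  shows "(\<lambda>x. F (A x)) \<in> borel_measurable lebesgue"
  using assms A_measurable by (rule borel_measurable_continuous_on)

lemma \<gamma>_measurable: "\<gamma> \<in> borel_measurable lebesgue"
proof -
  have "(\<lambda>x. trace (A x) / (norm (A x))\<^sup>2) \<in> borel_measurable lebesgue"
    unfolding trace_def by (intro borel_measurable_divide A_comp_measurable continuous_intros)
  then show ?thesis
    by (simp add: cordes_scaling_def[abs_def])
qed

lemma \<gamma>_periodic: "ae_periodic \<gamma>"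
  unfolding cordes_scaling_def[abs_def] using A_periodic by (rule ae_periodic_comp)

lemma \<gamma>_pos: "AE x in lebesgue. 0 < \<gamma> x"
  using A_elliptic by eventually_elim (use elliptic_scaling_pos[OF _ l] in \<open>auto simp: cordes_scaling_def\<close>)

lemma \<gamma>_le: "AE x in lebesgue. \<gamma> x \<le> L / l\<^sup>2"
  using A_elliptic by eventually_elim (use elliptic_scaling_le[OF _ l] in \<open>auto simp: cordes_scaling_def\<close>)

lemma \<gamma>_bounded: "AE x in lebesgue. \<bar>\<gamma> x\<bar> \<le> L / l\<^sup>2"
  using \<gamma>_pos \<gamma>_le by eventually_elim simp

lemma inverse_\<gamma>_L2_per: "(\<lambda>x. inverse (\<gamma> x)) \<in> L2_per"
proof -
  obtain C where C: "AE x in lebesgue. norm (A x) \<le> C"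
    using A_bounded by blast
  have "AE x in lebesgue. \<bar>inverse (\<gamma> x)\<bar> \<le> C\<^sup>2 / (real CARD('n) * l)"
    using C A_elliptic \<gamma>_pos
  proof eventually_elim
    case (elim x)
    have tr: "real CARD('n) * l \<le> trace (A x)"
      using elim(2) by (intro elliptic_trace[OF _ l]) blast
    have "\<bar>inverse (\<gamma> x)\<bar> = inverse (\<gamma> x)"
      using elim(3) by (simp only: abs_of_pos positive_imp_inverse_positive)
    also have "\<dots> = (norm (A x))\<^sup>2 / trace (A x)"
      by (simp add: cordes_scaling_def)
    also have "\<dots> \<le> C\<^sup>2 / (real CARD('n) * l)"
      using elim(1) tr l by (intro frac_le power_mono) auto
    finally show ?case .
  qed
  then show ?thesis
    using \<gamma>_measurable ae_periodic_comp[OF \<gamma>_periodic, of inverse]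
    by (intro L2_per_bounded borel_measurable_inverse)
qed

lemma \<gamma>_mult_L2_per: "u \<in> L2_per \<Longrightarrow> (\<lambda>x. \<gamma> x * u x) \<in> L2_per"
  by (rule L2_per_bounded_mult[OF \<gamma>_measurable \<gamma>_periodic \<gamma>_bounded])

lemma \<gamma>_L2_per: "\<gamma> \<in> L2_per"
  by (rule L2_per_bounded[OF \<gamma>_measurable \<gamma>_periodic \<gamma>_bounded])

lemma A_hess_L2_per:
  assumes v: "v \<in> H_per 2"
  shows "A_hess v \<in> L2_per"
proof -
  obtain C where C: "AE x in lebesgue. norm (A x) \<le> C"
    using A_bounded by blast
  have "(\<lambda>x. A x $ i $ j * hess_entry v i j x) \<in> L2_per" for i j
  proof (rule L2_per_bounded_mult)
    show "(\<lambda>x. A x $ i $ j) \<in> borel_measurable lebesgue"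
      by (intro A_comp_measurable continuous_intros)
    show "ae_periodic (\<lambda>x. A x $ i $ j)"
      using A_periodic by (rule ae_periodic_comp)
    show "AE x in lebesgue. \<bar>A x $ i $ j\<bar> \<le> C"
      using C
    proof eventually_elim
      case (elim x)
      have "\<bar>A x $ i $ j\<bar> \<le> norm (A x $ i)"
        by (rule component_le_norm_cart)
      also have "\<dots> \<le> norm (A x)"
        by (rule Finite_Cartesian_Product.norm_nth_le)
      finally show ?case
        using elim by simp
    qed
  qed (rule hess_entry_L2_per[OF v])
  then have "(\<lambda>x. \<Sum>i\<in>UNIV. \<Sum>j\<in>UNIV. A x $ i $ j * hess_entry v i j x) \<in> L2_per"
    by (intro L2_per_sum)
  then show ?thesis
    by (simp add: A_hess_def[abs_def] matrix_inner_eq hessian_nth)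
qed

lemma A_hess_diff:
  assumes "v \<in> H_per 2" "w \<in> H_per 2"
  shows "AE x in cell. A_hess (\<lambda>x. v x - w x) x = A_hess v x - A_hess w x"
  using hessian_diff_AE[OF assms] by eventually_elim (simp add: A_hess_def inner_diff_right)

text \<open>
  After scaling by \<open>\<gamma>\<close>, the operator is a perturbation of the Laplacian of relative size \<open>\<theta> < 1\<close>:
  the pointwise Cordes bound involves the full Hessian, and the Miranda--Talenti identity turns it
  into a bound by the Laplacian.
\<close>

lemma near_Laplacian:
  assumes v: "v \<in> H_per 2"
  shows "L2_norm (\<lambda>x. laplacian v x - \<gamma> x * A_hess v x) \<le> \<theta> * L2_norm (laplacian v)"
proof (rule power2_le_imp_le)
  let ?d = "\<lambda>x. laplacian v x - \<gamma> x * A_hess v x"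
  have dL: "?d \<in> L2_per"
    using v by (intro L2_per_diff laplacian_L2_per \<gamma>_mult_L2_per A_hess_L2_per)
  have "AE x in lebesgue. (?d x)\<^sup>2 \<le> (1 - \<delta>) * (\<Sum>i\<in>UNIV. \<Sum>j\<in>UNIV. (hess_entry v i j x)\<^sup>2)"
    using A_elliptic cordes[unfolded cordes_def]
  proof eventually_elim
    case (elim x)
    have ell: "l * (norm \<xi>)\<^sup>2 \<le> (A x *v \<xi>) \<bullet> \<xi> \<and> (A x *v \<xi>) \<bullet> \<xi> \<le> L * (norm \<xi>)\<^sup>2" if "\<xi> \<noteq> 0" for \<xi>
      using elim(1) that by blast
    have "0 < real CARD('n) * l"
      using l by simp
    also have "\<dots> \<le> trace (A x)"
      using ell l by (rule elliptic_trace)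
    finally show ?case
      using Cordes_near_identity[OF _ elliptic_norm[OF ell l] \<delta>(1) elim(2), of "hessian v x"]
      by (simp add: norm_hessian_square laplacian_eq_trace A_hess_def cordes_scaling_def)
  qed
  then have ae: "AE x in cell. (?d x)\<^sup>2 \<le> (1 - \<delta>) * (\<Sum>i\<in>UNIV. \<Sum>j\<in>UNIV. (hess_entry v i j x)\<^sup>2)"
    by (rule AE_cell_if_AE_lebesgue)
  have sq: "(L2_norm u)\<^sup>2 = integral\<^sup>L cell (\<lambda>x. (u x)\<^sup>2)" for u :: "real^'n \<Rightarrow> real"
    by (simp only: L2_norm_square L2_inner_def cell_integral_def flip: power2_eq_square)
  have int: "integrable cell (\<lambda>x. (hess_entry v i j x)\<^sup>2)" for i j
    using v by (intro L2_per_square_integrable hess_entry_L2_per)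
  have "(L2_norm ?d)\<^sup>2 \<le> integral\<^sup>L cell (\<lambda>x. (1 - \<delta>) * (\<Sum>i\<in>UNIV. \<Sum>j\<in>UNIV. (hess_entry v i j x)\<^sup>2))"
    unfolding sq using L2_per_square_integrable[OF dL] int ae
    by (intro integral_mono_AE) auto
  also have "\<dots> = (1 - \<delta>) * (\<Sum>i\<in>UNIV. \<Sum>j\<in>UNIV. (L2_norm (hess_entry v i j))\<^sup>2)"
    using int by (simp add: sq)
  also have "\<dots> = (\<theta> * L2_norm (laplacian v))\<^sup>2"
    by (simp add: Miranda_Talenti[OF v] power_mult_distrib \<theta>(3))
  finally show "(L2_norm ?d)\<^sup>2 \<le> (\<theta> * L2_norm (laplacian v))\<^sup>2" .
qed (use \<theta> in simp)

text \<open>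
  Let \<open>S G\<close> solve the Laplace equation whose right-hand side is \<open>G\<close> minus its mean. A fixed point
  of the map \<open>\<Phi> G = h + \<Delta> (S G) - \<gamma> A : D\<^sup>2 (S G)\<close> yields the solution \<open>S G\<close>, and \<open>\<Phi>\<close> is a
  contraction because the scaled operator is near the Laplacian. The additive constant in the
  conclusion comes from the mean of \<open>G\<close>, which had to be subtracted because a Laplacian always has
  mean zero.
\<close>

lemma solvable_mod_const:
  assumes h: "h \<in> L2_per"
  shows "\<exists>v\<in>H_per 2. \<exists>c. AE x in cell. \<gamma> x * A_hess v x = h x + c"
proof -
  have ex: "\<exists>v. v \<in> H_per 2 \<and> (AE x in cell. laplacian v x = G x - cell_integral G)"
    if G: "G \<in> L2_per" for G :: "real^'n \<Rightarrow> real"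
  proof -
    have "(\<lambda>x. G x - cell_integral G) \<in> L2_per" "cell_integral (\<lambda>x. G x - cell_integral G) = 0"
      using G by (simp_all add: L2_per_diff cell_integral_diff)
    then show ?thesis
      using Laplace_solvable by blast
  qed
  define S where "S G = (SOME v. v \<in> H_per 2 \<and> (AE x in cell. laplacian v x = G x - cell_integral G))"
    for G :: "real^'n \<Rightarrow> real"
  have S: "S G \<in> H_per 2" and lapS: "AE x in cell. laplacian (S G) x = G x - cell_integral G"
    if "G \<in> L2_per" for G
    using someI_ex[OF ex[OF that]] by (simp_all add: S_def)
  define \<Phi> where "\<Phi> G x = h x + (laplacian (S G) x - \<gamma> x * A_hess (S G) x)" for G x
  have "\<exists>G\<in>L2_per. AE x in cell. \<Phi> G x = G x"
  proof (rule L2_contraction_fixed_point[OF _ _ \<theta>(1,2)])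
    show \<Phi>: "\<Phi> G \<in> L2_per" if "G \<in> L2_per" for G
      unfolding \<Phi>_def[abs_def] using h S[OF that]
      by (intro L2_per_add L2_per_diff laplacian_L2_per \<gamma>_mult_L2_per A_hess_L2_per)
    fix G G' :: "real^'n \<Rightarrow> real" assume G: "G \<in> L2_per" and G': "G' \<in> L2_per"
    let ?z = "\<lambda>x. S G x - S G' x"
    have z: "?z \<in> H_per 2"
      using S[OF G] S[OF G'] by (rule H_per_2_diff)
    have GG: "(\<lambda>x. G x - G' x) \<in> L2_per"
      using G G' by (rule L2_per_diff)
    have "L2_norm (\<lambda>x. \<Phi> G x - \<Phi> G' x) = L2_norm (\<lambda>x. laplacian ?z x - \<gamma> x * A_hess ?z x)"
    proof (rule L2_norm_cong_AE)
      show "(\<lambda>x. \<Phi> G x - \<Phi> G' x) \<in> L2_per"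
        using \<Phi> G G' by (intro L2_per_diff)
      show "(\<lambda>x. laplacian ?z x - \<gamma> x * A_hess ?z x) \<in> L2_per"
        using z by (intro L2_per_diff laplacian_L2_per \<gamma>_mult_L2_per A_hess_L2_per)
      show "AE x in cell. \<Phi> G x - \<Phi> G' x = laplacian ?z x - \<gamma> x * A_hess ?z x"
        using laplacian_diff_AE[OF S[OF G] S[OF G']] A_hess_diff[OF S[OF G] S[OF G']]
        by eventually_elim (simp add: \<Phi>_def right_diff_distrib)
    qed
    also have "\<dots> \<le> \<theta> * L2_norm (laplacian ?z)"
      using z by (rule near_Laplacian)
    also have "L2_norm (laplacian ?z) = L2_norm (\<lambda>x. (G x - G' x) - cell_integral (\<lambda>x. G x - G' x))"
    proof (rule L2_norm_cong_AE)
      show "AE x in cell. laplacian ?z x = (G x - G' x) - cell_integral (\<lambda>x. G x - G' x)"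
        using laplacian_diff_AE[OF S[OF G] S[OF G']] lapS[OF G] lapS[OF G']
        by eventually_elim (simp add: cell_integral_diff[OF G G'])
      show "laplacian ?z \<in> L2_per"
        using z by (rule laplacian_L2_per)
      show "(\<lambda>x. (G x - G' x) - cell_integral (\<lambda>x. G x - G' x)) \<in> L2_per"
        using GG L2_per_const by (rule L2_per_diff)
    qed
    also have "\<dots> \<le> L2_norm (\<lambda>x. G x - G' x)"
      using GG by (rule L2_norm_minus_mean_le)
    finally show "L2_norm (\<lambda>x. \<Phi> G x - \<Phi> G' x) \<le> \<theta> * L2_norm (\<lambda>x. G x - G' x)"
      using \<theta>(1) by (simp add: mult_left_mono)
  qed
  then obtain G where G: "G \<in> L2_per" "AE x in cell. \<Phi> G x = G x"
    by blast
  have "AE x in cell. \<gamma> x * A_hess (S G) x = h x + (- cell_integral G)"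
    using G(2) lapS[OF G(1)] by eventually_elim (simp add: \<Phi>_def)
  then show ?thesis
    using S[OF G(1)] by blast
qed

text \<open>
  The Laplacian of \<open>w\<close> equals its own difference from the scaled operator, so its norm is at most
  \<open>\<theta> < 1\<close> times itself.
\<close>

lemma A_hess_zero_harmonic:
  assumes w: "w \<in> H_per 2" and zero: "AE x in cell. A_hess w x = 0"
  shows "AE x in cell. w x = cell_integral w"
proof -
  have "L2_norm (laplacian w) = L2_norm (\<lambda>x. laplacian w x - \<gamma> x * A_hess w x)"
    using w zero by (intro L2_norm_cong_AE L2_per_diff laplacian_L2_per \<gamma>_mult_L2_per A_hess_L2_per)
      (auto elim: eventually_mono)
  also have "\<dots> \<le> \<theta> * L2_norm (laplacian w)"
    using w by (rule near_Laplacian)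
  finally have "(1 - \<theta>) * L2_norm (laplacian w) \<le> 0"
    by (simp add: algebra_simps)
  then have "L2_norm (laplacian w) = 0"
    using \<theta>(2) L2_norm_nonneg[of "laplacian w"] by (simp add: mult_le_0_iff)
  then have "AE x in cell. laplacian w x = 0"
    by (rule L2_norm_zero_AE[OF laplacian_L2_per[OF w]])
  then show ?thesis
    by (rule weakly_harmonic_const[OF w])
qed

lemma is_solution_iff:
  "is_solution A f v \<longleftrightarrow> v \<in> H_per 2 \<and> (AE x in cell. A_hess v x = - f x)"
proof -
  have "(- A_hess v x = f x) \<longleftrightarrow> (A_hess v x = - f x)" for x
    by auto
  then show ?thesis
    by (simp add: is_solution_def A_hess_def)
qed

text \<open>
  The Laplacian is split into its difference from the scaled operator, which is absorbed on the
  left-hand side, and \<open>- \<gamma> f\<close>. The factor \<open>1 / (1 - \<theta>)\<close> is the Cordes constant.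
\<close>

lemma solution_norm_bound:
  assumes f: "f \<in> L2_per" and v: "is_solution A f v"
  shows "L2_norm (laplacian v) \<le> L / l\<^sup>2 * cordes_const \<delta> * L2_norm f"
proof -
  have v2: "v \<in> H_per 2" and eq: "AE x in cell. A_hess v x = - f x"
    using v by (auto simp: is_solution_iff)
  have mem: "laplacian v \<in> L2_per" "(\<lambda>x. \<gamma> x * A_hess v x) \<in> L2_per"
    using v2 by (auto intro: laplacian_L2_per \<gamma>_mult_L2_per A_hess_L2_per)
  have "L2_norm (\<lambda>x. \<gamma> x * A_hess v x) \<le> L2_norm (\<lambda>x. L / l\<^sup>2 * f x)"
  proof (rule L2_norm_mono_AE[OF mem(2) L2_per_scale[OF f]])
    show "AE x in cell. \<bar>\<gamma> x * A_hess v x\<bar> \<le> \<bar>L / l\<^sup>2 * f x\<bar>"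
      using eq AE_cell_if_AE_lebesgue[OF \<gamma>_bounded]
    proof eventually_elim
      case (elim x)
      then have "\<bar>\<gamma> x\<bar> \<le> \<bar>L / l\<^sup>2\<bar>"
        by linarith
      then show ?case
        unfolding elim(1) abs_mult abs_minus_cancel by (rule mult_right_mono) simp
    qed
  qed
  also have "\<dots> = \<bar>L / l\<^sup>2\<bar> * L2_norm f"
    by (rule L2_norm_scale)
  also have "\<bar>L / l\<^sup>2\<bar> = L / l\<^sup>2"
    using l L by simp
  finally have *: "L2_norm (\<lambda>x. \<gamma> x * A_hess v x) \<le> L / l\<^sup>2 * L2_norm f" .
  have "L2_norm (laplacian v) \<le> L2_norm (\<lambda>x. laplacian v x - \<gamma> x * A_hess v x) + L2_norm (\<lambda>x. \<gamma> x * A_hess v x)"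
    using L2_norm_triangle[OF L2_per_diff[OF mem] mem(2)] by simp
  also have "\<dots> \<le> \<theta> * L2_norm (laplacian v) + L / l\<^sup>2 * L2_norm f"
    using near_Laplacian[OF v2] * by simp
  finally have "(1 - \<theta>) * L2_norm (laplacian v) \<le> L / l\<^sup>2 * L2_norm f"
    by (simp add: algebra_simps)
  then have "L2_norm (laplacian v) \<le> (L / l\<^sup>2 * L2_norm f) / (1 - \<theta>)"
    using \<theta>(2) by (subst pos_le_divide_eq) (simp_all add: mult.commute)
  then show ?thesis
    by (simp add: cordes_const_def \<theta>_def field_simps)
qed

lemma solutions_differ_by_const:
  assumes v: "is_solution A f v" and w: "is_solution A f w"
  shows "AE x in lebesgue. v x - w x = cell_integral (\<lambda>x. v x - w x)"
proof -
  have v2: "v \<in> H_per 2" "AE x in cell. A_hess v x = - f x"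
    and w2: "w \<in> H_per 2" "AE x in cell. A_hess w x = - f x"
    using v w by (auto simp: is_solution_iff)
  have z: "(\<lambda>x. v x - w x) \<in> H_per 2"
    using v2(1) w2(1) by (rule H_per_2_diff)
  have "AE x in cell. A_hess (\<lambda>x. v x - w x) x = 0"
    using A_hess_diff[OF v2(1) w2(1)] v2(2) w2(2) by eventually_elim simp
  then have "AE x in cell. v x - w x = cell_integral (\<lambda>x. v x - w x)"
    by (rule A_hess_zero_harmonic[OF z])
  then show ?thesis
    by (rule ae_periodic_AE_cell[OF L2_per_ae_periodic[OF H_per_2D(1)[OF z]]])
qed

lemma is_solution_diff_const:
  assumes v: "is_solution A f v"
  shows "is_solution A f (\<lambda>x. v x - c)"
proof -
  have v2: "v \<in> H_per 2" and eq: "AE x in cell. A_hess v x = - f x"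
    using v by (auto simp: is_solution_iff)
  have "AE x in (cell :: (real^'n) measure). \<forall>i\<in>UNIV. \<forall>j\<in>UNIV. hess_entry (\<lambda>x::real^'n. c) i j x = 0"
    using hess_entry_const by (intro AE_finite_allI) auto
  then have "AE x in cell. A_hess (\<lambda>x. v x - c) x = - f x"
    using A_hess_diff[OF v2 H_per_2_const[of c]] eq
    by eventually_elim (simp add: A_hess_def matrix_inner_eq hessian_nth)
  then show ?thesis
    using H_per_2_diff[OF v2 H_per_2_const] by (simp add: is_solution_iff)
qed

end

section \<open>Solvability and the invariant measure\<close>

locale cordes_invariant_measure = cordes_coefficient A l L \<delta>
  for A :: "real^'n \<Rightarrow> real^'n^'n" and l L \<delta> +
  fixes r :: "real^'n \<Rightarrow> real"
  assumes r: "invariant_measure A r"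
begin

lemma r_L2_per: "r \<in> L2_per" and r_mean: "cell_integral r = 1"
  using r by (auto simp: invariant_measure_def)

lemma r_orthogonal:
  assumes v: "v \<in> H_per 2"
  shows "L2_inner (A_hess v) r = 0"
proof -
  have "L2_inner r (\<lambda>x. - A_hess v x) = 0"
    using r v by (simp add: invariant_measure_def A_hess_def)
  then show ?thesis
    using L2_inner_scale_right[OF A_hess_L2_per[OF v] r_L2_per, of "-1"] L2_inner_commute[of r "A_hess v"]
    by simp
qed

lemma scaled_equation:
  assumes v: "v \<in> H_per 2" and g: "g \<in> L2_per"
    and eq: "AE x in cell. \<gamma> x * A_hess v x = \<gamma> x * g x + c"
  shows "AE x in cell. A_hess v x = g x + c * inverse (\<gamma> x)"
    and "L2_inner g r + c * L2_inner (\<lambda>x. inverse (\<gamma> x)) r = 0"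
proof -
  show ae: "AE x in cell. A_hess v x = g x + c * inverse (\<gamma> x)"
    using eq AE_cell_if_AE_lebesgue[OF \<gamma>_pos]
  proof eventually_elim
    case (elim x)
    then have "A_hess v x = (\<gamma> x * g x + c) / \<gamma> x"
      by (simp add: eq_divide_eq mult.commute)
    also have "\<dots> = g x + c * inverse (\<gamma> x)"
      using elim(2) by (simp add: field_simps)
    finally show ?case .
  qed
  have cg: "(\<lambda>x. c * inverse (\<gamma> x)) \<in> L2_per"
    using inverse_\<gamma>_L2_per by (rule L2_per_scale)
  have "L2_inner (A_hess v) r = L2_inner (\<lambda>x. g x + c * inverse (\<gamma> x)) r"
    using v g cg ae r_L2_per by (intro L2_inner_cong_AE A_hess_L2_per L2_per_add)
  also have "\<dots> = L2_inner g r + c * L2_inner (\<lambda>x. inverse (\<gamma> x)) r"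
    using g cg r_L2_per inverse_\<gamma>_L2_per by (simp add: L2_inner_add_left L2_inner_scale_left)
  finally show "L2_inner g r + c * L2_inner (\<lambda>x. inverse (\<gamma> x)) r = 0"
    using r_orthogonal[OF v] by simp
qed

text \<open>
  Solving the scaled equation with right-hand side \<open>\<gamma>\<close> up to a constant \<open>c\<close> and testing with the
  invariant measure, whose integral is one, gives \<open>1 + c (1 / \<gamma>, r) = 0\<close>.
\<close>

lemma inverse_\<gamma>_r_nonzero: "L2_inner (\<lambda>x. inverse (\<gamma> x)) r \<noteq> 0"
proof
  assume zero: "L2_inner (\<lambda>x. inverse (\<gamma> x)) r = 0"
  obtain v c where v: "v \<in> H_per 2" "AE x in cell. \<gamma> x * A_hess v x = \<gamma> x + c"
    using solvable_mod_const[OF \<gamma>_L2_per] by blast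
  then have "L2_inner (\<lambda>x. 1) r + c * L2_inner (\<lambda>x. inverse (\<gamma> x)) r = 0"
    by (intro scaled_equation(2)) auto
  then show False
    using zero r_mean by (simp add: L2_inner_commute[of "\<lambda>x. 1"] L2_inner_one)
qed

text \<open>
  Testing with the invariant measure annihilates both the operator and \<open>f\<close>, and leaves a nonzero
  multiple of the constant.
\<close>

lemma solution_if_mod_const:
  assumes f: "f \<in> L2_per" "L2_inner f r = 0" and v: "v \<in> H_per 2"
    and eq: "AE x in cell. \<gamma> x * A_hess v x = \<gamma> x * (- f x) + c"
  shows "is_solution A f v"
proof -
  have "L2_inner (\<lambda>x. - f x) r = 0"
    using f L2_inner_scale_left[OF f(1) r_L2_per, of "-1"] by simp
  then have "c = 0"
    using scaled_equation(2)[OF v L2_per_minus[OF f(1)] eq] inverse_\<gamma>_r_nonzero by simp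
  then show ?thesis
    using scaled_equation(1)[OF v L2_per_minus[OF f(1)] eq] v by (simp add: is_solution_iff)
qed

lemma solvable_iff:
  assumes f: "f \<in> L2_per"
  shows "(\<exists>v. is_solution A f v) \<longleftrightarrow> L2_inner f r = 0"
proof
  assume "\<exists>v. is_solution A f v"
  then obtain v where v: "v \<in> H_per 2" "AE x in cell. A_hess v x = - f x"
    by (auto simp: is_solution_iff)
  have "L2_inner (A_hess v) r = L2_inner (\<lambda>x. - f x) r"
    using v f r_L2_per by (intro L2_inner_cong_AE A_hess_L2_per L2_per_minus)
  also have "\<dots> = - L2_inner f r"
    using L2_inner_scale_left[OF f r_L2_per, of "-1"] by simp
  finally show "L2_inner f r = 0"
    using r_orthogonal[OF v(1)] by simp
next
  assume "L2_inner f r = 0"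
  then show "\<exists>v. is_solution A f v"
    using solvable_mod_const[OF \<gamma>_mult_L2_per[OF L2_per_minus[OF f]]] solution_if_mod_const[OF f]
    by blast
qed

text \<open>
  Laplacians exhaust the functions of mean zero. The variational equation therefore says that the
  scaled residual of the equation is constant, and such a constant must vanish.
\<close>

lemma is_solution_iff_b0:
  assumes f: "f \<in> L2_per" "L2_inner f r = 0" and v: "v \<in> H_per 2"
  shows "is_solution A f v \<longleftrightarrow>
    (\<forall>\<phi>\<in>H_per 2. b0 A v \<phi> = - L2_inner (\<lambda>x. \<gamma> x * f x) (laplacian \<phi>))"
proof -
  let ?E = "\<lambda>x. \<gamma> x * A_hess v x + \<gamma> x * f x"
  note mem1 = \<gamma>_mult_L2_per[OF A_hess_L2_per[OF v]] and mem2 = \<gamma>_mult_L2_per[OF f(1)]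
  note mem = mem1 mem2 L2_per_add[OF mem1 mem2]
  have "b0 A v \<phi> + L2_inner (\<lambda>x. \<gamma> x * f x) (laplacian \<phi>) = L2_inner ?E (laplacian \<phi>)"
    if "\<phi> \<in> H_per 2" for \<phi>
    using mem laplacian_L2_per[OF that] by (simp add: b0_def L2_inner_add_left flip: A_hess_def)
  then have b0: "b0 A v \<phi> = - L2_inner (\<lambda>x. \<gamma> x * f x) (laplacian \<phi>) \<longleftrightarrow> L2_inner ?E (laplacian \<phi>) = 0"
    if "\<phi> \<in> H_per 2" for \<phi>
    using that by (simp add: eq_neg_iff_add_eq_0)
  show ?thesis
  proof
    assume "is_solution A f v"
    then have "AE x in cell. ?E x = 0"
      unfolding is_solution_iff by (auto elim: eventually_mono)
    then have "L2_inner ?E (laplacian \<phi>) = L2_inner (\<lambda>x. 0) (laplacian \<phi>)" if "\<phi> \<in> H_per 2" for \<phi>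
      using mem(3) laplacian_L2_per[OF that] by (intro L2_inner_cong_AE) auto
    then show "\<forall>\<phi>\<in>H_per 2. b0 A v \<phi> = - L2_inner (\<lambda>x. \<gamma> x * f x) (laplacian \<phi>)"
      using b0 by (simp add: L2_inner_def)
  next
    assume "\<forall>\<phi>\<in>H_per 2. b0 A v \<phi> = - L2_inner (\<lambda>x. \<gamma> x * f x) (laplacian \<phi>)"
    then have orth: "L2_inner ?E (laplacian \<phi>) = 0" if "\<phi> \<in> H_per 2" for \<phi>
      using b0 that by blast
    define m where "m = cell_integral ?E"
    let ?Z = "\<lambda>x. ?E x - m"
    have E0: "?Z \<in> L2_per" "cell_integral ?Z = 0"
      using mem(3) by (simp_all add: L2_per_diff cell_integral_diff m_def)
    obtain \<phi> where \<phi>: "\<phi> \<in> H_per 2" "AE x in cell. laplacian \<phi> x = ?Z x"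
      using Laplace_solvable[OF E0] by blast
    have "L2_inner ?Z ?Z = L2_inner ?E ?Z - L2_inner (\<lambda>x. m) ?Z"
      using mem(3) E0(1) by (intro L2_inner_diff_left) auto
    also have "L2_inner (\<lambda>x. m) ?Z = 0"
      using E0(2) by (simp add: L2_inner_def cell_integral_def)
    also have "L2_inner ?E ?Z = L2_inner ?E (laplacian \<phi>)"
      using \<phi> E0(1) mem(3) L2_inner_cong_AE[OF laplacian_L2_per[OF \<phi>(1)] E0(1) mem(3) \<phi>(2)]
      by (simp only: L2_inner_commute[of ?E])
    also have "\<dots> = 0"
      by (rule orth[OF \<phi>(1)])
    finally have "L2_norm ?Z = 0"
      by (simp add: L2_norm_def)
    then have "AE x in cell. ?Z x = 0"
      by (rule L2_norm_zero_AE[OF E0(1)])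
    then have "AE x in cell. \<gamma> x * A_hess v x = \<gamma> x * (- f x) + m"
      by eventually_elim simp
    then show "is_solution A f v"
      by (rule solution_if_mod_const[OF f v])
  qed
qed

lemma unique_solution_with_mean:
  assumes f: "f \<in> L2_per" "L2_inner f r = 0"
  shows "\<exists>v. is_solution A f v \<and> cell_integral v = m \<and>
    (\<forall>w. is_solution A f w \<and> cell_integral w = m \<longrightarrow> (AE x in lebesgue. w x = v x))"
proof -
  obtain u where u: "is_solution A f u"
    using solvable_iff f by blast
  have L2: "w \<in> L2_per" if "is_solution A f w" for w
    using that by (auto simp: is_solution_iff dest: H_per_2D(1))
  let ?v = "\<lambda>x. u x - (cell_integral u - m)"
  have v: "is_solution A f ?v"
    using u by (rule is_solution_diff_const)
  moreover have vm: "cell_integral ?v = m"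
    using L2[OF u] by (simp add: cell_integral_diff)
  moreover have "AE x in lebesgue. w x = ?v x" if w: "is_solution A f w" "cell_integral w = m" for w
    using solutions_differ_by_const[OF w(1) v] w(2) vm cell_integral_diff[OF L2[OF w(1)] L2[OF v]]
    by simp
  ultimately show ?thesis
    by blast
qed

end

theorem theorem3p3:
  fixes A :: "real^'n \<Rightarrow> real^'n^'n"
    and f r :: "real^'n \<Rightarrow> real"
    and l L \<delta> :: real
  assumes f: "f \<in> L2_per"
    and l: "0 < l" and L: "0 < L"
    and A: "A \<in> coeff_class l L"
    and \<delta>: "0 < \<delta>" "\<delta> \<le> 1"
    and cordes: "cordes \<delta> A"
    and r: "invariant_measure A r"
  shows
    "(((\<exists>v. is_solution A f v) \<longleftrightarrow> L2_inner f r = 0) \<and>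
      (L2_inner f r = 0 \<longrightarrow>
        (\<forall>v\<in>H_per 2. is_solution A f v \<longleftrightarrow>
           (\<forall>\<phi>\<in>H_per 2. b0 A v \<phi> =
              - L2_inner (\<lambda>x. cordes_scaling A x * f x) (laplacian \<phi>)))))
     \<and>
     (L2_inner f r = 0 \<longrightarrow>
        (\<forall>v1 v2. is_solution A f v1 \<and> is_solution A f v2 \<longrightarrow>
           (\<exists>c. AE x in lebesgue. v1 x - v2 x = c)) \<and>
        (\<forall>m. \<exists>v. is_solution A f v \<and> cell_integral v = m \<and>
           (\<forall>w. is_solution A f w \<and> cell_integral w = m \<longrightarrow>
              (AE x in lebesgue. w x = v x))))
     \<and>
     (L2_inner f r = 0 \<longrightarrow>
        (\<forall>v0\<in>H_per0 2. is_solution A f v0 \<longrightarrow>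
           L2_norm (laplacian v0) \<le> L / l\<^sup>2 * cordes_const \<delta> * L2_norm f))"
proof -
  interpret cordes_invariant_measure A l L \<delta> r
    using l L A \<delta> cordes r by unfold_locales
  show ?thesis
    using solvable_iff[OF f] is_solution_iff_b0[OF f] solutions_differ_by_const
      unique_solution_with_mean[OF f] solution_norm_bound[OF f]
    by blast
qed

end
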